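(* Consider the stochastic block model $G_N$ with $M$ blocks of equal size $N/M$, intra-block edge probabilities $p_1(N)\ge\dots\ge p_M(N)$ and inter-block edge probability $q(N)$, with all parameters as defined in the context, and assume that the limit $\kappa=\lim_{N\to\infty}\frac{(M-1)q}{p_{\min}}\in[0,\infty]$ exists. Let $w\in V_N$ be a vertex with block number $m=B(w)$. Assume that for every $l=1,\dots,M$ $$\frac{M\log^4N}{Np_l(1-p_l)+N(M-1)q(1-q)}\cdot\frac{p_{\max}^2}{p_{\min}^2}\xrightarrow[N\to\infty]{}0,$$ and that $$\frac{\gamma_m}{\bar\gamma}\ll\frac{\upsilon_m}{\bar p},\qquad \frac{\bar\upsilon}{\upsilon_m}\cdot\frac{\gamma_m}{\bar\gamma}\ll\sqrt N,\qquad \frac{\gamma_m}{\upsilon_m}\cdot\frac{p_{\min}^2}{\gamma_{\min}(M-1)^2q^2}\xrightarrow[N\to\infty]{}0.$$ Then $$\frac{\gamma_m^2}{N\upsilon_m\bar\gamma}\cdot\Big(H_w-\frac{N\bar\gamma}{\gamma_m}\Big)\Longrightarrow\mathcal N(0,1)\qquad(N\to\infty),$$ where $\Longrightarrow$ denotes convergence in distribution.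
   Context: Model: $M$ is the (fixed) number of blocks and $N\to\infty$ runs through multiples of $M$ with $M<N$. The vertex set $V=V_N=\{1,\dots,N\}$ is partitioned into blocks $V^{(1)},\dots,V^{(M)}$ of size $N/M$ each; $B(v)$ denotes the number of the block containing $v$. $p_1\ge\dots\ge p_M$ and $q$ are numbers in $[0,1]$ depending on $N$ (the argument $N$ is often suppressed). In the random graph $G_N=(V_N,E_N)$ the edge indicators $\varepsilon_{v,w}\in\{0,1\}$ of the unordered pairs $\{v,w\}$ (loops $v=w$ allowed) are independent; $\varepsilon_{v,w}=1$ with probability $p_m$ if $v,w$ are both in $V^{(m)}$, and with probability $q$ if they are in different blocks. Put $a_{v,w}=\varepsilon_{v,w}$ and $d_v=\sum_{w\in V}a_{v,w}$ (a loop counts once). $E$ is the edge set (including loops) and $L$ the set of loops, so $\sum_v d_v=2|E|-|L|$. Parameters: $\gamma_m=\frac NM p_m+(M-1)\frac NM q$ (expected degree in block $m$), $\gamma_{\min}=\min_m\gamma_m$, $p_{\min}=\min_m p_m$, $p_{\max}=\max_m p_m$, $\bar p=\frac1M\sum_{m=1}^Mp_m$, $\bar\gamma=\frac1M\sum_{m=1}^M\gamma_m$, $\upsilon_m^2=\frac NMp_m(1-p_m)+(M-1)\frac NMq(1-q)$ (variance of the degree in block $m$), $\upsilon_m=\sqrt{\upsilon_m^2}$, $\bar\upsilon^2=\frac1M\sum_{m=1}^M\upsilon_m^2$, $\bar\upsilon=\sqrt{\bar\upsilon^2}$. Random walk: for a realization of $G_N$, the simple random walk in discrete time jumps from $v$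 to $w$ with probability $1/d_v$ if $\{v,w\}\in E$, and $0$ otherwise. Its invariant distribution is $\pi_v=d_v/(2|E|-|L|)$. $H_{vw}$ is the expected time for the walk started in $v$ to reach $w$ (so $H_{ww}=0$), a random variable through the graph. Define $H_w=\sum_{v\in V}\pi_vH_{vw}$. The realization is tacitly assumed connected. Convention: $a_N\ll b_N$ means $a_N/b_N\to0$. *)

theory Defs
  imports "HOL-Probability.Probability"
begin

section \<open>The stochastic block model\<close>

definition verts :: "nat \<Rightarrow> nat set" where
  "verts N = {1..N}"

text \<open>Partition of the vertices into the \<open>M\<close> blocks \<open>{v \<in> verts N. B v = m}\<close>, all of the same size.\<close>

definition equal_blocks :: "nat \<Rightarrow> nat \<Rightarrow> (nat \<Rightarrow> nat) \<Rightarrow> bool" where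
  "equal_blocks M N B \<longleftrightarrow>
     B ` verts N \<subseteq> {1..M} \<and> (\<forall>m\<in>{1..M}. M * card {v \<in> verts N. B v = m} = N)"

text \<open>The unordered pairs of vertices; the loop at \<open>v\<close> is the singleton \<open>{v, v} = {v}\<close>.\<close>

definition vpairs :: "nat \<Rightarrow> nat set set" where
  "vpairs N = {{v, w} | v w. v \<in> verts N \<and> w \<in> verts N}"

definition edge_prob :: "(nat \<Rightarrow> nat) \<Rightarrow> (nat \<Rightarrow> real) \<Rightarrow> real \<Rightarrow> nat set \<Rightarrow> real" where
  "edge_prob B p q e = (if is_singleton (B ` e) then p (the_elem (B ` e)) else q)"

text \<open>A realization of the random graph is the family \<open>\<epsilon>\<close> of its edge indicators, with value
  \<open>False\<close> outside \<open>vpairs N\<close>.\<close>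

type_synonym graph = "nat set \<Rightarrow> bool"

definition sbm :: "nat \<Rightarrow> (nat \<Rightarrow> nat) \<Rightarrow> (nat \<Rightarrow> real) \<Rightarrow> real \<Rightarrow> graph pmf" where
  "sbm N B p q = Pi_pmf (vpairs N) False (\<lambda>e. bernoulli_pmf (edge_prob B p q e))"

lemma edge_prob_pair:
  "edge_prob B p q {v, w} = (if B v = B w then p (B v) else q)"
  by (auto simp: edge_prob_def is_singleton_def)

definition edges :: "nat \<Rightarrow> graph \<Rightarrow> nat set set" where
  "edges N \<epsilon> = {e \<in> vpairs N. \<epsilon> e}"

definition loops :: "nat \<Rightarrow> graph \<Rightarrow> nat set set" where
  "loops N \<epsilon> = {e \<in> edges N \<epsilon>. is_singleton e}"

definition adj :: "graph \<Rightarrow> nat \<Rightarrow> nat \<Rightarrow> nat" where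
  "adj \<epsilon> v w = of_bool (\<epsilon> {v, w})"

definition deg :: "nat \<Rightarrow> graph \<Rightarrow> nat \<Rightarrow> nat" where
  "deg N \<epsilon> v = (\<Sum>w\<in>verts N. adj \<epsilon> v w)"

definition connected_graph :: "nat \<Rightarrow> graph \<Rightarrow> bool" where
  "connected_graph N \<epsilon> \<longleftrightarrow>
     (\<forall>v\<in>verts N. \<forall>w\<in>verts N.
        (v, w) \<in> {(x, y). x \<in> verts N \<and> y \<in> verts N \<and> \<epsilon> {x, y}}\<^sup>*)"


section \<open>The parameters\<close>

definition p_min :: "nat \<Rightarrow> (nat \<Rightarrow> real) \<Rightarrow> real" where
  "p_min M p = Min (p ` {1..M})"

definition p_max :: "nat \<Rightarrow> (nat \<Rightarrow> real) \<Rightarrow> real" where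
  "p_max M p = Max (p ` {1..M})"

definition block_avg :: "nat \<Rightarrow> (nat \<Rightarrow> real) \<Rightarrow> real" where
  "block_avg M f = (1 / real M) * (\<Sum>m=1..M. f m)"

definition exp_deg :: "nat \<Rightarrow> nat \<Rightarrow> (nat \<Rightarrow> real) \<Rightarrow> real \<Rightarrow> nat \<Rightarrow> real" where
  "exp_deg M N p q m = (real N / real M) * p m + (real M - 1) * (real N / real M) * q"

definition exp_deg_min :: "nat \<Rightarrow> nat \<Rightarrow> (nat \<Rightarrow> real) \<Rightarrow> real \<Rightarrow> real" where
  "exp_deg_min M N p q = Min (exp_deg M N p q ` {1..M})"

definition exp_deg_avg :: "nat \<Rightarrow> nat \<Rightarrow> (nat \<Rightarrow> real) \<Rightarrow> real \<Rightarrow> real" where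
  "exp_deg_avg M N p q = block_avg M (exp_deg M N p q)"

definition var_deg :: "nat \<Rightarrow> nat \<Rightarrow> (nat \<Rightarrow> real) \<Rightarrow> real \<Rightarrow> nat \<Rightarrow> real" where
  "var_deg M N p q m = (real N / real M) * p m * (1 - p m)
                     + (real M - 1) * (real N / real M) * q * (1 - q)"

definition sd_deg :: "nat \<Rightarrow> nat \<Rightarrow> (nat \<Rightarrow> real) \<Rightarrow> real \<Rightarrow> nat \<Rightarrow> real" where
  "sd_deg M N p q m = sqrt (var_deg M N p q m)"

text \<open>The square root of the averaged variance, not the average of the standard deviations.\<close>

definition sd_deg_avg :: "nat \<Rightarrow> nat \<Rightarrow> (nat \<Rightarrow> real) \<Rightarrow> real \<Rightarrow> real" where
  "sd_deg_avg M N p q = sqrt (block_avg M (var_deg M N p q))"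


section \<open>The simple random walk and its hitting times\<close>

text \<open>The walk moves to a uniformly chosen neighbour. An isolated vertex, which a connected graph
  on at least two vertices does not have, is made absorbing.\<close>

definition walk_step :: "nat \<Rightarrow> graph \<Rightarrow> nat \<Rightarrow> nat pmf" where
  "walk_step N \<epsilon> v = (let A = {w \<in> verts N. \<epsilon> {v, w}} in
     if A = {} then return_pmf v else pmf_of_set A)"

lemma deg_eq_card: "deg N \<epsilon> v = card {w \<in> verts N. \<epsilon> {v, w}}"
proof -
  have "finite (verts N)" by (simp add: verts_def)
  then show ?thesis unfolding deg_def adj_def by (simp add: Int_def)
qed

lemma pmf_walk_step:
  assumes "deg N \<epsilon> v > 0" "w \<in> verts N"
  shows "pmf (walk_step N \<epsilon> v) w = real (adj \<epsilon> v w) / real (deg N \<epsilon> v)"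
proof -
  let ?A = "{w \<in> verts N. \<epsilon> {v, w}}"
  have fin: "finite ?A" by (simp add: verts_def)
  moreover have ne: "?A \<noteq> {}" using assms(1) fin by (auto simp: deg_eq_card card_gt_0_iff)
  ultimately show ?thesis
    using assms(2)
    unfolding walk_step_def Let_def if_not_P[OF ne] pmf_of_set[OF ne fin] deg_eq_card adj_def
    by (simp add: indicator_def)
qed

text \<open>Transition kernels in the format of \<^locale>\<open>Ionescu_Tulcea\<close>: the law of the state at time
  \<open>t\<close>, given the history \<open>h\<close> of the states before \<open>t\<close>.\<close>

definition walk_kernel :: "nat \<Rightarrow> graph \<Rightarrow> nat \<Rightarrow> nat \<Rightarrow> (nat \<Rightarrow> nat) \<Rightarrow> nat measure" where
  "walk_kernel N \<epsilon> v t h =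
     measure_pmf (if t = 0 then return_pmf v else walk_step N \<epsilon> (h (t - 1)))"

interpretation walk: Ionescu_Tulcea "walk_kernel N \<epsilon> v" "\<lambda>_. count_space UNIV" for N \<epsilon> v
proof (rule Ionescu_Tulcea.intro)
  fix t
  show "walk_kernel N \<epsilon> v t
      \<in> (\<Pi>\<^sub>M i\<in>{0..<t}. count_space UNIV) \<rightarrow>\<^sub>M subprob_algebra (count_space UNIV)"
  proof (cases t)
    case 0
    then show ?thesis
      by (simp add: walk_kernel_def[abs_def] measure_pmf_in_subprob_algebra)
  next
    case (Suc s)
    have "(\<lambda>h. h s) \<in> (\<Pi>\<^sub>M i\<in>{0..<t}. count_space (UNIV :: nat set)) \<rightarrow>\<^sub>M count_space UNIV"
      by (rule measurable_component_singleton) (simp add: Suc)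
    moreover have "(\<lambda>x. measure_pmf (walk_step N \<epsilon> x))
        \<in> count_space UNIV \<rightarrow>\<^sub>M subprob_algebra (count_space UNIV)"
      by (simp add: measure_pmf_in_subprob_algebra)
    ultimately have "(\<lambda>h. measure_pmf (walk_step N \<epsilon> (h s)))
        \<in> (\<Pi>\<^sub>M i\<in>{0..<t}. count_space UNIV) \<rightarrow>\<^sub>M subprob_algebra (count_space UNIV)"
      by (rule measurable_compose)
    then show ?thesis by (simp add: walk_kernel_def[abs_def] Suc)
  qed
next
  fix t h
  show "prob_space (walk_kernel N \<epsilon> v t h)"
    unfolding walk_kernel_def by (rule prob_space_measure_pmf)
qed

text \<open>Law of the trajectory of the walk started in \<open>v\<close>.\<close>

definition walk_law :: "nat \<Rightarrow> graph \<Rightarrow> nat \<Rightarrow> (nat \<Rightarrow> nat) measure" where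
  "walk_law N \<epsilon> v = walk.PF.lim N \<epsilon> v"

text \<open>The infimum is \<open>\<infinity>\<close> if the trajectory never visits \<open>w\<close>.\<close>

definition hitting_time :: "nat \<Rightarrow> (nat \<Rightarrow> nat) \<Rightarrow> ennreal" where
  "hitting_time w \<omega> = (INF t\<in>{t. \<omega> t = w}. of_nat t)"

definition exp_hitting_time :: "nat \<Rightarrow> graph \<Rightarrow> nat \<Rightarrow> nat \<Rightarrow> ennreal" where
  "exp_hitting_time N \<epsilon> v w = (\<integral>\<^sup>+\<omega>. hitting_time w \<omega> \<partial>walk_law N \<epsilon> v)"

definition invariant_dist :: "nat \<Rightarrow> graph \<Rightarrow> nat \<Rightarrow> real" where
  "invariant_dist N \<epsilon> v =
     real (deg N \<epsilon> v) / (2 * real (card (edges N \<epsilon>)) - real (card (loops N \<epsilon>)))"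

definition mean_hitting_time :: "nat \<Rightarrow> graph \<Rightarrow> nat \<Rightarrow> ennreal" where
  "mean_hitting_time N \<epsilon> w =
     (\<Sum>v\<in>verts N. ennreal (invariant_dist N \<epsilon> v) * exp_hitting_time N \<epsilon> v w)"

lemma sets_walk_law [simp, measurable_cong]:
  "sets (walk_law N \<epsilon> v) = sets (\<Pi>\<^sub>M i\<in>UNIV. count_space UNIV)"
  by (simp add: walk_law_def)

lemma emeasure_walk_law_cylinder:
  "emeasure (walk_law N \<epsilon> v) {\<omega>. \<forall>t\<le>n. \<omega> t = x t} =
     ennreal (indicator {v} (x 0) * (\<Prod>t<n. pmf (walk_step N \<epsilon> (x t)) (x (Suc t))))"
proof -
  let ?K = "\<lambda>_::nat. count_space (UNIV :: nat set)"
  let ?P = "walk_kernel N \<epsilon> v"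
  let ?x = "\<lambda>n. restrict x {0..<n}"
  let ?u = "\<lambda>_::nat. undefined :: nat"
  have x_space: "?x n \<in> space (PiM {0..<n} ?K)" for n by (auto simp: space_PiM)
  have sets_x: "{?x n} \<in> sets (PiM {0..<n} ?K)" for n
  proof -
    have "{?x n} = PiE {0..<n} (\<lambda>t. {x t})" by (auto simp: PiE_iff extensional_def fun_eq_iff)
    also have "\<dots> \<in> sets (PiM {0..<n} ?K)" by (rule sets_PiM_I_finite) auto
    finally show ?thesis .
  qed
  have u_space: "?u \<in> space (PiM {0..<0} ?K)" by (simp add: space_PiM)
  have eP: "emeasure (walk.eP N \<epsilon> v n \<omega>) {?x (Suc n)}
      = emeasure (?P n \<omega>) {x n} * indicator {?x n} \<omega>"
    if \<omega>: "\<omega> \<in> space (PiM {0..<n} ?K)" for n \<omega>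
  proof -
    have ext: "\<omega> \<in> extensional {0..<n}" using \<omega> by (auto simp: space_PiM PiE_def)
    have iff: "fun_upd \<omega> n y = ?x (Suc n) \<longleftrightarrow> \<omega> = ?x n \<and> y = x n" for y
    proof
      assume eq: "fun_upd \<omega> n y = ?x (Suc n)"
      have "\<omega> t = ?x n t" for t
        using fun_cong[OF eq, of t] ext
        by (cases "t < n") (auto simp: extensional_def restrict_def)
      moreover have "y = x n" using fun_cong[OF eq, of n] by simp
      ultimately show "\<omega> = ?x n \<and> y = x n" by auto
    qed (auto simp: fun_eq_iff)
    have "emeasure (walk.eP N \<epsilon> v n \<omega>) {?x (Suc n)}
        = emeasure (?P n \<omega>) ((\<lambda>y. fun_upd \<omega> n y) -` {?x (Suc n)} \<inter> space (count_space UNIV))"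
      by (rule walk.emeasure_eP[OF \<omega> sets_x])
    also have "(\<lambda>y. fun_upd \<omega> n y) -` {?x (Suc n)} \<inter> space (count_space UNIV)
        = (if \<omega> = ?x n then {x n} else {})"
      by (simp only: vimage_def singleton_iff iff) auto
    finally show ?thesis by (cases "\<omega> = ?x n") (simp_all only: if_True if_False indicator_simps singleton_iff simp_thms mult_1_right mult_zero_right emeasure_empty)
  qed
  have C: "emeasure (walk.C N \<epsilon> v 0 n ?u) {?x n} = (\<Prod>t<n. emeasure (?P t (?x t)) {x t})" for n
  proof (induction n)
    case 0
    have "?x 0 = ?u" by (simp add: restrict_def)
    then show ?case using sets_x[of 0] by simp
  next
    case (Suc n)
    have sC: "sets (walk.C N \<epsilon> v 0 n ?u) = sets (PiM {0..<n} ?K)"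
      using walk.sets_C[OF u_space, of N \<epsilon> v n] by simp
    have spC: "space (walk.C N \<epsilon> v 0 n ?u) = space (PiM {0..<n} ?K)"
      using walk.space_C[OF u_space, of N \<epsilon> v n] by simp
    have ne: "space (walk.C N \<epsilon> v 0 n ?u) \<noteq> {}" using x_space[of n] unfolding spC by blast
    have meas: "walk.eP N \<epsilon> v n
        \<in> walk.C N \<epsilon> v 0 n ?u \<rightarrow>\<^sub>M subprob_algebra (PiM {0..<Suc n} ?K)"
      using walk.measurable_eP[of N \<epsilon> v n] measurable_cong_sets[OF sC refl] by blast
    have "emeasure (walk.C N \<epsilon> v 0 (Suc n) ?u) {?x (Suc n)}
        = (\<integral>\<^sup>+\<omega>. emeasure (walk.eP N \<epsilon> v n \<omega>) {?x (Suc n)} \<partial>walk.C N \<epsilon> v 0 n ?u)"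
      by (simp add: emeasure_bind[OF ne meas sets_x])
    also have "\<dots> = (\<integral>\<^sup>+\<omega>. emeasure (?P n (?x n)) {x n} * indicator {?x n} \<omega> \<partial>walk.C N \<epsilon> v 0 n ?u)"
      by (intro nn_integral_cong) (auto simp: eP spC indicator_def)
    also have "\<dots> = emeasure (?P n (?x n)) {x n} * emeasure (walk.C N \<epsilon> v 0 n ?u) {?x n}"
      by (rule nn_integral_cmult_indicator) (simp add: sC sets_x)
    finally show ?case unfolding prod.lessThan_Suc Suc.IH by (simp only: mult.commute)
  qed
  have cyl: "{\<omega>. \<forall>t\<le>n. \<omega> t = x t} = prod_emb UNIV ?K {0..<Suc n} {?x (Suc n)}"
  proof -
    have "(\<forall>t\<le>n. \<omega> t = x t) \<longleftrightarrow> restrict \<omega> {0..<Suc n} = ?x (Suc n)" for \<omega>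
      by (auto simp: fun_eq_iff restrict_def less_Suc_eq_le)
    then show ?thesis by (auto simp: prod_emb_def space_PiM)
  qed
  have self: "prod_emb {0..<Suc n} ?K {0..<Suc n} {?x (Suc n)} = {?x (Suc n)}"
    by (rule prod_emb_id) auto
  have "emeasure (walk_law N \<epsilon> v) {\<omega>. \<forall>t\<le>n. \<omega> t = x t}
      = emeasure (walk.C N \<epsilon> v 0 (Suc n) ?u) {?x (Suc n)}"
    unfolding walk_law_def cyl
    by (subst walk.lim, simp, rule sets_x, subst walk.emeasure_CI[of _ "Suc n"], simp, rule sets_x,
        simp only: self)
  also have "\<dots> = (\<Prod>t<Suc n. emeasure (?P t (?x t)) {x t})" by (rule C)
  also have "\<dots> = emeasure (?P 0 (?x 0)) {x 0}
      * (\<Prod>t<n. emeasure (?P (Suc t) (?x (Suc t))) {x (Suc t)})"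
    by (rule prod.lessThan_Suc_shift)
  also have "\<dots> = ennreal (indicator {v} (x 0))
      * (\<Prod>t<n. ennreal (pmf (walk_step N \<epsilon> (x t)) (x (Suc t))))"
    by (simp add: walk_kernel_def emeasure_pmf_single indicator_def)
  also have "\<dots> = ennreal (indicator {v} (x 0) * (\<Prod>t<n. pmf (walk_step N \<epsilon> (x t)) (x (Suc t))))"
    by (simp add: prod_ennreal ennreal_mult' prod_nonneg)
  finally show ?thesis .
qed

lemma measurable_hitting_time [measurable]:
  "hitting_time w \<in> borel_measurable (\<Pi>\<^sub>M i\<in>(UNIV :: nat set). count_space (UNIV :: nat set))"
proof -
  have eq: "hitting_time w = (\<lambda>\<omega>. INF t. if \<omega> t = w then of_nat t else \<infinity>)"
  proof
    fix \<omega>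
    show "hitting_time w \<omega> = (INF t. if \<omega> t = w then of_nat t else \<infinity>)"
      unfolding hitting_time_def
    proof (intro antisym INF_greatest)
      fix t
      show "(INF t\<in>{t. \<omega> t = w}. of_nat t) \<le> (if \<omega> t = w then of_nat t else (\<infinity> :: ennreal))"
        by (auto intro: INF_lower2)
    next
      fix t assume "t \<in> {t. \<omega> t = w}"
      then show "(INF t. if \<omega> t = w then of_nat t else (\<infinity> :: ennreal)) \<le> of_nat t"
        by (intro INF_lower2[of t]) auto
    qed
  qed
  show ?thesis unfolding eq by measurable
qed


section \<open>Asymptotics\<close>

text \<open>\<open>N \<rightarrow> \<infinity>\<close> through the multiples of \<open>M\<close> with \<open>M < N\<close>.\<close>

definition multiples :: "nat \<Rightarrow> nat filter" where
  "multiples M = inf at_top (principal {N. M dvd N \<and> M < N})"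

definition much_less :: "nat filter \<Rightarrow> (nat \<Rightarrow> real) \<Rightarrow> (nat \<Rightarrow> real) \<Rightarrow> bool" where
  "much_less F a b \<longleftrightarrow> ((\<lambda>N. a N / b N) \<longlongrightarrow> 0) F"

lemma multiples_eq: "M \<ge> 1 \<Longrightarrow> multiples M = filtermap (\<lambda>k. M * k) sequentially"
proof (rule filter_eqI)
  fix P assume M: "M \<ge> 1"
  show "eventually P (multiples M) \<longleftrightarrow> eventually P (filtermap (\<lambda>k. M * k) sequentially)"
    unfolding multiples_def eventually_inf_principal eventually_filtermap
  proof
    assume "eventually (\<lambda>N. N \<in> {N. M dvd N \<and> M < N} \<longrightarrow> P N) at_top"
    then obtain n where n: "\<And>N. N \<ge> n \<Longrightarrow> M dvd N \<Longrightarrow> M < N \<Longrightarrow> P N"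
      by (auto simp: eventually_at_top_linorder)
    have "P (M * k)" if "k \<ge> max n 2" for k
    proof (rule n)
      have "1 * k \<le> M * k" using M by (intro mult_right_mono) auto
      then show "M * k \<ge> n" using that by linarith
      have "M * 1 < M * k" using M that by (intro mult_strict_left_mono) auto
      then show "M < M * k" by simp
    qed simp
    then show "\<forall>\<^sub>F k in sequentially. P (M * k)"
      unfolding eventually_at_top_linorder by blast
  next
    assume "\<forall>\<^sub>F k in sequentially. P (M * k)"
    then obtain n where n: "\<And>k. k \<ge> n \<Longrightarrow> P (M * k)"
      by (auto simp: eventually_at_top_linorder)
    have "P N" if "N \<ge> M * n" "M dvd N" for N
      using that M n by (auto elim!: dvdE)
    then show "eventually (\<lambda>N. N \<in> {N. M dvd N \<and> M < N} \<longrightarrow> P N) at_top"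
      unfolding eventually_at_top_linorder by blast
  qed
qed

end

theory Submission
  imports Defs
begin

text \<open>The hitting times \<open>h v\<close> of \<open>w\<close> solve a linear system, and \<open>H\<^sub>w\<close> is the Dirichlet energy of \<open>h\<close>.
  The edges at \<open>w\<close> contribute \<open>vol / d\<^sub>w\<close> up to a constant, where \<open>vol\<close> is the sum of all degrees. The
  remaining energy is controlled by a Poincare inequality, so that \<open>H\<^sub>w = vol / d\<^sub>w\<close> up to a relative
  error of order \<open>1 / (N q)\<close>. The Poincare inequality needs only the edges between different blocks: by
  the union bound over all vertex sets and Chernoff's inequality this cross-block graph is an expander
  as soon as \<open>N q\<close> is large compared with \<open>ln N\<close>, and Cheeger's inequality applies. The number
  \<open>vol\<close> concentrates by Chebyshev's inequality, and \<open>d\<^sub>w\<close> is a sum of independent indicators, so the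
  fluctuations of \<open>1 / d\<^sub>w\<close> give the central limit theorem.\<close>

section \<open>Isoperimetric inequalities on weighted graphs\<close>

text \<open>The relative fluctuation of \<open>1 / d_w\<close> is of order
  \<open>\<upsilon> / \<gamma>\<close> at the block of \<open>w\<close>, so a relative error of
  order \<open>1 / (N q)\<close> disappears once \<open>\<gamma> / (N q \<upsilon>)\<close> tends to
  0. The first and the fourth growth condition yield this, and also
  \<open>N q \<ge> (ln N)^2 / 2\<close>, which pays for the union bound over vertex sets. The
  obstacle is that the blocks may have very different densities, which spoils a direct comparison
  with one homogeneous expander. The cross-block edges all have the same probability
  \<open>q\<close>, and dropping the other edges only lowers the Dirichlet energy. On this subgraph
  the maximal degree and the edge expansion are both of order \<open>N q\<close>, so the quadratic
  loss in Cheeger's inequality is only a constant factor. The Poincare inequality is taken with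
  respect to counting measure; the unequal degrees then enter only through crude upper bounds.
  Expansion also forces connectedness, so the unspecified values of \<open>H\<close> on disconnected
  graphs live on an event of vanishing probability. All estimates are explicit for fixed
  \<open>N\<close>, and limits are taken only at the end.\<close>

lemma coarea_isoperimetric:
  fixes a :: "'v \<Rightarrow> 'v \<Rightarrow> real" and f :: "'v \<Rightarrow> real"
  assumes fin: "finite V"
    and a_nonneg: "\<And>x y. x \<in> V \<Longrightarrow> y \<in> V \<Longrightarrow> 0 \<le> a x y"
    and a_sym: "\<And>x y. x \<in> V \<Longrightarrow> y \<in> V \<Longrightarrow> a x y = a y x"
    and iso: "\<And>S. S \<subseteq> V \<Longrightarrow> 2 * card S \<le> card V \<Longrightarrow> h * real (card S) \<le> (\<Sum>x\<in>S. \<Sum>y\<in>V - S. a x y)"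
    and f_nonneg: "\<And>x. x \<in> V \<Longrightarrow> 0 \<le> f x"
    and supp: "2 * card {x \<in> V. 0 < f x} \<le> card V"
  shows "2 * h * (\<Sum>x\<in>V. f x) \<le> (\<Sum>x\<in>V. \<Sum>y\<in>V. a x y * \<bar>f x - f y\<bar>)"
  using f_nonneg supp
proof (induction "card {x \<in> V. 0 < f x}" arbitrary: f rule: less_induct)
  case less
  define S where "S = {x \<in> V. 0 < f x}"
  have finS: "finite S" and SV: "S \<subseteq> V" using fin by (auto simp: S_def)
  have f0: "f x = 0" if "x \<in> V" "x \<notin> S" for x using that less.prems(1)[of x] by (auto simp: S_def)
  show ?case
  proof (cases "S = {}")
    case True
    then have "(\<Sum>x\<in>V. f x) = 0" using f0 by (intro sum.neutral) auto
    moreover have "0 \<le> (\<Sum>x\<in>V. \<Sum>y\<in>V. a x y * \<bar>f x - f y\<bar>)"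
      by (intro sum_nonneg mult_nonneg_nonneg a_nonneg) auto
    ultimately show ?thesis by simp
  next
    case False
    \<comment> \<open>Peel off the lowest positive level: subtracting \<open>\<alpha>\<close> on the
      support \<open>S\<close> kills at least the vertex \<open>z\<close>, so the induction runs on
      the size of the support. Only pairs crossing the boundary of \<open>S\<close> lose
      \<open>\<alpha>\<close>, and each is counted in both orders, which gives the factor 2.\<close>
    define \<alpha> where "\<alpha> = Min (f ` S)"
    have "\<alpha> \<in> f ` S" unfolding \<alpha>_def using False finS by (intro Min_in) auto
    then obtain z where z: "z \<in> S" "f z = \<alpha>" by auto
    have \<alpha>_le: "\<alpha> \<le> f x" if "x \<in> S" for x unfolding \<alpha>_def using that finS by auto
    have \<alpha>_pos: "0 < \<alpha>" using z by (auto simp: S_def)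
    define g where "g x = f x - \<alpha> * indicator S x" for x
    have g_nonneg: "0 \<le> g x" if "x \<in> V" for x
      using that less.prems(1)[of x] \<alpha>_le[of x] by (auto simp: g_def indicator_def)
    have sub: "{x \<in> V. 0 < g x} \<subseteq> S - {z}"
    proof
      fix x assume x: "x \<in> {x \<in> V. 0 < g x}"
      then have "x \<in> S" using f0[of x] by (cases "x \<in> S") (auto simp: g_def)
      moreover have "x \<noteq> z" using x z by (auto simp: g_def)
      ultimately show "x \<in> S - {z}" by simp
    qed
    have "{x \<in> V. 0 < g x} \<subset> S" using sub z by blast
    then have lt: "card {x \<in> V. 0 < g x} < card {x \<in> V. 0 < f x}"
      using psubset_card_mono[OF finS] by (simp add: S_def)
    then have IH: "2 * h * (\<Sum>x\<in>V. g x) \<le> (\<Sum>x\<in>V. \<Sum>y\<in>V. a x y * \<bar>g x - g y\<bar>)"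
      using less.prems(2) by (intro less.hyps g_nonneg) auto
    have split: "\<bar>f x - f y\<bar> = \<bar>g x - g y\<bar>
        + \<alpha> * (indicator S x * indicator (V - S) y + indicator (V - S) x * indicator S y)"
      if "x \<in> V" "y \<in> V" for x y
      using that g_nonneg[of x] g_nonneg[of y] f0[of x] f0[of y] \<alpha>_pos
      by (auto simp: g_def indicator_def)
    have cut1: "(\<Sum>x\<in>V. \<Sum>y\<in>V. a x y * (indicator S x * indicator (V - S) y)) = (\<Sum>x\<in>S. \<Sum>y\<in>V - S. a x y)"
    proof -
      have "(\<Sum>y\<in>V. a x y * (indicator S x * indicator (V - S) y))
          = (\<Sum>y\<in>V - S. a x y) * indicator S x" for x
        unfolding sum_distrib_right
        by (rule sum.mono_neutral_cong_right) (use fin in \<open>auto simp: indicator_def\<close>)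
      moreover have "(\<Sum>x\<in>V. (\<Sum>y\<in>V - S. a x y) * indicator S x) = (\<Sum>x\<in>S. \<Sum>y\<in>V - S. a x y)"
        by (rule sum.mono_neutral_cong_right) (use fin SV in \<open>auto simp: indicator_def\<close>)
      ultimately show ?thesis by simp
    qed
    have cut2: "(\<Sum>x\<in>V. \<Sum>y\<in>V. a x y * (indicator (V - S) x * indicator S y)) = (\<Sum>x\<in>S. \<Sum>y\<in>V - S. a x y)"
      unfolding cut1[symmetric]
      by (subst sum.swap) (auto intro!: sum.cong simp: a_sym mult.commute)
    have "(\<Sum>x\<in>V. \<Sum>y\<in>V. a x y * \<bar>f x - f y\<bar>) = (\<Sum>x\<in>V. \<Sum>y\<in>V. a x y * \<bar>g x - g y\<bar>
        + \<alpha> * (a x y * (indicator S x * indicator (V - S) y)) + \<alpha> * (a x y * (indicator (V - S) x * indicator S y)))"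
      by (intro sum.cong refl) (simp add: split algebra_simps)
    also have "\<dots> = (\<Sum>x\<in>V. \<Sum>y\<in>V. a x y * \<bar>g x - g y\<bar>) + 2 * \<alpha> * (\<Sum>x\<in>S. \<Sum>y\<in>V - S. a x y)"
      unfolding sum.distrib sum_distrib_left[symmetric] cut1 cut2 by simp
    finally have eq: "(\<Sum>x\<in>V. \<Sum>y\<in>V. a x y * \<bar>f x - f y\<bar>)
        = (\<Sum>x\<in>V. \<Sum>y\<in>V. a x y * \<bar>g x - g y\<bar>) + 2 * \<alpha> * (\<Sum>x\<in>S. \<Sum>y\<in>V - S. a x y)" .
    have "\<alpha> * (h * real (card S)) \<le> \<alpha> * (\<Sum>x\<in>S. \<Sum>y\<in>V - S. a x y)"
      using less.prems(2) \<alpha>_pos by (intro mult_left_mono iso SV) (auto simp: S_def)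
    moreover have "(\<Sum>x\<in>V. f x) = (\<Sum>x\<in>V. g x) + \<alpha> * real (card S)"
    proof -
      have "(\<Sum>x\<in>V. indicator S x :: real) = real (card S)"
        using SV fin by (simp add: indicator_def sum.If_cases Int_absorb1)
      then show ?thesis by (simp add: g_def sum_subtractf flip: sum_distrib_left)
    qed
    ultimately show ?thesis using IH eq by (simp add: algebra_simps)
  qed
qed

text \<open>Cheeger's argument: the coarea bound is applied to the square of \<open>f\<close>, whose
  differences factor into a difference and a sum. Young's inequality then separates the energy from
  the sum of squares.\<close>

lemma cheeger_nonneg:
  fixes a :: "'v \<Rightarrow> 'v \<Rightarrow> real" and f :: "'v \<Rightarrow> real"
  assumes fin: "finite V"
    and a_nonneg: "\<And>x y. x \<in> V \<Longrightarrow> y \<in> V \<Longrightarrow> 0 \<le> a x y"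
    and a_sym: "\<And>x y. x \<in> V \<Longrightarrow> y \<in> V \<Longrightarrow> a x y = a y x"
    and h: "0 < h"
    and iso: "\<And>S. S \<subseteq> V \<Longrightarrow> 2 * card S \<le> card V \<Longrightarrow> h * real (card S) \<le> (\<Sum>x\<in>S. \<Sum>y\<in>V - S. a x y)"
    and D: "0 < D" and deg: "\<And>x. x \<in> V \<Longrightarrow> (\<Sum>y\<in>V. a x y) \<le> D"
    and f_nonneg: "\<And>x. x \<in> V \<Longrightarrow> 0 \<le> f x"
    and supp: "2 * card {x \<in> V. 0 < f x} \<le> card V"
  shows "(\<Sum>x\<in>V. (f x)\<^sup>2) \<le> D / h\<^sup>2 * (\<Sum>x\<in>V. \<Sum>y\<in>V. a x y * (f x - f y)\<^sup>2)"
proof -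
  define F where "F = (\<Sum>x\<in>V. (f x)\<^sup>2)"
  define E where "E = (\<Sum>x\<in>V. \<Sum>y\<in>V. a x y * (f x - f y)\<^sup>2)"
  have "{x \<in> V. 0 < (f x)\<^sup>2} = {x \<in> V. 0 < f x}"
    using f_nonneg by (auto simp: order_less_le)
  then have "2 * h * F \<le> (\<Sum>x\<in>V. \<Sum>y\<in>V. a x y * \<bar>(f x)\<^sup>2 - (f y)\<^sup>2\<bar>)"
    unfolding F_def using supp by (intro coarea_isoperimetric fin a_nonneg a_sym iso) auto
  also have "\<dots> \<le> (\<Sum>x\<in>V. \<Sum>y\<in>V. D / h * (a x y * (f x - f y)\<^sup>2) + h / (2 * D) * (a x y * (f x)\<^sup>2)
      + h / (2 * D) * (a x y * (f y)\<^sup>2))"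
  proof (intro sum_mono)
    fix x y assume xy: "x \<in> V" "y \<in> V"
    define u where "u = \<bar>f x - f y\<bar>"
    define v where "v = f x + f y"
    have "v\<^sup>2 \<le> 2 * ((f x)\<^sup>2 + (f y)\<^sup>2)"
      using sum_squares_ge_zero[of "f x - f y" 0] unfolding v_def by (simp add: power2_eq_square algebra_simps)
    then have v: "h / (4 * D) * v\<^sup>2 \<le> h / (4 * D) * (2 * ((f x)\<^sup>2 + (f y)\<^sup>2))"
      using h D by (intro mult_left_mono) auto
    have "\<bar>(f x)\<^sup>2 - (f y)\<^sup>2\<bar> = u * v"
      unfolding u_def v_def using f_nonneg[OF xy(1)] f_nonneg[OF xy(2)]
      by (simp add: power2_eq_square square_diff_square_factored abs_mult mult.commute)
    \<comment> \<open>The weight in Young's inequality is chosen so that, with degrees at most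
      \<open>D\<close>, the \<open>v\<close>-terms add up to \<open>h * F\<close>, half of the
      \<open>2 * h * F\<close> on the left.\<close>
    also have "u * v \<le> D / h * u\<^sup>2 + h / (4 * D) * v\<^sup>2"
    proof -
      have "0 \<le> D / h * (u - h / (2 * D) * v)\<^sup>2" using h D by simp
      also have "\<dots> = D / h * u\<^sup>2 + h / (4 * D) * v\<^sup>2 - u * v"
        using h D by (simp add: power2_eq_square field_simps)
      finally show ?thesis by simp
    qed
    also have "\<dots> \<le> D / h * (f x - f y)\<^sup>2 + h / (2 * D) * (f x)\<^sup>2 + h / (2 * D) * (f y)\<^sup>2"
      using v by (simp add: u_def algebra_simps)
    finally show "a x y * \<bar>(f x)\<^sup>2 - (f y)\<^sup>2\<bar> \<le> D / h * (a x y * (f x - f y)\<^sup>2)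
        + h / (2 * D) * (a x y * (f x)\<^sup>2) + h / (2 * D) * (a x y * (f y)\<^sup>2)"
      using mult_left_mono[OF _ a_nonneg[OF xy]] by (fastforce simp: algebra_simps)
  qed
  also have "\<dots> = D / h * E + h / (2 * D) * (\<Sum>x\<in>V. (\<Sum>y\<in>V. a x y) * (f x)\<^sup>2)
      + h / (2 * D) * (\<Sum>x\<in>V. \<Sum>y\<in>V. a x y * (f y)\<^sup>2)"
    unfolding E_def sum.distrib sum_distrib_right unfolding sum_distrib_left ..
  also have "(\<Sum>x\<in>V. \<Sum>y\<in>V. a x y * (f y)\<^sup>2) = (\<Sum>x\<in>V. (\<Sum>y\<in>V. a x y) * (f x)\<^sup>2)"
    unfolding sum_distrib_right by (subst sum.swap) (auto intro!: sum.cong simp: a_sym)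
  also have "D / h * E + h / (2 * D) * (\<Sum>x\<in>V. (\<Sum>y\<in>V. a x y) * (f x)\<^sup>2)
      + h / (2 * D) * (\<Sum>x\<in>V. (\<Sum>y\<in>V. a x y) * (f x)\<^sup>2) = D / h * E + h / D * (\<Sum>x\<in>V. (\<Sum>y\<in>V. a x y) * (f x)\<^sup>2)"
    by (simp add: field_simps)
  also have "\<dots> \<le> D / h * E + h / D * (D * F)"
    unfolding F_def sum_distrib_left using h D
    by (intro add_left_mono sum_mono mult_left_mono mult_right_mono deg) auto
  also have "h / D * (D * F) = h * F" using D by simp
  finally have "h * F \<le> D / h * E" by linarith
  then have "F \<le> D / h * E / h" using h by (simp only: pos_le_divide_eq mult.commute)
  then show ?thesis unfolding F_def E_def by (simp add: power2_eq_square field_simps)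
qed

lemma exists_median:
  fixes f :: "'v \<Rightarrow> real"
  assumes fin: "finite V" and ne: "V \<noteq> {}"
  obtains c where "2 * card {x \<in> V. c < f x} \<le> card V" "2 * card {x \<in> V. f x < c} \<le> card V"
proof -
  \<comment> \<open>The median is the least value of \<open>f\<close> with at most half of the
    vertices strictly above it. If more than half lay strictly below, the next smaller value of
    \<open>f\<close> would belong to \<open>C\<close> as well.\<close>
  define C where "C = {c \<in> f ` V. 2 * card {x \<in> V. c < f x} \<le> card V}"
  have finC: "finite C" using fin by (simp add: C_def)
  have "{x \<in> V. Max (f ` V) < f x} = {}" using fin by (auto simp: not_less)
  moreover have "Max (f ` V) \<in> f ` V" using fin ne by (intro Max_in) auto
  ultimately have "Max (f ` V) \<in> C" by (simp only: C_def mem_Collect_eq card.empty) simp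
  then have "C \<noteq> {}" by auto
  then have c: "Min C \<in> C" using finC by simp
  define c where "c = Min C"
  have "2 * card {x \<in> V. f x < c} \<le> card V"
  proof (rule ccontr)
    assume less: "\<not> 2 * card {x \<in> V. f x < c} \<le> card V"
    define L where "L = {x \<in> V. f x < c}"
    have "L \<noteq> {}" using less by (metis L_def card.empty mult_0_right zero_le)
    then have L: "finite L" "L \<subseteq> V" "L \<noteq> {}" using fin by (auto simp: L_def)
    define c' where "c' = Max (f ` L)"
    have c': "c' \<in> f ` L" unfolding c'_def using L by (intro Max_in) auto
    have "{x \<in> V. c' < f x} \<subseteq> V - L" using L by (auto simp: c'_def)
    then have "card {x \<in> V. c' < f x} \<le> card V - card L"
      using card_mono[of "V - L"] fin L by (simp add: card_Diff_subset)
    then have "c' \<in> C" using c' L less by (auto simp: C_def L_def)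
    moreover have "c' < c" using c' by (auto simp: L_def)
    ultimately show False using finC c_def by (meson Min_le not_less)
  qed
  then show thesis using c that[of c] by (simp add: C_def c_def)
qed

text \<open>Centring at a median leaves the positive and the negative part supported on at most half
  of the vertices each, where the one-sided inequality applies. Their energies add up to at most the
  energy of \<open>f\<close>, so the splitting costs no constant.\<close>

lemma poincare_isoperimetric:
  fixes a :: "'v \<Rightarrow> 'v \<Rightarrow> real" and f :: "'v \<Rightarrow> real"
  assumes fin: "finite V" and ne: "V \<noteq> {}"
    and a_nonneg: "\<And>x y. x \<in> V \<Longrightarrow> y \<in> V \<Longrightarrow> 0 \<le> a x y"
    and a_sym: "\<And>x y. x \<in> V \<Longrightarrow> y \<in> V \<Longrightarrow> a x y = a y x"
    and h: "0 < h"
    and iso: "\<And>S. S \<subseteq> V \<Longrightarrow> 2 * card S \<le> card V \<Longrightarrow> h * real (card S) \<le> (\<Sum>x\<in>S. \<Sum>y\<in>V - S. a x y)"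
    and D: "0 < D" and deg: "\<And>x. x \<in> V \<Longrightarrow> (\<Sum>y\<in>V. a x y) \<le> D"
  obtains c where "(\<Sum>x\<in>V. (f x - c)\<^sup>2) \<le> D / h\<^sup>2 * (\<Sum>x\<in>V. \<Sum>y\<in>V. a x y * (f x - f y)\<^sup>2)"
proof -
  obtain c where c: "2 * card {x \<in> V. c < f x} \<le> card V" "2 * card {x \<in> V. f x < c} \<le> card V"
    using exists_median[OF fin ne] by blast
  define P where "P x = max (f x - c) 0" for x
  define R where "R x = max (c - f x) 0" for x
  have P: "(\<Sum>x\<in>V. (P x)\<^sup>2) \<le> D / h\<^sup>2 * (\<Sum>x\<in>V. \<Sum>y\<in>V. a x y * (P x - P y)\<^sup>2)"
    using c by (intro cheeger_nonneg fin a_nonneg a_sym h iso D deg) (auto simp: P_def less_max_iff_disj)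
  have R: "(\<Sum>x\<in>V. (R x)\<^sup>2) \<le> D / h\<^sup>2 * (\<Sum>x\<in>V. \<Sum>y\<in>V. a x y * (R x - R y)\<^sup>2)"
    using c by (intro cheeger_nonneg fin a_nonneg a_sym h iso D deg) (auto simp: R_def less_max_iff_disj)
  have "(\<Sum>x\<in>V. (f x - c)\<^sup>2) = (\<Sum>x\<in>V. (P x)\<^sup>2) + (\<Sum>x\<in>V. (R x)\<^sup>2)"
    unfolding sum.distrib[symmetric]
    by (intro sum.cong refl) (auto simp: P_def R_def max_def power2_commute)
  also have "\<dots> \<le> D / h\<^sup>2 * (\<Sum>x\<in>V. \<Sum>y\<in>V. a x y * (P x - P y)\<^sup>2 + a x y * (R x - R y)\<^sup>2)"
    using P R by (simp add: sum.distrib distrib_left)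
  also have "\<dots> \<le> D / h\<^sup>2 * (\<Sum>x\<in>V. \<Sum>y\<in>V. a x y * (f x - f y)\<^sup>2)"
  proof (intro mult_left_mono sum_mono)
    fix x y assume xy: "x \<in> V" "y \<in> V"
    \<comment> \<open>\<open>P\<close> is nondecreasing and \<open>R\<close> nonincreasing in the
      value of \<open>f\<close>, so both increments have the same sign.\<close>
    have "0 \<le> (P x - P y) * (R y - R x)"
      by (auto simp: P_def R_def max_def mult_le_0_iff mult_nonneg_nonneg mult_nonpos_nonpos)
    moreover have "f x - f y = (P x - P y) + (R y - R x)" by (auto simp: P_def R_def)
    moreover have "(P x - P y + (R y - R x))\<^sup>2
        = (P x - P y)\<^sup>2 + (R x - R y)\<^sup>2 + 2 * ((P x - P y) * (R y - R x))"
      by (simp add: power2_eq_square algebra_simps)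
    ultimately have "(P x - P y)\<^sup>2 + (R x - R y)\<^sup>2 \<le> (f x - f y)\<^sup>2"
      by simp
    then show "a x y * (P x - P y)\<^sup>2 + a x y * (R x - R y)\<^sup>2 \<le> a x y * (f x - f y)\<^sup>2"
      using mult_left_mono[OF _ a_nonneg[OF xy]] by (fastforce simp: algebra_simps)
  qed (use D in auto)
  finally show thesis by (rule that)
qed

section \<open>Hitting times of the random walk\<close>

lemma finite_verts [simp]: "finite (verts N)"
  by (simp add: verts_def)

text \<open>The cylinder formula at time 0 gives the start \<open>v\<close> mass 1 and each of the
  countably many other starts mass 0.\<close>

lemma prob_space_walk_law: "prob_space (walk_law N \<epsilon> v)"
proof
  have cyl: "emeasure (walk_law N \<epsilon> v) {\<omega>. \<omega> 0 = x} = indicator {v} x" for x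
    using emeasure_walk_law_cylinder[of N \<epsilon> v 0 "\<lambda>_. x"] by (simp add: indicator_def)
  have sp: "space (walk_law N \<epsilon> v) = UNIV"
    using sets_eq_imp_space_eq[OF sets_walk_law[of N \<epsilon> v]] by (simp add: space_PiM)
  have meas: "{\<omega>. \<omega> 0 = x} \<in> sets (walk_law N \<epsilon> v)" for x
  proof -
    have "{\<omega> \<in> space (\<Pi>\<^sub>M i\<in>UNIV. count_space UNIV). \<omega> 0 = x} \<in> sets (\<Pi>\<^sub>M i\<in>(UNIV::nat set). count_space (UNIV::nat set))"
      by measurable
    then show ?thesis by (simp add: space_PiM)
  qed
  have "AE \<omega> in walk_law N \<epsilon> v. \<omega> 0 \<noteq> x" if "x \<noteq> v" for x
    by (rule AE_I[where N = "{\<omega>. \<omega> 0 = x}"]) (use that cyl meas in auto)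
  then have "AE \<omega> in walk_law N \<epsilon> v. \<forall>x. x \<noteq> v \<longrightarrow> \<omega> 0 \<noteq> x"
    by (subst AE_all_countable) auto
  then have "AE \<omega> in walk_law N \<epsilon> v. (\<omega> \<in> UNIV) = (\<omega> \<in> {\<omega>. \<omega> 0 = v})"
    by eventually_elim auto
  then have "emeasure (walk_law N \<epsilon> v) UNIV = emeasure (walk_law N \<epsilon> v) {\<omega>. \<omega> 0 = v}"
    by (rule emeasure_eq_AE) (use meas sp sets.top[of "walk_law N \<epsilon> v"] in auto)
  then show "emeasure (walk_law N \<epsilon> v) (space (walk_law N \<epsilon> v)) = 1"
    by (simp add: sp cyl)
qed

lemma space_walk_law [simp]: "space (walk_law N \<epsilon> v) = UNIV"
  using sets_eq_imp_space_eq[OF sets_walk_law[of N \<epsilon> v]] by (simp add: space_PiM)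

text \<open>The probability that the walk stays in \<open>A\<close> at the times 0 to
  \<open>t\<close>, both included: the powers of the transition matrix restricted to
  \<open>A\<close>. Conditioning on the first step is the form in which the Markov property is
  used.\<close>

primrec stay_prob :: "nat \<Rightarrow> graph \<Rightarrow> nat set \<Rightarrow> nat \<Rightarrow> nat \<Rightarrow> real" where
  "stay_prob N \<epsilon> A 0 v = indicator A v"
| "stay_prob N \<epsilon> A (Suc t) v =
     indicator A v * (\<Sum>x\<in>A. pmf (walk_step N \<epsilon> v) x * stay_prob N \<epsilon> A t x)"

lemma stay_prob_nonneg: "0 \<le> stay_prob N \<epsilon> A t v"
  by (induction t arbitrary: v) (auto intro!: sum_nonneg mult_nonneg_nonneg)

lemma stay_prob_eq_0: "v \<notin> A \<Longrightarrow> stay_prob N \<epsilon> A t v = 0"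
  by (cases t) auto

lemma sum_indicator_singleton_mult:
  assumes "finite A"
  shows "(\<Sum>x\<in>A. indicator {v} x * g x) = indicator A v * (g v :: real)"
proof -
  have "(\<Sum>x\<in>A. indicator {v} x * g x) = (\<Sum>x\<in>A. if x = v then g x else 0)"
    by (intro sum.cong) (auto simp: indicator_def)
  then show ?thesis using assms by (simp add: sum.delta)
qed

text \<open>Unfolding the recursion gives the total weight of the paths inside \<open>A\<close>.
  Times 0 to \<open>t\<close> make a list of length \<open>Suc t\<close>, and the summand is the one
  of the cylinder formula.\<close>

lemma stay_prob_sum_paths:
  assumes "finite A"
  shows "(\<Sum>xs\<in>{xs. set xs \<subseteq> A \<and> length xs = Suc t}.
      indicator {v} (xs ! 0) * (\<Prod>s<t. pmf (walk_step N \<epsilon> (xs ! s)) (xs ! Suc s))) = stay_prob N \<epsilon> A t v"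
proof (induction t arbitrary: v)
  case 0
  have eq: "{xs. set xs \<subseteq> A \<and> length xs = Suc 0} = (\<lambda>x. [x]) ` A"
    by (auto simp: length_Suc_conv)
  have inj: "inj_on (\<lambda>x. [x]) A" by (simp add: inj_on_def)
  show ?case
    unfolding eq sum.reindex[OF inj]
    using sum_indicator_singleton_mult[OF assms, of v "\<lambda>_. 1"] by simp
next
  case (Suc t)
  define L where "L = {xs. set xs \<subseteq> A \<and> length xs = Suc t}"
  define W where "W xs = (\<Prod>s<t. pmf (walk_step N \<epsilon> (xs ! s)) (xs ! Suc s))" for xs
  have eq: "{xs. set xs \<subseteq> A \<and> length xs = Suc (Suc t)} = (\<lambda>(x, xs). x # xs) ` (A \<times> L)"
    unfolding L_def by (auto simp: length_Suc_conv image_iff)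
  have inj: "inj_on (\<lambda>(x, xs). x # xs) (A \<times> L)" by (auto simp: inj_on_def)
  have L0: "xs ! 0 \<in> A" if "xs \<in> L" for xs
    using that by (auto simp: L_def length_Suc_conv)
  have "(\<Sum>xs\<in>{xs. set xs \<subseteq> A \<and> length xs = Suc (Suc t)}. indicator {v} (xs ! 0)
        * (\<Prod>s<Suc t. pmf (walk_step N \<epsilon> (xs ! s)) (xs ! Suc s)))
      = (\<Sum>(x, xs)\<in>A \<times> L. indicator {v} x * (pmf (walk_step N \<epsilon> x) (xs ! 0) * W xs))"
    unfolding eq sum.reindex[OF inj]
    by (intro sum.cong refl) (auto simp: prod.lessThan_Suc_shift W_def simp del: prod.lessThan_Suc)
  also have "\<dots> = (\<Sum>x\<in>A. indicator {v} x * (\<Sum>xs\<in>L. pmf (walk_step N \<epsilon> x) (xs ! 0) * W xs))"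
    unfolding sum_distrib_left by (rule sum.cartesian_product[symmetric])
  also have "\<dots> = indicator A v * (\<Sum>xs\<in>L. pmf (walk_step N \<epsilon> v) (xs ! 0) * W xs)"
    by (rule sum_indicator_singleton_mult[OF assms])
  also have "(\<Sum>xs\<in>L. pmf (walk_step N \<epsilon> v) (xs ! 0) * W xs)
      = (\<Sum>xs\<in>L. \<Sum>y\<in>A. pmf (walk_step N \<epsilon> v) y * (indicator {y} (xs ! 0) * W xs))"
  proof (intro sum.cong refl)
    fix xs assume "xs \<in> L"
    then have "xs ! 0 \<in> A" by (rule L0)
    moreover have "indicator {y} (xs ! 0) = (indicator {xs ! 0} y :: real)" for y
      by (auto simp: indicator_def)
    ultimately show "pmf (walk_step N \<epsilon> v) (xs ! 0) * W xs
        = (\<Sum>y\<in>A. pmf (walk_step N \<epsilon> v) y * (indicator {y} (xs ! 0) * W xs))"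
      using sum_indicator_singleton_mult[OF assms, of "xs ! 0" "\<lambda>y. pmf (walk_step N \<epsilon> v) y * W xs"]
      by (simp add: mult.left_commute)
  qed
  also have "\<dots> = (\<Sum>y\<in>A. pmf (walk_step N \<epsilon> v) y * stay_prob N \<epsilon> A t y)"
    unfolding Suc.IH[symmetric] L_def W_def sum_distrib_left by (rule sum.swap)
  finally show ?case by simp
qed

lemma sets_walk_law_cylinder: "{\<omega>. \<forall>s\<le>n. \<omega> s \<in> A s} \<in> sets (walk_law N \<epsilon> v)"
proof -
  have "{\<omega> \<in> space (\<Pi>\<^sub>M i\<in>UNIV. count_space UNIV). \<forall>s\<le>n. \<omega> s \<in> A s}
      \<in> sets (\<Pi>\<^sub>M i\<in>(UNIV::nat set). count_space (UNIV::nat set))"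
    by measurable
  then show ?thesis by (simp add: space_PiM)
qed

lemma emeasure_walk_law_stay:
  assumes "finite A"
  shows "emeasure (walk_law N \<epsilon> v) {\<omega>. \<forall>s\<le>t. \<omega> s \<in> A} = ennreal (stay_prob N \<epsilon> A t v)"
proof -
  define L where "L = {xs. set xs \<subseteq> A \<and> length xs = Suc t}"
  have finL: "finite L" unfolding L_def using finite_lists_length_eq[OF assms] by simp
  define C where "C xs = {\<omega>. \<forall>s\<le>t. \<omega> s = xs ! s}" for xs :: "nat list"
  have "{\<omega>. \<forall>s\<le>t. \<omega> s \<in> A} = (\<Union>xs\<in>L. C xs)"
  proof (intro set_eqI iffI)
    fix \<omega> :: "nat \<Rightarrow> nat" assume \<omega>: "\<omega> \<in> {\<omega>. \<forall>s\<le>t. \<omega> s \<in> A}"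
    define xs where "xs = map \<omega> [0..<Suc t]"
    have "\<omega> \<in> C xs" by (auto simp: C_def xs_def simp del: upt_Suc)
    moreover have "xs \<in> L" using \<omega> by (auto simp: L_def xs_def simp del: upt_Suc)
    ultimately show "\<omega> \<in> (\<Union>xs\<in>L. C xs)" by blast
  next
    fix \<omega> :: "nat \<Rightarrow> nat" assume "\<omega> \<in> (\<Union>xs\<in>L. C xs)"
    then obtain xs where xs: "xs \<in> L" "\<omega> \<in> C xs" by blast
    have "xs ! s \<in> A" if "s \<le> t" for s
      using xs(1) that nth_mem[of s xs] by (auto simp: L_def)
    then show "\<omega> \<in> {\<omega>. \<forall>s\<le>t. \<omega> s \<in> A}" using xs(2) by (auto simp: C_def)
  qed
  moreover have disj: "disjoint_family_on C L"
  proof -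
    have "xs = ys" if "xs \<in> L" "ys \<in> L" "\<omega> \<in> C xs" "\<omega> \<in> C ys" for xs ys \<omega>
      using that by (intro nth_equalityI) (auto simp: L_def C_def less_Suc_eq_le)
    then show ?thesis unfolding disjoint_family_on_def by blast
  qed
  moreover have "C xs \<in> sets (walk_law N \<epsilon> v)" for xs
    using sets_walk_law_cylinder[of t "\<lambda>s. {xs ! s}"] by (simp add: C_def)
  then have "C ` L \<subseteq> sets (walk_law N \<epsilon> v)" by blast
  ultimately have "emeasure (walk_law N \<epsilon> v) {\<omega>. \<forall>s\<le>t. \<omega> s \<in> A}
      = (\<Sum>xs\<in>L. emeasure (walk_law N \<epsilon> v) (C xs))"
    using sum_emeasure[OF _ disj finL, of "walk_law N \<epsilon> v"] by simp
  also have "\<dots> = (\<Sum>xs\<in>L. ennreal (indicator {v} (xs ! 0)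
      * (\<Prod>s<t. pmf (walk_step N \<epsilon> (xs ! s)) (xs ! Suc s))))"
    unfolding C_def by (intro sum.cong refl emeasure_walk_law_cylinder)
  also have "\<dots> = ennreal (stay_prob N \<epsilon> A t v)"
    unfolding stay_prob_sum_paths[OF assms, symmetric] L_def
    by (intro sum_ennreal mult_nonneg_nonneg prod_nonneg) auto
  finally show ?thesis .
qed

lemma sum_pmf_walk_step:
  assumes "v \<in> verts N"
  shows "(\<Sum>x\<in>verts N. pmf (walk_step N \<epsilon> v) x) = 1"
proof (rule sum_pmf_eq_1)
  show "set_pmf (walk_step N \<epsilon> v) \<subseteq> verts N"
    using assms by (auto simp: walk_step_def Let_def split: if_splits)
qed simp

lemma stay_prob_verts: "v \<in> verts N \<Longrightarrow> stay_prob N \<epsilon> (verts N) t v = 1"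
  by (induction t arbitrary: v) (simp_all add: sum_pmf_walk_step)

text \<open>The walk almost surely never leaves \<open>verts N\<close>, so avoiding \<open>w\<close>
  amounts to staying in a finite set, to which the path expansion applies.\<close>

lemma emeasure_walk_law_avoid:
  assumes v: "v \<in> verts N"
  shows "emeasure (walk_law N \<epsilon> v) {\<omega>. \<forall>s\<le>t. \<omega> s \<noteq> w} = ennreal (stay_prob N \<epsilon> (verts N - {w}) t v)"
proof -
  interpret P: prob_space "walk_law N \<epsilon> v" by (rule prob_space_walk_law)
  have "emeasure (walk_law N \<epsilon> v) {\<omega>. \<forall>s\<le>t. \<omega> s \<in> verts N} = 1"
    by (simp add: emeasure_walk_law_stay stay_prob_verts v)
  then have "AE \<omega> in walk_law N \<epsilon> v. \<omega> \<in> {\<omega>. \<forall>s\<le>t. \<omega> s \<in> verts N}"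
    by (intro P.AE_prob_1) (simp add: P.emeasure_eq_measure)
  then have "AE \<omega> in walk_law N \<epsilon> v.
      (\<omega> \<in> {\<omega>. \<forall>s\<le>t. \<omega> s \<noteq> w}) = (\<omega> \<in> {\<omega>. \<forall>s\<le>t. \<omega> s \<in> verts N - {w}})"
    by eventually_elim auto
  then have "emeasure (walk_law N \<epsilon> v) {\<omega>. \<forall>s\<le>t. \<omega> s \<noteq> w}
      = emeasure (walk_law N \<epsilon> v) {\<omega>. \<forall>s\<le>t. \<omega> s \<in> verts N - {w}}"
    by (rule emeasure_eq_AE)
      (use sets_walk_law_cylinder[of t "\<lambda>_. - {w}"] sets_walk_law_cylinder[of t "\<lambda>_. verts N - {w}"] in auto)
  also have "\<dots> = ennreal (stay_prob N \<epsilon> (verts N - {w}) t v)"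
    by (rule emeasure_walk_law_stay) simp
  finally show ?thesis .
qed

text \<open>Tail-sum formula: the \<open>t\<close>-th indicator says that the hitting time exceeds
  \<open>t\<close>. On paths that miss \<open>w\<close> both sides are infinite.\<close>

lemma hitting_time_eq_suminf:
  "hitting_time w \<omega> = (\<Sum>t. indicator {\<omega>. \<forall>s\<le>t. \<omega> s \<noteq> w} \<omega>)"
proof (cases "\<exists>t. \<omega> t = w")
  case True
  define T where "T = (LEAST t. \<omega> t = w)"
  have T: "\<omega> T = w" unfolding T_def using True by (rule LeastI_ex)
  have less: "T \<le> t" if "\<omega> t = w" for t unfolding T_def using that by (rule Least_le)
  have "hitting_time w \<omega> = of_nat T"
    unfolding hitting_time_def
    by (rule antisym) (use T less in \<open>auto intro!: INF_lower2[of T] INF_greatest\<close>)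
  moreover have iff: "(\<forall>s\<le>t. \<omega> s \<noteq> w) \<longleftrightarrow> t < T" for t
    using T less by (metis leD le_less_linear less_le_trans)
  have "(\<Sum>t. indicator {\<omega>. \<forall>s\<le>t. \<omega> s \<noteq> w} \<omega> :: ennreal) = (\<Sum>t<T. 1)"
    by (subst suminf_finite[of "{..<T}"]) (auto simp: iff indicator_def)
  ultimately show ?thesis by simp
next
  case False
  define S where "S = (\<Sum>t. indicator {\<omega>. \<forall>s\<le>t. \<omega> s \<noteq> w} \<omega> :: ennreal)"
  have "of_nat n \<le> S" for n
    using sum_le_suminf[of "\<lambda>t. indicator {\<omega>. \<forall>s\<le>t. \<omega> s \<noteq> w} \<omega> :: ennreal" "{..<n}"] False
    by (auto simp: indicator_def S_def)
  then have "\<not> S < top" using ennreal_Ex_less_of_nat[of S] by (auto simp: not_less[symmetric])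
  then have "S = top" using less_top[of S] by blast
  then show ?thesis using False by (simp add: hitting_time_def S_def)
qed

lemma exp_hitting_time_eq_suminf:
  assumes "v \<in> verts N"
  shows "exp_hitting_time N \<epsilon> v w = (\<Sum>t. ennreal (stay_prob N \<epsilon> (verts N - {w}) t v))"
proof -
  have meas: "{\<omega>. \<forall>s\<le>t. \<omega> s \<noteq> w} \<in> sets (walk_law N \<epsilon> v)" for t
    using sets_walk_law_cylinder[of t "\<lambda>_. - {w}"] by simp
  have "exp_hitting_time N \<epsilon> v w
      = (\<integral>\<^sup>+\<omega>. (\<Sum>t. indicator {\<omega>. \<forall>s\<le>t. \<omega> s \<noteq> w} \<omega>) \<partial>walk_law N \<epsilon> v)"
    by (simp add: exp_hitting_time_def hitting_time_eq_suminf)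
  also have "\<dots> = (\<Sum>t. \<integral>\<^sup>+\<omega>. indicator {\<omega>. \<forall>s\<le>t. \<omega> s \<noteq> w} \<omega> \<partial>walk_law N \<epsilon> v)"
    by (rule nn_integral_suminf) (use meas in measurable)
  also have "\<dots> = (\<Sum>t. ennreal (stay_prob N \<epsilon> (verts N - {w}) t v))"
    by (simp only: nn_integral_indicator[OF meas] emeasure_walk_law_avoid[OF assms])
  finally show ?thesis .
qed

section \<open>Comparison principle and the linear system for the expected hitting times\<close>

lemma sum_stay_prob_Suc:
  "(\<Sum>t<Suc n. stay_prob N \<epsilon> A t v) =
     indicator A v * (1 + (\<Sum>x\<in>A. pmf (walk_step N \<epsilon> v) x * (\<Sum>t<n. stay_prob N \<epsilon> A t x)))"
proof -
  have "(\<Sum>x\<in>A. pmf (walk_step N \<epsilon> v) x * (\<Sum>t<n. stay_prob N \<epsilon> A t x))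
      = (\<Sum>t<n. \<Sum>x\<in>A. pmf (walk_step N \<epsilon> v) x * stay_prob N \<epsilon> A t x)"
    unfolding sum_distrib_left by (rule sum.swap)
  then show ?thesis
    unfolding sum.lessThan_Suc_shift by (simp add: algebra_simps sum_distrib_left)
qed

text \<open>The partial sums satisfy the recursion with equality and start from 0, so a nonnegative
  supersolution dominates them by induction. This is what makes the expected hitting times
  finite.\<close>

lemma sum_stay_prob_le_supersolution:
  assumes "\<And>v. v \<in> A \<Longrightarrow> 0 \<le> g v"
    and "\<And>v. v \<in> A \<Longrightarrow> 1 + (\<Sum>x\<in>A. pmf (walk_step N \<epsilon> v) x * g x) \<le> g v"
    and "v \<in> A"
  shows "(\<Sum>t<n. stay_prob N \<epsilon> A t v) \<le> g v"
  using assms(3)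
proof (induction n arbitrary: v)
  case 0
  then show ?case using assms(1) by simp
next
  case (Suc n)
  have "(\<Sum>t<Suc n. stay_prob N \<epsilon> A t v)
      = 1 + (\<Sum>x\<in>A. pmf (walk_step N \<epsilon> v) x * (\<Sum>t<n. stay_prob N \<epsilon> A t x))"
    unfolding sum_stay_prob_Suc using Suc.prems by simp
  also have "\<dots> \<le> 1 + (\<Sum>x\<in>A. pmf (walk_step N \<epsilon> v) x * g x)"
    by (intro add_left_mono sum_mono mult_left_mono Suc.IH) auto
  also have "\<dots> \<le> g v" by (rule assms(2)[OF Suc.prems])
  finally show ?case .
qed

lemma deg_le: "deg N \<epsilon> v \<le> N"
proof -
  have "card {w \<in> verts N. \<epsilon> {v, w}} \<le> card (verts N)" by (intro card_mono) auto
  then show ?thesis by (simp add: deg_eq_card verts_def)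
qed

lemma connected_graph_deg_pos:
  assumes conn: "connected_graph N \<epsilon>" and v: "v \<in> verts N" and N: "2 \<le> N"
  shows "0 < deg N \<epsilon> v"
proof -
  have "card (verts N - {v}) \<noteq> 0" using v N by (simp add: verts_def)
  then obtain u where u: "u \<in> verts N" "u \<noteq> v" by (metis DiffE card.empty equals0I singletonI)
  then have "(v, u) \<in> {(x, y). x \<in> verts N \<and> y \<in> verts N \<and> \<epsilon> {x, y}}\<^sup>*"
    using conn v unfolding connected_graph_def by blast
  then obtain y where "y \<in> verts N" "\<epsilon> {v, y}"
    using u(2) by (cases rule: converse_rtranclE) auto
  then have "{w \<in> verts N. \<epsilon> {v, w}} \<noteq> {}" by blast
  then show ?thesis by (simp add: deg_eq_card card_gt_0_iff)
qed

text \<open>With \<open>c = 2N\<close>, the function \<open>c^D - c^(D - dist v w)\<close> drops by at least 1 on average under one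
  step of the walk, because with probability at least \<open>1/N\<close> the distance to \<open>w\<close> decreases.\<close>

lemma hitting_time_supersolution:
  assumes conn: "connected_graph N \<epsilon>" and w: "w \<in> verts N" and N: "2 \<le> N"
  obtains g where "\<And>v. v \<in> verts N \<Longrightarrow> 0 \<le> g v"
    "\<And>v. v \<in> verts N - {w} \<Longrightarrow>
      1 + (\<Sum>x\<in>verts N - {w}. pmf (walk_step N \<epsilon> v) x * g x) \<le> g v"
proof -
  define R where "R = {(x, y). x \<in> verts N \<and> y \<in> verts N \<and> \<epsilon> {x, y}}"
  define dst where "dst v = (LEAST k. (v, w) \<in> R ^^ k)" for v
  define D where "D = Max (dst ` verts N)"
  define c :: real where "c = 2 * real N"
  define g where "g v = c ^ D - c ^ (D - dst v)" for v
  have c: "1 \<le> c" using N by (simp add: c_def)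
  have reach: "\<exists>k. (v, w) \<in> R ^^ k" if "v \<in> verts N" for v
    using conn that w unfolding connected_graph_def R_def[symmetric] by (simp add: rtrancl_power)
  have dst: "(v, w) \<in> R ^^ dst v" if "v \<in> verts N" for v
    unfolding dst_def by (rule LeastI_ex[OF reach[OF that]])
  have dst_le: "dst v \<le> k" if "(v, w) \<in> R ^^ k" for v k
    unfolding dst_def using that by (rule Least_le)
  \<comment> \<open>\<open>D\<close> bounds all distances, so the truncated subtractions in the
    exponents are exact.\<close>
  have D: "dst v \<le> D" if "v \<in> verts N" for v unfolding D_def using that by simp
  have g_nonneg: "0 \<le> g v" for v
    unfolding g_def using c by (simp add: power_increasing)
  have "1 + (\<Sum>x\<in>verts N - {w}. pmf (walk_step N \<epsilon> v) x * g x) \<le> g v" if v: "v \<in> verts N - {w}" for v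
  proof -
    have vV: "v \<in> verts N" and "v \<noteq> w" using v by auto
    have "dst v \<noteq> 0"
    proof
      assume "dst v = 0"
      with dst[OF vV] have "v = w" by simp
      with \<open>v \<noteq> w\<close> show False ..
    qed
    then obtain k where k: "dst v = Suc k" by (cases "dst v") auto
    then obtain y where y: "(v, y) \<in> R" "(y, w) \<in> R ^^ k"
      using dst[OF vV] relpow_Suc_D2[of v w k R] by auto
    have yV: "y \<in> verts N" and vy: "\<epsilon> {v, y}" using y(1) by (auto simp: R_def)
    have deg: "0 < deg N \<epsilon> v" by (rule connected_graph_deg_pos[OF conn vV N])
    have "1 / real N \<le> 1 / real (deg N \<epsilon> v)"
      using deg deg_le[of N \<epsilon> v] by (intro divide_left_mono) auto
    then have pmf_y: "1 / real N \<le> pmf (walk_step N \<epsilon> v) y"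
      using pmf_walk_step[OF deg yV] vy by (simp add: adj_def)
    \<comment> \<open>Of the factor \<open>c = 2 * N\<close>, the 2 absorbs the added 1, and
      \<open>N\<close> pays for the probability of a step towards \<open>w\<close>, which may be as
      small as \<open>1 / N\<close>.\<close>
    have "1 + c ^ (D - dst v) \<le> 2 * c ^ (D - dst v)" using c by (simp add: one_le_power)
    also have "\<dots> = 1 / real N * c ^ Suc (D - dst v)" using N by (simp add: c_def)
    also have "\<dots> \<le> pmf (walk_step N \<epsilon> v) y * c ^ (D - dst y)"
    proof (intro mult_mono pmf_y power_increasing c)
      show "Suc (D - dst v) \<le> D - dst y" using D[OF vV] k dst_le[OF y(2)] by linarith
    qed (use c in auto)
    also have "\<dots> \<le> (\<Sum>x\<in>verts N. pmf (walk_step N \<epsilon> v) x * c ^ (D - dst x))"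
      using c by (intro member_le_sum yV) auto
    also have "\<dots> = c ^ D - (\<Sum>x\<in>verts N. pmf (walk_step N \<epsilon> v) x * g x)"
      unfolding g_def right_diff_distrib sum_subtractf sum_distrib_right[symmetric]
      by (simp add: sum_pmf_walk_step[OF vV])
    finally have "1 + (\<Sum>x\<in>verts N. pmf (walk_step N \<epsilon> v) x * g x) \<le> g v"
      by (simp add: g_def)
    moreover have "(\<Sum>x\<in>verts N - {w}. pmf (walk_step N \<epsilon> v) x * g x)
        \<le> (\<Sum>x\<in>verts N. pmf (walk_step N \<epsilon> v) x * g x)"
      by (intro sum_mono2) (auto intro: g_nonneg mult_nonneg_nonneg)
    ultimately show ?thesis by linarith
  qed
  then show thesis using g_nonneg that by blast
qed

text \<open>First-step analysis, obtained by letting \<open>n\<close> tend to infinity in the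
  recursion for the partial sums. The supersolution makes the limits finite, so the system can be
  stated over the reals.\<close>

lemma hitting_time_equations:
  assumes conn: "connected_graph N \<epsilon>" and w: "w \<in> verts N" and N: "2 \<le> N"
  obtains f :: "nat \<Rightarrow> real" where "f w = 0" "\<And>v. 0 \<le> f v"
    "\<And>v. v \<in> verts N \<Longrightarrow> exp_hitting_time N \<epsilon> v w = ennreal (f v)"
    "\<And>v. v \<in> verts N \<Longrightarrow> v \<noteq> w \<Longrightarrow>
      real (deg N \<epsilon> v) * f v = real (deg N \<epsilon> v) + (\<Sum>x\<in>verts N. real (adj \<epsilon> v x) * f x)"
proof -
  define A where "A = verts N - {w}"
  define S where "S t v = stay_prob N \<epsilon> A t v" for t v
  define f where "f v = (\<Sum>t. S t v)" for v
  obtain g where g: "\<And>v. v \<in> verts N \<Longrightarrow> 0 \<le> g v"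
      "\<And>v. v \<in> A \<Longrightarrow> 1 + (\<Sum>x\<in>A. pmf (walk_step N \<epsilon> v) x * g x) \<le> g v"
    using hitting_time_supersolution[OF assms] unfolding A_def by blast
  have S_nonneg: "0 \<le> S t v" for t v by (simp add: S_def stay_prob_nonneg)
  have S_0: "S t v = 0" if "v \<notin> A" for t v using that by (simp add: S_def stay_prob_eq_0)
  have summable: "summable (\<lambda>t. S t v)" for v
  proof (cases "v \<in> A")
    case True
    have "(\<Sum>t<n. S t v) \<le> g v" for n
      unfolding S_def by (rule sum_stay_prob_le_supersolution) (use g True in \<open>auto simp: A_def\<close>)
    then show ?thesis
      by (intro summableI_nonneg_bounded[where x = "g v"] S_nonneg)
  qed (simp add: S_0)
  have f_w: "f w = 0" by (simp add: f_def S_0 A_def)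
  have f_nonneg: "0 \<le> f v" for v unfolding f_def by (intro suminf_nonneg summable S_nonneg)
  have hit: "exp_hitting_time N \<epsilon> v w = ennreal (f v)" if "v \<in> verts N" for v
    unfolding exp_hitting_time_eq_suminf[OF that] f_def A_def[symmetric] S_def[symmetric]
    by (rule suminf_ennreal2[OF S_nonneg summable])
  have eq: "real (deg N \<epsilon> v) * f v = real (deg N \<epsilon> v) + (\<Sum>x\<in>verts N. real (adj \<epsilon> v x) * f x)"
    if v: "v \<in> verts N" "v \<noteq> w" for v
  proof -
    have lim: "(\<lambda>n. \<Sum>t<n. S t x) \<longlonglongrightarrow> f x" for x
      unfolding f_def by (rule summable_LIMSEQ[OF summable])
    have "(\<lambda>n. \<Sum>t<Suc n. S t v) \<longlonglongrightarrow> f v" by (rule LIMSEQ_Suc[OF lim])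
    moreover have "(\<Sum>t<Suc n. S t v) = 1 + (\<Sum>x\<in>A. pmf (walk_step N \<epsilon> v) x * (\<Sum>t<n. S t x))" for n
      unfolding S_def sum_stay_prob_Suc using v by (simp add: A_def)
    moreover have "(\<lambda>n. 1 + (\<Sum>x\<in>A. pmf (walk_step N \<epsilon> v) x * (\<Sum>t<n. S t x)))
        \<longlonglongrightarrow> 1 + (\<Sum>x\<in>A. pmf (walk_step N \<epsilon> v) x * f x)"
      by (intro tendsto_intros lim)
    ultimately have "f v = 1 + (\<Sum>x\<in>A. pmf (walk_step N \<epsilon> v) x * f x)"
      using LIMSEQ_unique by simp
    also have "(\<Sum>x\<in>A. pmf (walk_step N \<epsilon> v) x * f x) = (\<Sum>x\<in>verts N. pmf (walk_step N \<epsilon> v) x * f x)"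
      by (intro sum.mono_neutral_left) (auto simp: A_def f_w)
    also have "\<dots> = (\<Sum>x\<in>verts N. real (adj \<epsilon> v x) * f x) / real (deg N \<epsilon> v)"
      unfolding sum_divide_distrib
      by (intro sum.cong refl) (simp add: pmf_walk_step connected_graph_deg_pos[OF conn v(1) N])
    finally show ?thesis
      using connected_graph_deg_pos[OF conn v(1) N] by (simp add: field_simps)
  qed
  show thesis by (rule that[OF f_w f_nonneg hit eq])
qed

lemma finite_vpairs [simp]: "finite (vpairs N)"
  by (rule finite_subset[of _ "Pow (verts N)"]) (auto simp: vpairs_def)

text \<open>The map from ordered pairs to \<open>{v, w}\<close> has fibres of size 2, and of size 1
  over the loops. It turns double sums over vertices into sums over the independent edge
  indicators.\<close>

lemma sum_ordered_pairs_eq: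
  fixes \<phi> :: "nat set \<Rightarrow> real"
  shows "(\<Sum>v\<in>verts N. \<Sum>w\<in>verts N. \<phi> {v, w}) = (\<Sum>e\<in>vpairs N. (2 - of_bool (is_singleton e)) * \<phi> e)"
proof -
  define W where "W e = {(v, w). v \<in> verts N \<and> w \<in> verts N \<and> {v, w} = e}" for e
  have finW: "finite (W e)" for e
    by (rule finite_subset[of _ "verts N \<times> verts N"]) (auto simp: W_def)
  have card_W: "real (card (W e)) = 2 - of_bool (is_singleton e)" if "e \<in> vpairs N" for e
  proof -
    obtain v w where e: "e = {v, w}" "v \<in> verts N" "w \<in> verts N"
      using \<open>e \<in> vpairs N\<close> by (auto simp: vpairs_def)
    have "W e = {(v, w), (w, v)}" using e by (auto simp: W_def doubleton_eq_iff)
    then show ?thesis using e by (cases "v = w") (auto simp: is_singleton_def)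
  qed
  have "(\<Sum>v\<in>verts N. \<Sum>w\<in>verts N. \<phi> {v, w}) = (\<Sum>(v, w)\<in>verts N \<times> verts N. \<phi> {v, w})"
    by (rule sum.cartesian_product)
  also have "verts N \<times> verts N = (\<Union>e\<in>vpairs N. W e)"
    by (auto simp: W_def vpairs_def)
  also have "(\<Sum>(v, w)\<in>(\<Union>e\<in>vpairs N. W e). \<phi> {v, w}) = (\<Sum>e\<in>vpairs N. \<Sum>(v, w)\<in>W e. \<phi> {v, w})"
    using finW by (intro sum.UNION_disjoint) (auto simp: W_def)
  also have "\<dots> = (\<Sum>e\<in>vpairs N. \<Sum>(v, w)\<in>W e. \<phi> e)"
    by (intro sum.cong refl) (auto simp: W_def)
  also have "\<dots> = (\<Sum>e\<in>vpairs N. (2 - of_bool (is_singleton e)) * \<phi> e)"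
    by (intro sum.cong refl) (simp add: card_W case_prod_unfold)
  finally show ?thesis .
qed

lemma sum_deg_eq: "(\<Sum>v\<in>verts N. real (deg N \<epsilon> v)) = 2 * real (card (edges N \<epsilon>)) - real (card (loops N \<epsilon>))"
proof -
  have "(\<Sum>v\<in>verts N. real (deg N \<epsilon> v)) = (\<Sum>v\<in>verts N. \<Sum>w\<in>verts N. of_bool (\<epsilon> {v, w}))"
    by (simp add: deg_def adj_def del: sum_of_bool_eq)
  also have "\<dots> = (\<Sum>e\<in>vpairs N. (2 - of_bool (is_singleton e)) * of_bool (\<epsilon> e))"
    by (rule sum_ordered_pairs_eq)
  also have "\<dots> = (\<Sum>e\<in>edges N \<epsilon>. 2 - of_bool (is_singleton e))"
    unfolding edges_def by (intro sum.mono_neutral_cong_right) auto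
  also have "\<dots> = 2 * real (card (edges N \<epsilon>)) - real (card (loops N \<epsilon>))"
    by (simp add: sum_subtractf loops_def edges_def Int_def)
  finally show ?thesis .
qed

section \<open>The energy identity for the mean hitting time\<close>

text \<open>Summation by parts. Every edge between distinct vertices appears in both orders, hence
  the factor 2; loops carry no energy.\<close>

lemma dirichlet_form_eq:
  fixes a :: "'v \<Rightarrow> 'v \<Rightarrow> real" and g :: "'v \<Rightarrow> real"
  assumes a_sym: "\<And>x y. x \<in> V \<Longrightarrow> y \<in> V \<Longrightarrow> a x y = a y x"
  shows "(\<Sum>x\<in>V. \<Sum>y\<in>V. a x y * (g x - g y)\<^sup>2)
    = 2 * (\<Sum>x\<in>V. g x * ((\<Sum>y\<in>V. a x y) * g x - (\<Sum>y\<in>V. a x y * g y)))"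
proof -
  have swap: "(\<Sum>x\<in>V. \<Sum>y\<in>V. a x y * (g y)\<^sup>2) = (\<Sum>x\<in>V. \<Sum>y\<in>V. a x y * (g x)\<^sup>2)"
    by (subst sum.swap) (auto intro!: sum.cong simp: a_sym)
  have "(\<Sum>x\<in>V. \<Sum>y\<in>V. a x y * (g x - g y)\<^sup>2)
      = (\<Sum>x\<in>V. \<Sum>y\<in>V. (a x y * (g x)\<^sup>2 - 2 * (a x y * (g x * g y))) + a x y * (g y)\<^sup>2)"
    by (intro sum.cong refl) (simp add: power2_eq_square algebra_simps)
  also have "\<dots> = 2 * ((\<Sum>x\<in>V. \<Sum>y\<in>V. a x y * (g x)\<^sup>2) - (\<Sum>x\<in>V. \<Sum>y\<in>V. a x y * (g x * g y)))"
    unfolding sum.distrib sum_subtractf swap sum_distrib_left[symmetric] by simp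
  also have "(\<Sum>x\<in>V. \<Sum>y\<in>V. a x y * (g x)\<^sup>2) = (\<Sum>x\<in>V. g x * ((\<Sum>y\<in>V. a x y) * g x))"
    by (intro sum.cong refl) (simp add: sum_distrib_left sum_distrib_right power2_eq_square mult_ac)
  also have "(\<Sum>x\<in>V. \<Sum>y\<in>V. a x y * (g x * g y)) = (\<Sum>x\<in>V. g x * (\<Sum>y\<in>V. a x y * g y))"
    by (intro sum.cong refl) (simp add: sum_distrib_left mult_ac)
  finally show ?thesis by (simp add: right_diff_distrib sum_subtractf)
qed

text \<open>The mean hitting time \<open>H\<close> is the Dirichlet energy of \<open>f\<close>. Replacing \<open>f w = 0\<close> by the mean
  \<open>R\<close> of \<open>f\<close> over the neighbours of \<open>w\<close> removes the energy \<open>R\<close> of the edges at \<open>w\<close>, so that the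
  modified function has energy at most \<open>H - R + 1\<close>; conversely \<open>H - R\<close> is, up to a loop term, a
  linear functional of it, which the Poincare inequality controls.\<close>

lemma mean_hitting_time_bounds:
  fixes a :: "'v \<Rightarrow> 'v \<Rightarrow> real" and f :: "'v \<Rightarrow> real" and V :: "'v set" and w :: 'v
  defines "d \<equiv> \<lambda>x. \<Sum>y\<in>V. a x y"
  defines "vol \<equiv> \<Sum>x\<in>V. d x"
  defines "R \<equiv> vol / d w - 1"
  defines "H \<equiv> \<Sum>x\<in>V. d x / vol * f x"
  assumes fin: "finite V" and w: "w \<in> V"
    and a_sym: "\<And>x y. x \<in> V \<Longrightarrow> y \<in> V \<Longrightarrow> a x y = a y x"
    and a_01: "\<And>x y. x \<in> V \<Longrightarrow> y \<in> V \<Longrightarrow> 0 \<le> a x y \<and> a x y \<le> 1"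
    and d_w: "0 < d w"
    and f_w: "f w = 0"
    and f: "\<And>v. v \<in> V \<Longrightarrow> v \<noteq> w \<Longrightarrow> d v * f v = d v + (\<Sum>x\<in>V. a v x * f x)"
    and P: "0 \<le> P"
    and poincare: "\<And>g. \<exists>c. (\<Sum>x\<in>V. (g x - c)\<^sup>2) \<le> P * (\<Sum>x\<in>V. \<Sum>y\<in>V. a x y * (g x - g y)\<^sup>2)"
  shows "R - 1 \<le> H"
    and "H \<le> R + 1 + 4 * P * vol * ((\<Sum>x\<in>V. (d x)\<^sup>2) / vol\<^sup>2 + 1 / d w) + 2 * R / d w"
proof -
  have d_nonneg: "0 \<le> d x" if "x \<in> V" for x
    unfolding d_def using a_01 that by (intro sum_nonneg) auto
  have sum_a: "(\<Sum>y\<in>V. a x y) = d x" for x by (simp add: d_def)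
  have vol_ge: "d w \<le> vol" unfolding vol_def by (intro member_le_sum w fin d_nonneg) auto
  have vol: "0 < vol" using vol_ge d_w by linarith
  have R: "0 \<le> R" using vol_ge d_w by (simp add: R_def)
  have dR: "d w * R = vol - d w" using d_w by (simp add: R_def field_simps)
  define e where "e x = (if x = w then 1 else 0 :: real)" for x
  have sum_e: "(\<Sum>x\<in>V. e x * g x) = g w" for g
    unfolding e_def using w fin by (simp add: if_distrib[of "\<lambda>z. z * _"] sum.delta cong: if_cong)
  have sum_af: "(\<Sum>x\<in>V. d x * f x) = (\<Sum>v\<in>V. \<Sum>x\<in>V. a v x * f x)"
    unfolding d_def sum_distrib_right by (subst sum.swap) (auto intro!: sum.cong simp: a_sym)
  \<comment> \<open>Summing the linear system over all vertices, the Laplacian of \<open>f\<close>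
    cancels by symmetry. What remains at \<open>w\<close> says that \<open>f\<close> has mean
    \<open>R\<close> over the neighbours of \<open>w\<close>; this is Kac's formula, with
    \<open>vol / d w\<close> the mean return time.\<close>
  have "(\<Sum>v\<in>V. d v * f v - (\<Sum>x\<in>V. a v x * f x)) = (\<Sum>v\<in>V. d v - e v * (d v + (\<Sum>x\<in>V. a w x * f x)))"
    using f by (intro sum.cong refl) (auto simp: e_def f_w)
  then have "0 = vol - (d w + (\<Sum>x\<in>V. a w x * f x))"
    unfolding sum_subtractf sum_af sum_e vol_def by simp
  then have af_w: "(\<Sum>x\<in>V. a w x * f x) = d w * R" using dR by simp
  have Lf: "d x * f x - (\<Sum>y\<in>V. a x y * f y) = d x - e x * (d w + d w * R)" if "x \<in> V" for x
    using f[OF that] by (cases "x = w") (auto simp: e_def f_w af_w)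
  have volH: "(\<Sum>x\<in>V. d x * f x) = vol * H"
    unfolding H_def sum_distrib_left using vol by (intro sum.cong refl) simp
  define ft where "ft x = f x + R * e x" for x
  define EN where "EN = (\<Sum>x\<in>V. \<Sum>y\<in>V. a x y * (ft x - ft y)\<^sup>2)"
  have "EN = 2 * (\<Sum>x\<in>V. ft x * (d x * ft x - (\<Sum>y\<in>V. a x y * ft y)))"
    unfolding EN_def d_def by (rule dirichlet_form_eq) (rule a_sym)
  also have "(\<Sum>x\<in>V. ft x * (d x * ft x - (\<Sum>y\<in>V. a x y * ft y)))
      = (\<Sum>x\<in>V. d x * f x - R * (a w x * f x) + e x * (R * (d x - (d w + d w * R) + R * (d w - a w x))))"
  proof (intro sum.cong refl)
    fix x assume x: "x \<in> V"
    have "(\<Sum>y\<in>V. a x y * ft y) = (\<Sum>y\<in>V. a x y * f y) + R * (\<Sum>y\<in>V. e y * a x y)"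
      unfolding ft_def by (simp add: distrib_left sum.distrib sum_distrib_left mult_ac)
    also have "(\<Sum>y\<in>V. e y * a x y) = a w x" using a_sym[OF x w] by (simp add: sum_e)
    finally have "d x * ft x - (\<Sum>y\<in>V. a x y * ft y)
        = (d x * f x - (\<Sum>y\<in>V. a x y * f y)) + R * (d x * e x - a w x)"
      by (simp add: ft_def algebra_simps)
    also have "\<dots> = d x - e x * (d w + d w * R) + R * (d x * e x - a w x)"
      by (simp only: Lf[OF x])
    finally have *: "d x * ft x - (\<Sum>y\<in>V. a x y * ft y) = \<dots>" .
    show "ft x * (d x * ft x - (\<Sum>y\<in>V. a x y * ft y))
        = d x * f x - R * (a w x * f x) + e x * (R * (d x - (d w + d w * R) + R * (d w - a w x)))"
      unfolding * by (cases "x = w") (auto simp: ft_def e_def f_w algebra_simps)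
  qed
  also have "\<dots> = vol * H - R * (d w * R) + R * (d w - (d w + d w * R) + R * (d w - a w w))"
    unfolding sum.distrib sum_subtractf sum_distrib_left[symmetric] af_w volH sum_e ..
  finally have EN: "EN = 2 * (vol * H - d w * R\<^sup>2 - a w w * R\<^sup>2)"
    by (simp add: power2_eq_square algebra_simps)
  have awwR: "0 \<le> a w w * R\<^sup>2" using a_01[OF w w] by simp
  have dRR: "d w * R\<^sup>2 = vol * R - vol + d w"
  proof -
    have "d w * R\<^sup>2 = (d w * R) * R" by (simp add: power2_eq_square)
    also have "\<dots> = (vol - d w) * R" by (simp only: dR)
    also have "\<dots> = vol * R - d w * R" by (rule left_diff_distrib)
    finally show ?thesis using dR by simp
  qed
  have EN_le: "EN \<le> 2 * vol * (H - R + 1)"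
  proof -
    have "EN = 2 * (vol * H) - 2 * (d w * R\<^sup>2) - 2 * (a w w * R\<^sup>2)"
      unfolding EN by (simp add: algebra_simps)
    also have "\<dots> \<le> 2 * (vol * H) - 2 * (vol * R) + 2 * vol"
      using d_w awwR dRR by linarith
    also have "\<dots> = 2 * vol * (H - R + 1)" by (simp add: algebra_simps)
    finally show ?thesis .
  qed
  have "0 \<le> EN" unfolding EN_def using a_01 by (intro sum_nonneg mult_nonneg_nonneg) auto
  then have "0 \<le> vol * (H - R + 1)" using EN_le by linarith
  then show "R - 1 \<le> H" using vol by (simp add: zero_le_mult_iff)
  \<comment> \<open>The stationary law minus the law of the walk one step after \<open>w\<close>.
    Paired with \<open>f\<close> it gives \<open>H - R\<close>; since it has total mass 0, any
    constant may be subtracted from \<open>ft\<close> before the Poincare inequality is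
    used.\<close>
  define s where "s x = d x / vol - a w x / d w" for x
  have sum_s: "(\<Sum>x\<in>V. s x) = 0"
    unfolding s_def sum_subtractf sum_divide_distrib[symmetric] vol_def[symmetric]
    using vol d_w by (simp add: sum_a)
  have sft: "(\<Sum>x\<in>V. s x * ft x) = H - R + d w * R / vol - a w w * R / d w"
  proof -
    have "(\<Sum>x\<in>V. s x * ft x) = (\<Sum>x\<in>V. d x / vol * f x - (a w x * f x) / d w + e x * (s x * R))"
      by (intro sum.cong refl) (simp add: s_def ft_def algebra_simps)
    also have "\<dots> = H - (d w * R) / d w + s w * R"
      unfolding sum.distrib sum_subtractf sum_divide_distrib[symmetric] af_w sum_e H_def ..
    finally show ?thesis using d_w by (simp add: s_def algebra_simps)
  qed
  obtain c where c: "(\<Sum>x\<in>V. (ft x - c)\<^sup>2) \<le> P * EN" using poincare[of ft] unfolding EN_def by blast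
  have "(\<Sum>x\<in>V. s x * ft x) = (\<Sum>x\<in>V. s x * (ft x - c))"
    unfolding right_diff_distrib sum_subtractf sum_distrib_right[symmetric] sum_s by simp
  also have "\<dots> \<le> 2 * P * vol / 2 * (\<Sum>x\<in>V. (s x)\<^sup>2) + (H - R + 1) / 2"
  proof (cases "P = 0")
    case True
    then have "(\<Sum>x\<in>V. (ft x - c)\<^sup>2) = 0" using c by (intro antisym sum_nonneg) auto
    then have "\<And>x. x \<in> V \<Longrightarrow> ft x - c = 0" using fin by (subst (asm) sum_nonneg_eq_0_iff) auto
    then show ?thesis using True \<open>R - 1 \<le> H\<close> by simp
  next
    case False
    \<comment> \<open>With this weight in Young's inequality and the bound \<open>EN_le\<close>, the
      quadratic term in \<open>ft - c\<close> is at most \<open>(H - R + 1) / 2\<close>, half of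
      which is then absorbed by the \<open>H - R\<close> on the left. The weight vanishes for
      \<open>P = 0\<close>, hence the separate case.\<close>
    define l where "l = 2 * P * vol"
    have l: "0 < l" using False P vol by (simp add: l_def)
    have "(\<Sum>x\<in>V. s x * (ft x - c)) \<le> (\<Sum>x\<in>V. l / 2 * (s x)\<^sup>2 + (ft x - c)\<^sup>2 / (2 * l))"
    proof (intro sum_mono)
      fix x
      have "0 \<le> (l * s x - (ft x - c))\<^sup>2 / (2 * l)" using l by simp
      also have "\<dots> = l / 2 * (s x)\<^sup>2 + (ft x - c)\<^sup>2 / (2 * l) - s x * (ft x - c)"
        using l by (simp add: power2_eq_square field_simps)
      finally show "s x * (ft x - c) \<le> l / 2 * (s x)\<^sup>2 + (ft x - c)\<^sup>2 / (2 * l)" by simp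
    qed
    also have "\<dots> = l / 2 * (\<Sum>x\<in>V. (s x)\<^sup>2) + (\<Sum>x\<in>V. (ft x - c)\<^sup>2) / (2 * l)"
      by (simp add: sum.distrib sum_distrib_left sum_divide_distrib)
    also have "(\<Sum>x\<in>V. (ft x - c)\<^sup>2) / (2 * l) \<le> (H - R + 1) / 2"
    proof -
      have "(\<Sum>x\<in>V. (ft x - c)\<^sup>2) / (2 * l) \<le> P * (2 * vol * (H - R + 1)) / (2 * l)"
        using c l mult_left_mono[OF EN_le P] by (intro divide_right_mono) auto
      also have "P * (2 * vol * (H - R + 1)) / (2 * l) = (H - R + 1) / 2"
        using l False vol by (simp add: l_def)
      finally show ?thesis .
    qed
    finally show ?thesis by (simp add: l_def)
  qed
  finally have "H - R + d w * R / vol - a w w * R / d w \<le> P * vol * (\<Sum>x\<in>V. (s x)\<^sup>2) + (H - R + 1) / 2"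
    by (simp add: sft)
  moreover have "0 \<le> d w * R / vol" using d_w R vol by simp
  moreover have "a w w * R / d w \<le> R / d w"
    using a_01[OF w w] R d_w by (intro divide_right_mono mult_left_le_one_le) auto
  ultimately have upper: "H \<le> R + 1 + 2 * (P * vol * (\<Sum>x\<in>V. (s x)\<^sup>2)) + 2 * (R / d w)"
    unfolding add_divide_distrib diff_divide_distrib by linarith
  have "(\<Sum>x\<in>V. (s x)\<^sup>2) \<le> (\<Sum>x\<in>V. 2 * ((d x)\<^sup>2 / vol\<^sup>2) + 2 * (a w x / (d w)\<^sup>2))"
  proof (intro sum_mono)
    fix x assume x: "x \<in> V"
    have "(s x)\<^sup>2 \<le> 2 * (d x / vol)\<^sup>2 + 2 * (a w x / d w)\<^sup>2"
    proof -
      have "(y - z)\<^sup>2 \<le> 2 * y\<^sup>2 + 2 * z\<^sup>2" for y z :: real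
        using zero_le_power2[of "y + z"] by (simp add: power2_eq_square algebra_simps)
      then show ?thesis unfolding s_def .
    qed
    also have "(a w x / d w)\<^sup>2 \<le> a w x / (d w)\<^sup>2"
      unfolding power_divide using a_01[OF w x]
      by (intro divide_right_mono) (auto simp: power2_eq_square mult_left_le)
    finally show "(s x)\<^sup>2 \<le> 2 * ((d x)\<^sup>2 / vol\<^sup>2) + 2 * (a w x / (d w)\<^sup>2)"
      by (simp add: power_divide)
  qed
  also have "\<dots> = 2 * ((\<Sum>x\<in>V. (d x)\<^sup>2) / vol\<^sup>2 + 1 / d w)"
    unfolding sum.distrib sum_distrib_left[symmetric] sum_divide_distrib[symmetric]
    using d_w by (simp add: sum_a power2_eq_square)
  finally have "P * vol * (\<Sum>x\<in>V. (s x)\<^sup>2) \<le> P * vol * (2 * ((\<Sum>x\<in>V. (d x)\<^sup>2) / vol\<^sup>2 + 1 / d w))"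
    using P vol by (intro mult_left_mono) auto
  then show "H \<le> R + 1 + 4 * P * vol * ((\<Sum>x\<in>V. (d x)\<^sup>2) / vol\<^sup>2 + 1 / d w) + 2 * R / d w"
    using upper by linarith
qed

section \<open>Sums of independent indicators\<close>

text \<open>Second-order Taylor expansion at the two values of a centred indicator. The remainder is
  the third absolute moment, which is at most the variance \<open>r * (1 - r)\<close>; so the errors
  of many indicators add up to a multiple of the total variance.\<close>

lemma norm_bernoulli_char_approx:
  fixes r \<tau> :: real
  assumes "0 \<le> r" "r \<le> 1"
  shows "cmod (complex_of_real r * iexp (\<tau> * (r - 1)) + complex_of_real (1 - r) * iexp (\<tau> * r)
      - complex_of_real (1 - \<tau>\<^sup>2 * (r * (1 - r)) / 2)) \<le> \<bar>\<tau>\<bar> ^ 3 * (r * (1 - r)) / 6"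
proof -
  define e where "e x = iexp x - (1 + \<i> * complex_of_real x - complex_of_real (x\<^sup>2 / 2))" for x
  have e: "cmod (e x) \<le> \<bar>x\<bar> ^ 3 / 6" for x
    using iexp_approx1[of x 2]
    by (simp add: e_def eval_nat_numeral power_mult_distrib algebra_simps)
  have "complex_of_real r * iexp (\<tau> * (r - 1)) + complex_of_real (1 - r) * iexp (\<tau> * r)
      - complex_of_real (1 - \<tau>\<^sup>2 * (r * (1 - r)) / 2)
      = complex_of_real r * e (\<tau> * (r - 1)) + complex_of_real (1 - r) * e (\<tau> * r)"
    unfolding e_def by (simp add: field_simps power2_eq_square)
  also have "cmod \<dots> \<le> r * (\<bar>\<tau> * (r - 1)\<bar> ^ 3 / 6) + (1 - r) * (\<bar>\<tau> * r\<bar> ^ 3 / 6)"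
  proof (intro order.trans[OF norm_triangle_ineq] add_mono)
    show "cmod (complex_of_real r * e (\<tau> * (r - 1))) \<le> r * (\<bar>\<tau> * (r - 1)\<bar> ^ 3 / 6)"
      unfolding norm_mult norm_of_real using assms mult_left_mono[OF e] by simp
    show "cmod (complex_of_real (1 - r) * e (\<tau> * r)) \<le> (1 - r) * (\<bar>\<tau> * r\<bar> ^ 3 / 6)"
      unfolding norm_mult norm_of_real using assms mult_left_mono[OF e] by simp
  qed
  also have "\<dots> = \<bar>\<tau>\<bar> ^ 3 * (r * (1 - r)) / 6 * ((1 - r)\<^sup>2 + r\<^sup>2)"
  proof -
    have r: "\<bar>r - 1\<bar> = 1 - r" "\<bar>r\<bar> = r" using assms by auto
    have "r * (T * (1 - r) ^ 3 / 6) + (1 - r) * (T * r ^ 3 / 6) = T * (r * (1 - r)) / 6 * ((1 - r)\<^sup>2 + r\<^sup>2)" for T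
      by (simp add: power3_eq_cube power2_eq_square field_simps)
    then show ?thesis unfolding abs_mult r power_mult_distrib .
  qed
  also have "\<dots> \<le> \<bar>\<tau>\<bar> ^ 3 * (r * (1 - r)) / 6 * 1"
  proof (rule mult_left_mono)
    have "(1 - r)\<^sup>2 + r\<^sup>2 = 1 - 2 * (r * (1 - r))" by (simp add: power2_eq_square algebra_simps)
    then show "(1 - r)\<^sup>2 + r\<^sup>2 \<le> 1" using assms by simp
  qed (use assms in auto)
  finally show ?thesis by simp
qed

lemma exp_minus_le_quadratic:
  fixes a :: real
  assumes "0 \<le> a"
  shows "\<bar>1 - a - exp (- a)\<bar> \<le> a\<^sup>2"
proof -
  have "1 + a \<le> exp a" by (rule exp_ge_add_one_self)
  then have "exp (- a) \<le> 1 / (1 + a)"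
    using assms by (simp add: exp_minus field_simps)
  also have "\<dots> \<le> 1 - a + a\<^sup>2"
    using assms by (simp add: field_simps power2_eq_square)
  finally show ?thesis using exp_ge_add_one_self[of "- a"] by simp
qed

locale bernoulli_family =
  fixes I :: "'e set" and r :: "'e \<Rightarrow> real"
  assumes fin: "finite I" and r01: "\<And>e. e \<in> I \<Longrightarrow> 0 \<le> r e \<and> r e \<le> 1"
begin

abbreviation law :: "('e \<Rightarrow> bool) pmf" where
  "law \<equiv> Pi_pmf I False (\<lambda>e. bernoulli_pmf (r e))"

lemma finite_set_law: "finite (set_pmf law)"
  unfolding set_Pi_pmf[OF fin] using fin by (intro finite_PiE_dflt) auto

lemma integrable_law [simp]: "integrable (measure_pmf law) (f :: _ \<Rightarrow> 'b :: {banach, second_countable_topology})"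
  by (rule integrable_measure_pmf_finite[OF finite_set_law])

lemma expectation_coord:
  fixes f :: "bool \<Rightarrow> 'b :: {banach, second_countable_topology}"
  assumes "e \<in> I"
  shows "measure_pmf.expectation law (\<lambda>\<epsilon>. f (\<epsilon> e)) = measure_pmf.expectation (bernoulli_pmf (r e)) f"
proof -
  have "measure_pmf.expectation (map_pmf (\<lambda>\<epsilon>. \<epsilon> e) law) f = measure_pmf.expectation law (\<lambda>\<epsilon>. f (\<epsilon> e))"
    by simp
  then show ?thesis using assms by (simp add: Pi_pmf_component[OF fin])
qed

lemma expectation_prod:
  fixes f :: "'e \<Rightarrow> bool \<Rightarrow> 'b :: {real_normed_field, banach, second_countable_topology}"
  assumes F: "F \<subseteq> I"
  shows "measure_pmf.expectation law (\<lambda>\<epsilon>. \<Prod>e\<in>F. f e (\<epsilon> e))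
    = (\<Prod>e\<in>F. measure_pmf.expectation (bernoulli_pmf (r e)) (f e))"
proof -
  have "measure_pmf.expectation law (\<lambda>\<epsilon>. \<Prod>e\<in>F. f e (\<epsilon> e))
      = (\<Prod>e\<in>F. measure_pmf.expectation law (\<lambda>\<epsilon>. f e (\<epsilon> e)))"
  proof (rule prob_space.indep_vars_lebesgue_integral[OF prob_space_measure_pmf])
    show "finite F" using F fin finite_subset by blast
    have "prob_space.indep_vars (measure_pmf law) (\<lambda>_. count_space UNIV) (\<lambda>x f. f x) F"
      by (rule prob_space.indep_vars_subset[OF prob_space_measure_pmf indep_vars_Pi_pmf[OF fin] F])
    then show "prob_space.indep_vars (measure_pmf law) (\<lambda>_. borel) (\<lambda>e \<epsilon>. f e (\<epsilon> e)) F"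
      by (rule prob_space.indep_vars_compose2[OF prob_space_measure_pmf]) simp
  qed simp
  also have "\<dots> = (\<Prod>e\<in>F. measure_pmf.expectation (bernoulli_pmf (r e)) (f e))"
    using F by (intro prod.cong refl expectation_coord) auto
  finally show ?thesis .
qed

text \<open>The moment generating function is dominated by that of a Poisson variable with the same
  mean, because \<open>1 + x \<le> exp x\<close> holds factor by factor.\<close>

lemma expectation_exp_count_le:
  assumes F: "F \<subseteq> I"
  shows "measure_pmf.expectation law (\<lambda>\<epsilon>. exp (s * (\<Sum>e\<in>F. of_bool (\<epsilon> e)))) \<le> exp ((exp s - 1) * (\<Sum>e\<in>F. r e))"
proof -
  have finF: "finite F" using F fin finite_subset by blast
  have "measure_pmf.expectation law (\<lambda>\<epsilon>. exp (s * (\<Sum>e\<in>F. of_bool (\<epsilon> e))))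
      = measure_pmf.expectation law (\<lambda>\<epsilon>. \<Prod>e\<in>F. exp (s * of_bool (\<epsilon> e)))"
    using finF by (simp add: sum_distrib_left exp_sum del: sum_mult_of_bool_eq sum_of_bool_eq)
  also have "\<dots> = (\<Prod>e\<in>F. exp s * r e + (1 - r e))"
    unfolding expectation_prod[OF F, of "\<lambda>_ b. exp (s * of_bool b)"] using F r01
    by (intro prod.cong refl) auto
  also have "\<dots> \<le> (\<Prod>e\<in>F. exp ((exp s - 1) * r e))"
  proof (intro prod_mono conjI)
    fix e assume "e \<in> F"
    then have re: "0 \<le> r e" "r e \<le> 1" using F r01 by auto
    then show "0 \<le> exp s * r e + (1 - r e)" by (intro add_nonneg_nonneg mult_nonneg_nonneg) auto
    show "exp s * r e + (1 - r e) \<le> exp ((exp s - 1) * r e)"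
      using exp_ge_add_one_self[of "(exp s - 1) * r e"] by (simp add: algebra_simps)
  qed
  also have "\<dots> = exp ((exp s - 1) * (\<Sum>e\<in>F. r e))"
    using finF by (simp add: sum_distrib_left exp_sum)
  finally show ?thesis .
qed

lemma prob_le_expectation:
  fixes u :: "('e \<Rightarrow> bool) \<Rightarrow> real"
  assumes "\<And>\<epsilon>. 0 \<le> u \<epsilon>" "0 < c" "\<And>\<epsilon>. \<epsilon> \<in> A \<Longrightarrow> c \<le> u \<epsilon>"
  shows "measure_pmf.prob law A \<le> measure_pmf.expectation law u / c"
proof -
  have "measure_pmf.prob law A \<le> measure_pmf.prob law {x \<in> space (measure_pmf law). c \<le> u x}"
    using assms(3) by (intro measure_pmf.finite_measure_mono) auto
  also have "\<dots> \<le> measure_pmf.expectation law u / c"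
    by (rule integral_Markov_inequality_measure[where A = "{}"]) (use assms in auto)
  finally show ?thesis .
qed

text \<open>Chernoff's bound with exponential parameter 1: as \<open>exp 1 - 1 \<le> 2\<close>, the
  exponent is at most \<open>2 * \<mu> - 4 * \<mu>\<close>.\<close>

lemma prob_count_ge:
  assumes F: "F \<subseteq> I" and \<mu>: "(\<Sum>e\<in>F. r e) \<le> \<mu>"
  shows "measure_pmf.prob law {\<epsilon>. 4 * \<mu> \<le> (\<Sum>e\<in>F. of_bool (\<epsilon> e))} \<le> exp (- 2 * \<mu>)"
proof -
  have "0 \<le> (\<Sum>e\<in>F. r e)" using F r01 by (intro sum_nonneg) auto

  have "measure_pmf.prob law {\<epsilon>. 4 * \<mu> \<le> (\<Sum>e\<in>F. of_bool (\<epsilon> e))}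
      \<le> measure_pmf.expectation law (\<lambda>\<epsilon>. exp (1 * (\<Sum>e\<in>F. of_bool (\<epsilon> e)))) / exp (4 * \<mu>)"
    by (rule prob_le_expectation) auto
  also have "\<dots> \<le> exp ((exp 1 - 1) * (\<Sum>e\<in>F. r e)) / exp (4 * \<mu>)"
    by (intro divide_right_mono expectation_exp_count_le F) simp
  also have "\<dots> \<le> exp (2 * \<mu>) / exp (4 * \<mu>)"
  proof -
    have "(exp 1 - 1) * (\<Sum>e\<in>F. r e) \<le> 2 * \<mu>"
      using exp_le \<mu> \<open>0 \<le> sum r F\<close> by (intro mult_mono) auto
    then show ?thesis by (intro divide_right_mono) auto
  qed
  also have "\<dots> = exp (- 2 * \<mu>)" by (simp flip: exp_diff)
  finally show ?thesis .
qed

text \<open>Chernoff's bound with exponential parameter \<open>- 1\<close>: as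
  \<open>exp (- 1) \<le> 1 / 2\<close>, the exponent is at most
  \<open>- \<mu> / 2 + \<mu> / 4\<close>.\<close>

lemma prob_count_le:
  assumes F: "F \<subseteq> I" and \<mu>: "\<mu> \<le> (\<Sum>e\<in>F. r e)"
  shows "measure_pmf.prob law {\<epsilon>. (\<Sum>e\<in>F. of_bool (\<epsilon> e)) \<le> \<mu> / 4} \<le> exp (- \<mu> / 4)"
proof -
  have S0: "0 \<le> (\<Sum>e\<in>F. r e)" using F r01 by (intro sum_nonneg) auto
  have "measure_pmf.prob law {\<epsilon>. (\<Sum>e\<in>F. of_bool (\<epsilon> e)) \<le> \<mu> / 4}
      \<le> measure_pmf.expectation law (\<lambda>\<epsilon>. exp (- 1 * (\<Sum>e\<in>F. of_bool (\<epsilon> e)))) / exp (- \<mu> / 4)"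
    by (rule prob_le_expectation) auto
  also have "\<dots> \<le> exp ((exp (- 1) - 1) * (\<Sum>e\<in>F. r e)) / exp (- \<mu> / 4)"
    by (intro divide_right_mono expectation_exp_count_le F) simp
  also have "\<dots> \<le> exp (- \<mu> / 2) / exp (- \<mu> / 4)"
  proof -
    have "exp (- 1 :: real) \<le> 1 / 2"
      using exp_ge_add_one_self[of 1] by (simp add: exp_minus field_simps)
    then have "(exp (- 1) - 1) * (\<Sum>e\<in>F. r e) \<le> (- 1 / 2) * (\<Sum>e\<in>F. r e)"
      using S0 by (intro mult_right_mono) auto
    also have "\<dots> \<le> - \<mu> / 2" using \<mu> by simp
    finally show ?thesis by (intro divide_right_mono) auto
  qed
  also have "\<dots> = exp (- \<mu> / 4)" by (simp flip: exp_diff)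
  finally show ?thesis .
qed

lemma expectation_square_centered:
  assumes F: "F \<subseteq> I"
  shows "measure_pmf.expectation law (\<lambda>\<epsilon>. (\<Sum>e\<in>F. c e * (of_bool (\<epsilon> e) - r e))\<^sup>2)
    = (\<Sum>e\<in>F. (c e)\<^sup>2 * (r e * (1 - r e)))"
proof -
  have finF: "finite F" using F fin finite_subset by blast
  define Y where "Y e b = c e * (of_bool b - r e)" for e b
  have EY: "measure_pmf.expectation (bernoulli_pmf (r e)) (Y e) = 0" if "e \<in> F" for e
    using that F r01[of e] by (auto simp: Y_def algebra_simps)
  have EYY: "measure_pmf.expectation law (\<lambda>\<epsilon>. Y e (\<epsilon> e) * Y f (\<epsilon> f))
      = (if e = f then (c e)\<^sup>2 * (r e * (1 - r e)) else 0)" if "e \<in> F" "f \<in> F" for e f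
  proof (cases "e = f")
    case True
    have "e \<in> I" using that F by auto
    then show ?thesis
      using True r01[of e] expectation_coord[of e "\<lambda>b. Y e b * Y e b"]
      by (simp add: Y_def power2_eq_square algebra_simps)
  next
    case False
    have sub: "{e, f} \<subseteq> I" using that F by auto
    show ?thesis using expectation_prod[OF sub, of Y] False EY that by simp
  qed
  have "measure_pmf.expectation law (\<lambda>\<epsilon>. (\<Sum>e\<in>F. c e * (of_bool (\<epsilon> e) - r e))\<^sup>2)
      = measure_pmf.expectation law (\<lambda>\<epsilon>. \<Sum>e\<in>F. \<Sum>f\<in>F. Y e (\<epsilon> e) * Y f (\<epsilon> f))"
    by (simp add: Y_def power2_eq_square sum_product)
  also have "\<dots> = (\<Sum>e\<in>F. \<Sum>f\<in>F. measure_pmf.expectation law (\<lambda>\<epsilon>. Y e (\<epsilon> e) * Y f (\<epsilon> f)))"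
    by (subst Bochner_Integration.integral_sum, simp, intro sum.cong refl Bochner_Integration.integral_sum, simp)
  also have "\<dots> = (\<Sum>e\<in>F. \<Sum>f\<in>F. if e = f then (c e)\<^sup>2 * (r e * (1 - r e)) else 0)"
    by (intro sum.cong refl EYY)
  also have "\<dots> = (\<Sum>e\<in>F. (c e)\<^sup>2 * (r e * (1 - r e)))"
    using finF by (simp add: sum.delta)
  finally show ?thesis .
qed

lemma prob_centered_ge:
  assumes F: "F \<subseteq> I" and t: "0 < t"
  shows "measure_pmf.prob law {\<epsilon>. t \<le> \<bar>\<Sum>e\<in>F. c e * (of_bool (\<epsilon> e) - r e)\<bar>}
    \<le> (\<Sum>e\<in>F. (c e)\<^sup>2 * (r e * (1 - r e))) / t\<^sup>2"
  unfolding expectation_square_centered[OF F, symmetric]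
proof (rule prob_le_expectation)
  fix \<epsilon> assume "\<epsilon> \<in> {\<epsilon>. t \<le> \<bar>\<Sum>e\<in>F. c e * (of_bool (\<epsilon> e) - r e)\<bar>}"
  then have "t\<^sup>2 \<le> \<bar>\<Sum>e\<in>F. c e * (of_bool (\<epsilon> e) - r e)\<bar>\<^sup>2"
    using t by (intro power_mono) auto
  then show "t\<^sup>2 \<le> (\<Sum>e\<in>F. c e * (of_bool (\<epsilon> e) - r e))\<^sup>2" by simp
qed (use t in auto)

text \<open>Both characteristic functions are products with factors of modulus at most 1, so they
  differ by at most the sum of the factorwise differences. The bound involves only \<open>t\<close>
  and \<open>\<sigma>\<close>, which suits a triangular array. The summands are \<open>r e\<close>
  minus the indicator because a large degree makes the hitting time small.\<close>

lemma norm_char_count_diff_le: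
  assumes F: "F \<subseteq> I" and \<sigma>: "0 < \<sigma>" "\<sigma>\<^sup>2 = (\<Sum>e\<in>F. r e * (1 - r e))"
  shows "cmod (measure_pmf.expectation law (\<lambda>\<epsilon>. iexp (t * ((\<Sum>e\<in>F. r e - of_bool (\<epsilon> e)) / \<sigma>)))
      - exp (- (t\<^sup>2) / 2)) \<le> \<bar>t\<bar> ^ 3 / (6 * \<sigma>) + t ^ 4 / (16 * \<sigma>\<^sup>2)"
proof -
  have finF: "finite F" using F fin finite_subset by blast
  define \<tau> where "\<tau> = t / \<sigma>"
  define v where "v e = r e * (1 - r e)" for e
  define \<phi> where "\<phi> e = complex_of_real (r e) * iexp (\<tau> * (r e - 1)) + complex_of_real (1 - r e) * iexp (\<tau> * r e)" for e
  define a where "a e = \<tau>\<^sup>2 * v e / 2" for e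
  have re: "0 \<le> r e" "r e \<le> 1" if "e \<in> F" for e using that F r01 by auto
  have v0: "0 \<le> v e" if "e \<in> F" for e using re[OF that] by (simp add: v_def)
  have v1: "v e \<le> 1 / 4" for e
    using zero_le_power2[of "r e - 1 / 2"] by (simp add: v_def power2_eq_square algebra_simps)
  have a0: "0 \<le> a e" if "e \<in> F" for e using v0[OF that] by (simp add: a_def)
  have \<phi>1: "cmod (\<phi> e) \<le> 1" if "e \<in> F" for e
  proof -
    have "cmod (\<phi> e) \<le> cmod (complex_of_real (r e) * iexp (\<tau> * (r e - 1))) + cmod (complex_of_real (1 - r e) * iexp (\<tau> * r e))"
      unfolding \<phi>_def by (rule norm_triangle_ineq)
    also have "\<dots> = 1" unfolding norm_mult norm_exp_i_times norm_of_real using re[OF that] by simp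
    finally show ?thesis .
  qed
  have "(\<Prod>e\<in>F. exp (- a e)) = exp (- (\<Sum>e\<in>F. a e))"
    using finF by (simp add: exp_sum sum_negf[symmetric])
  also have "(\<Sum>e\<in>F. a e) = t\<^sup>2 / 2"
  proof -
    have "(\<Sum>e\<in>F. a e) = \<tau>\<^sup>2 / 2 * (\<Sum>e\<in>F. v e)"
      unfolding a_def sum_distrib_left by (intro sum.cong refl) simp
    also have "(\<Sum>e\<in>F. v e) = \<sigma>\<^sup>2" unfolding v_def \<sigma>(2) ..
    finally show ?thesis using \<sigma>(1) by (simp add: \<tau>_def power_divide)
  qed
  finally have prod_a: "exp (- (t\<^sup>2) / 2) = (\<Prod>e\<in>F. exp (- a e))" by simp
  have "measure_pmf.expectation law (\<lambda>\<epsilon>. iexp (t * ((\<Sum>e\<in>F. r e - of_bool (\<epsilon> e)) / \<sigma>)))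
      = measure_pmf.expectation law (\<lambda>\<epsilon>. \<Prod>e\<in>F. iexp (\<tau> * (r e - of_bool (\<epsilon> e))))"
  proof (rule Bochner_Integration.integral_cong[OF refl])
    fix \<epsilon> :: "'e \<Rightarrow> bool"
    have "t * ((\<Sum>e\<in>F. r e - of_bool (\<epsilon> e)) / \<sigma>) = (\<Sum>e\<in>F. \<tau> * (r e - of_bool (\<epsilon> e)))"
      unfolding sum_distrib_left[symmetric] \<tau>_def by simp
    then show "iexp (t * ((\<Sum>e\<in>F. r e - of_bool (\<epsilon> e)) / \<sigma>)) = (\<Prod>e\<in>F. iexp (\<tau> * (r e - of_bool (\<epsilon> e))))"
      using finF by (simp only: of_real_sum sum_distrib_left exp_sum)
  qed
  also have "\<dots> = (\<Prod>e\<in>F. \<phi> e)"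
    unfolding expectation_prod[OF F, of "\<lambda>e b. iexp (\<tau> * (r e - of_bool b))"]
  proof (intro prod.cong refl)
    fix e assume "e \<in> F"
    then show "measure_pmf.expectation (bernoulli_pmf (r e)) (\<lambda>b. iexp (\<tau> * (r e - of_bool b))) = \<phi> e"
      using re by (subst integral_measure_pmf[of UNIV]) (auto simp: UNIV_bool \<phi>_def scaleR_conv_of_real)
  qed
  finally have "cmod (measure_pmf.expectation law (\<lambda>\<epsilon>. iexp (t * ((\<Sum>e\<in>F. r e - of_bool (\<epsilon> e)) / \<sigma>)))
      - exp (- (t\<^sup>2) / 2)) = cmod ((\<Prod>e\<in>F. \<phi> e) - (\<Prod>e\<in>F. complex_of_real (exp (- a e))))"
    by (simp only: prod_a of_real_prod)
  also have "\<dots> \<le> (\<Sum>e\<in>F. cmod (\<phi> e - complex_of_real (exp (- a e))))"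
    by (rule norm_prod_diff) (use \<phi>1 a0 in auto)
  also have "\<dots> \<le> (\<Sum>e\<in>F. \<bar>\<tau>\<bar> ^ 3 / 6 * v e + \<tau> ^ 4 / 16 * v e)"
  proof (intro sum_mono)
    fix e assume e: "e \<in> F"
    have "cmod (\<phi> e - complex_of_real (exp (- a e)))
        \<le> cmod (\<phi> e - complex_of_real (1 - a e)) + cmod (complex_of_real (1 - a e) - complex_of_real (exp (- a e)))"
      by (rule norm_diff_triangle_le[OF order_refl order_refl])
    also have "cmod (complex_of_real (1 - a e) - complex_of_real (exp (- a e))) = \<bar>1 - a e - exp (- a e)\<bar>"
      by (metis norm_of_real of_real_diff)
    also have "\<bar>1 - a e - exp (- a e)\<bar> \<le> (a e)\<^sup>2" by (rule exp_minus_le_quadratic[OF a0[OF e]])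
    also have "(a e)\<^sup>2 = \<tau> ^ 4 / 4 * (v e * v e)"
      by (simp add: a_def power2_eq_square power4_eq_xxxx)
    \<comment> \<open>One factor \<open>v e\<close> is kept and the other bounded by
      \<open>1 / 4\<close>, so that the sum over \<open>F\<close> is again a multiple of
      \<open>\<sigma>\<^sup>2\<close>.\<close>
    also have "\<dots> \<le> \<tau> ^ 4 / 4 * (1 / 4 * v e)"
      using v0[OF e] v1[of e] by (intro mult_left_mono mult_right_mono) auto
    also have "cmod (\<phi> e - complex_of_real (1 - a e)) \<le> \<bar>\<tau>\<bar> ^ 3 / 6 * v e"
      using norm_bernoulli_char_approx[OF re[OF e], of \<tau>] unfolding \<phi>_def a_def v_def by simp
    finally show "cmod (\<phi> e - complex_of_real (exp (- a e))) \<le> \<bar>\<tau>\<bar> ^ 3 / 6 * v e + \<tau> ^ 4 / 16 * v e"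
      by simp
  qed
  also have "\<dots> = (\<bar>\<tau>\<bar> ^ 3 / 6 + \<tau> ^ 4 / 16) * \<sigma>\<^sup>2"
    unfolding \<sigma>(2) v_def[symmetric] sum_distrib_left by (simp add: algebra_simps)
  also have "\<dots> = \<bar>t\<bar> ^ 3 / (6 * \<sigma>) + t ^ 4 / (16 * \<sigma>\<^sup>2)"
    using \<sigma>(1) by (simp add: \<tau>_def abs_divide field_simps power2_eq_square power3_eq_cube power4_eq_xxxx)
  finally show ?thesis .
qed

end

section \<open>The stochastic block model\<close>

lemma edge_prob_bounds:
  assumes "0 \<le> q" "q \<le> 1" and "\<And>v. v \<in> verts N \<Longrightarrow> 0 \<le> p (B v) \<and> p (B v) \<le> 1" and "e \<in> vpairs N"
  shows "0 \<le> edge_prob B p q e \<and> edge_prob B p q e \<le> 1"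
  using assms(3,4) assms(1,2) by (auto simp: vpairs_def edge_prob_pair)

locale block_model =
  fixes M N :: nat and B :: "nat \<Rightarrow> nat" and p :: "nat \<Rightarrow> real" and q :: real
  assumes M: "2 \<le> M" and N: "2 \<le> N" and blocks: "equal_blocks M N B"
    and p01: "\<And>l. l \<in> {1..M} \<Longrightarrow> 0 \<le> p l \<and> p l \<le> 1"
    and q01: "0 \<le> q" "q \<le> 1"
begin

lemma B_range: "v \<in> verts N \<Longrightarrow> B v \<in> {1..M}"
  using blocks by (auto simp: equal_blocks_def)

sublocale bernoulli_family "vpairs N" "edge_prob B p q"
  by unfold_locales (simp, rule edge_prob_bounds, use q01 p01 B_range in auto)

lemma sbm_eq: "sbm N B p q = law" by (simp add: sbm_def)

definition bs :: real where "bs = real N / real M"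

lemma card_verts [simp]: "card (verts N) = N" by (simp add: verts_def)

lemma card_block: "l \<in> {1..M} \<Longrightarrow> real (card {v \<in> verts N. B v = l}) = bs"
  using blocks M by (auto simp: equal_blocks_def bs_def field_simps simp flip: of_nat_mult)

lemma sum_blocks:
  fixes F :: "nat \<Rightarrow> real"
  shows "(\<Sum>v\<in>verts N. F (B v)) = bs * (\<Sum>l=1..M. F l)"
proof -
  have "(\<Sum>v\<in>verts N. F (B v)) = (\<Sum>l=1..M. \<Sum>v\<in>{v \<in> verts N. B v = l}. F (B v))"
    by (rule sum.group[symmetric]) (use B_range in auto)
  also have "\<dots> = (\<Sum>l=1..M. bs * F l)"
    by (intro sum.cong refl) (simp add: card_block)
  finally show ?thesis by (simp add: sum_distrib_left)
qed

text \<open>A general \<open>\<phi>\<close> yields the mean and the variance of a degree from the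
  same count. The loop at \<open>v\<close> counts towards its own block.\<close>

lemma sum_star:
  fixes \<phi> :: "real \<Rightarrow> real"
  assumes v: "v \<in> verts N"
  shows "(\<Sum>w\<in>verts N. \<phi> (edge_prob B p q {v, w})) = bs * \<phi> (p (B v)) + (real M - 1) * bs * \<phi> q"
proof -
  have "(\<Sum>w\<in>verts N. \<phi> (edge_prob B p q {v, w})) = (\<Sum>w\<in>verts N. if B w = B v then \<phi> (p (B v)) else \<phi> q)"
    by (intro sum.cong refl) (auto simp: edge_prob_pair)
  also have "\<dots> = bs * (\<Sum>l=1..M. if l = B v then \<phi> (p (B v)) else \<phi> q)"
    by (rule sum_blocks[of "\<lambda>l. if l = B v then \<phi> (p (B v)) else \<phi> q"])
  also have "(\<Sum>l=1..M. if l = B v then \<phi> (p (B v)) else \<phi> q)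
      = (\<Sum>l=1..M. \<phi> q + (if l = B v then \<phi> (p (B v)) - \<phi> q else 0))"
    by (intro sum.cong) auto
  also have "\<dots> = real M * \<phi> q + (\<phi> (p (B v)) - \<phi> q)"
    using B_range[OF v] by (simp add: sum.distrib)
  finally show ?thesis by (simp add: algebra_simps)
qed

abbreviation \<gamma> :: "nat \<Rightarrow> real" where "\<gamma> \<equiv> exp_deg M N p q"

abbreviation var :: "nat \<Rightarrow> real" where "var \<equiv> var_deg M N p q"

abbreviation vol :: "graph \<Rightarrow> real" where "vol \<epsilon> \<equiv> \<Sum>v\<in>verts N. real (deg N \<epsilon> v)"

lemma sum_star_edge_prob: "v \<in> verts N \<Longrightarrow> (\<Sum>w\<in>verts N. edge_prob B p q {v, w}) = \<gamma> (B v)"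
  using sum_star[of v "\<lambda>x. x"] by (simp add: exp_deg_def bs_def)

lemma sum_star_variance:
  "v \<in> verts N \<Longrightarrow> (\<Sum>w\<in>verts N. edge_prob B p q {v, w} * (1 - edge_prob B p q {v, w})) = var (B v)"
  using sum_star[of v "\<lambda>x. x * (1 - x)"] by (simp add: var_deg_def bs_def mult.assoc)

section \<open>Chernoff bounds for the degrees and for the cuts of the cross-block graph\<close>

definition star :: "nat \<Rightarrow> nat set \<Rightarrow> nat set set" where
  "star v W = (\<lambda>w. {v, w}) ` W"

lemma star_subset: "v \<in> verts N \<Longrightarrow> W \<subseteq> verts N \<Longrightarrow> star v W \<subseteq> vpairs N"
  by (auto simp: star_def vpairs_def)

lemma sum_over_star: "(\<Sum>e\<in>star v W. g e) = (\<Sum>w\<in>W. g {v, w})"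
  unfolding star_def by (subst sum.reindex) (auto simp: inj_on_def doubleton_eq_iff)

lemma deg_eq_sum: "real (deg N \<epsilon> v) = (\<Sum>w\<in>verts N. of_bool (\<epsilon> {v, w}))"
  by (simp add: deg_def adj_def del: sum_of_bool_eq)

lemma q_le_\<gamma>: "real N * q / 2 \<le> \<gamma> l" if "l \<in> {1..M}"
proof -
  have "real M * (real N * q) \<le> 2 * ((real M - 1) * (real N * q))"
    using M q01 by (simp add: mult_right_mono flip: mult.assoc)
  then have "real N * q / 2 \<le> (real M - 1) * (real N / real M) * q"
    using M by (simp add: field_simps)
  also have "\<dots> \<le> \<gamma> l" using p01[OF that] by (simp add: exp_deg_def)
  finally show ?thesis .
qed

lemma prob_deg_ge:
  assumes v: "v \<in> verts N"
  shows "measure_pmf.prob law {\<epsilon>. 4 * \<gamma> (B v) \<le> real (deg N \<epsilon> v)} \<le> exp (- 2 * \<gamma> (B v))"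
  using prob_count_ge[OF star_subset[OF v order_refl], of "\<gamma> (B v)"]
  by (simp add: sum_over_star deg_eq_sum sum_star_edge_prob[OF v] del: sum_of_bool_eq)

definition cross_adj :: "graph \<Rightarrow> nat \<Rightarrow> nat \<Rightarrow> real" where
  "cross_adj \<epsilon> x y = of_bool (B x \<noteq> B y \<and> \<epsilon> {x, y})"

lemma prob_cross_deg_ge:
  assumes v: "v \<in> verts N"
  shows "measure_pmf.prob law {\<epsilon>. 4 * (real N * q) \<le> (\<Sum>w\<in>verts N. cross_adj \<epsilon> v w)} \<le> exp (- 2 * (real N * q))"
proof -
  define W where "W = {w \<in> verts N. B v \<noteq> B w}"
  have W: "W \<subseteq> verts N" "finite W" by (auto simp: W_def)
  have "(\<Sum>e\<in>star v W. edge_prob B p q e) = (\<Sum>w\<in>W. q)"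
    unfolding sum_over_star by (intro sum.cong refl) (auto simp: W_def edge_prob_pair)
  also have "\<dots> \<le> real N * q"
    using card_mono[OF finite_verts W(1)] q01 by (simp add: mult_right_mono)
  finally have "measure_pmf.prob law {\<epsilon>. 4 * (real N * q) \<le> (\<Sum>e\<in>star v W. of_bool (\<epsilon> e))}
      \<le> exp (- 2 * (real N * q))"
    by (intro prob_count_ge star_subset v W)
  moreover have "(\<Sum>e\<in>star v W. of_bool (\<epsilon> e)) = (\<Sum>w\<in>verts N. cross_adj \<epsilon> v w)" for \<epsilon>
    unfolding sum_over_star W_def cross_adj_def
    by (intro sum.mono_neutral_cong_left) auto
  ultimately show ?thesis by (simp only:)
qed

text \<open>Each potential cut edge is listed once, from its end in \<open>S\<close> to its end
  outside.\<close>

definition cross_cut :: "nat set \<Rightarrow> (nat \<times> nat) set" where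
  "cross_cut S = {(x, y). x \<in> S \<and> y \<in> verts N - S \<and> B x \<noteq> B y}"

text \<open>Counting by blocks gives \<open>c * (N - c - N / M)\<close> plus the sum of the squares
  of the block contents of \<open>S\<close>, where \<open>c\<close> is the size of \<open>S\<close>.
  By Cauchy-Schwarz an even spread over the blocks is the worst case, with
  \<open>c * (1 - 1 / M) * (N - c)\<close> pairs; here \<open>1 - 1 / M \<ge> 1 / 2\<close> and
  \<open>N - c \<ge> N / 2\<close>.\<close>

lemma card_cut_ge:
  assumes S: "S \<subseteq> verts N" and half: "2 * card S \<le> N"
  shows "real (card S) * real N / 4 \<le> real (card (cross_cut S))"
proof -
  have finS: "finite S" using finite_subset[OF S finite_verts] .
  define s where "s l = real (card {x \<in> S. B x = l})" for l
  define c where "c = real (card S)"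
  have inner: "real (card {y \<in> verts N - S. B x \<noteq> B y}) = real N - c - bs + s (B x)" if x: "x \<in> S" for x
  proof -
    have "B x \<in> {1..M}" using x S B_range by auto
    then have "real (card {y \<in> verts N. B y = B x}) = bs" by (rule card_block)
    moreover have "card {y \<in> verts N. B y = B x} = card {y \<in> verts N - S. B y = B x} + card {y \<in> S. B y = B x}"
    proof -
      have "{y \<in> verts N. B y = B x} = {y \<in> verts N - S. B y = B x} \<union> {y \<in> S. B y = B x}"
        using S by auto
      moreover have "card ({y \<in> verts N - S. B y = B x} \<union> {y \<in> S. B y = B x})
          = card {y \<in> verts N - S. B y = B x} + card {y \<in> S. B y = B x}"
        using finS by (intro card_Un_disjoint) auto
      ultimately show ?thesis by (simp only:)
    qed
    moreover have "card (verts N - S) = card {y \<in> verts N - S. B y = B x} + card {y \<in> verts N - S. B x \<noteq> B y}"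
    proof -
      have "verts N - S = {y \<in> verts N - S. B y = B x} \<union> {y \<in> verts N - S. B x \<noteq> B y}" by auto
      moreover have "card ({y \<in> verts N - S. B y = B x} \<union> {y \<in> verts N - S. B x \<noteq> B y})
          = card {y \<in> verts N - S. B y = B x} + card {y \<in> verts N - S. B x \<noteq> B y}"
        by (intro card_Un_disjoint) auto
      ultimately show ?thesis by (simp only:)
    qed
    moreover have "real (card (verts N - S)) = real N - c"
      using S finS card_mono[OF finite_verts S] by (simp add: card_Diff_subset c_def of_nat_diff)
    ultimately show ?thesis by (simp add: s_def)
  qed
  have "cross_cut S = Sigma S (\<lambda>x. {y \<in> verts N - S. B x \<noteq> B y})" by (auto simp: cross_cut_def)
  then have "real (card (cross_cut S)) = (\<Sum>x\<in>S. real (card {y \<in> verts N - S. B x \<noteq> B y}))"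
    using finS by (simp add: card_SigmaI)
  also have "\<dots> = (\<Sum>x\<in>S. real N - c - bs + s (B x))" by (intro sum.cong refl inner)
  also have "\<dots> = c * (real N - c - bs) + (\<Sum>x\<in>S. s (B x))" by (simp add: sum.distrib c_def)
  also have "(\<Sum>x\<in>S. s (B x)) = (\<Sum>l=1..M. \<Sum>x\<in>{x \<in> S. B x = l}. s (B x))"
    by (rule sum.group[symmetric]) (use S B_range finS in auto)
  also have "\<dots> = (\<Sum>l=1..M. (s l)\<^sup>2)" by (intro sum.cong refl) (simp add: s_def power2_eq_square)
  finally have card_cut: "real (card (cross_cut S)) = c * (real N - c - bs) + (\<Sum>l=1..M. (s l)\<^sup>2)" .
  have sum_s: "(\<Sum>l=1..M. s l) = c"
  proof -
    have "(\<Sum>l=1..M. \<Sum>x\<in>{x \<in> S. B x = l}. 1 :: real) = (\<Sum>x\<in>S. 1)"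
      by (rule sum.group) (use S B_range finS in auto)
    then show ?thesis by (simp add: s_def c_def)
  qed
  have "0 \<le> (\<Sum>l=1..M. (s l - c / real M)\<^sup>2)" by (intro sum_nonneg) auto
  also have "\<dots> = (\<Sum>l=1..M. (s l)\<^sup>2 - 2 * c / real M * s l + (c / real M)\<^sup>2)"
    by (intro sum.cong refl) (simp add: power2_diff)
  also have "\<dots> = (\<Sum>l=1..M. (s l)\<^sup>2) - 2 * c / real M * c + real M * (c / real M)\<^sup>2"
    unfolding sum.distrib sum_subtractf sum_distrib_left[symmetric] sum_s by simp
  also have "\<dots> = (\<Sum>l=1..M. (s l)\<^sup>2) - c * c / real M"
    using M by (simp add: power2_eq_square field_simps)
  finally have "c * (real N - c - bs) + c * c / real M \<le> real (card (cross_cut S))"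
    unfolding card_cut by simp
  moreover have "c * (real N - c - bs) + c * c / real M = c * ((1 - 1 / real M) * (real N - c))"
    using M by (simp add: bs_def field_simps)
  moreover have "c * (1 / 2 * (real N / 2)) \<le> c * ((1 - 1 / real M) * (real N - c))"
    using M half by (intro mult_left_mono mult_mono) (auto simp: c_def field_simps)
  ultimately have "c * (1 / 2 * (real N / 2)) \<le> real (card (cross_cut S))" by linarith
  then show ?thesis by (simp add: c_def)
qed

text \<open>The expected cut is at least \<open>card S * N * q / 4\<close>, and the lower tail bound
  loses another factor 4. The bound is a power with exponent \<open>card S\<close>, so that the
  union over all sets becomes a binomial sum.\<close>

lemma prob_cut_le:
  assumes S: "S \<subseteq> verts N" and half: "2 * card S \<le> N"
  shows "measure_pmf.prob law {\<epsilon>. (\<Sum>x\<in>S. \<Sum>y\<in>verts N - S. cross_adj \<epsilon> x y) \<le> real N * q / 16 * real (card S)}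
    \<le> exp (- (real N * q / 16)) ^ card S"
proof -
  define C where "C = (\<lambda>(x, y). {x, y}) ` cross_cut S"
  have finS: "finite S" using finite_subset[OF S finite_verts] .
  have inj: "inj_on (\<lambda>(x, y). {x, y}) (cross_cut S)"
    by (auto simp: inj_on_def cross_cut_def doubleton_eq_iff)
  have C: "C \<subseteq> vpairs N" using S by (auto simp: C_def cross_cut_def vpairs_def)
  define \<mu> where "\<mu> = real (card S) * real N / 4 * q"
  have "(\<Sum>e\<in>C. edge_prob B p q e) = (\<Sum>(x, y)\<in>cross_cut S. q)"
    unfolding C_def sum.reindex[OF inj] by (intro sum.cong refl) (auto simp: cross_cut_def edge_prob_pair)
  also have "\<dots> = real (card (cross_cut S)) * q" by (simp add: case_prod_unfold)
  finally have "\<mu> \<le> (\<Sum>e\<in>C. edge_prob B p q e)"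
    using mult_right_mono[OF card_cut_ge[OF S half] q01(1)] by (simp add: \<mu>_def)
  then have "measure_pmf.prob law {\<epsilon>. (\<Sum>e\<in>C. of_bool (\<epsilon> e)) \<le> \<mu> / 4} \<le> exp (- \<mu> / 4)"
    by (rule prob_count_le[OF C])
  moreover have "(\<Sum>e\<in>C. of_bool (\<epsilon> e)) = (\<Sum>x\<in>S. \<Sum>y\<in>verts N - S. cross_adj \<epsilon> x y)" for \<epsilon>
  proof -
    have "(\<Sum>e\<in>C. of_bool (\<epsilon> e) :: real) = (\<Sum>z\<in>cross_cut S. cross_adj \<epsilon> (fst z) (snd z))"
      unfolding C_def sum.reindex[OF inj]
      by (intro sum.cong refl) (auto simp: cross_cut_def cross_adj_def)
    also have "\<dots> = (\<Sum>z\<in>S \<times> (verts N - S). cross_adj \<epsilon> (fst z) (snd z))"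
      using finS by (intro sum.mono_neutral_left) (auto simp: cross_cut_def cross_adj_def)
    also have "\<dots> = (\<Sum>x\<in>S. \<Sum>y\<in>verts N - S. cross_adj \<epsilon> x y)"
      by (simp add: sum.cartesian_product case_prod_unfold)
    finally show "(\<Sum>e\<in>C. of_bool (\<epsilon> e)) = (\<Sum>x\<in>S. \<Sum>y\<in>verts N - S. cross_adj \<epsilon> x y)" .
  qed
  moreover have "\<mu> / 4 = real N * q / 16 * real (card S)" by (simp add: \<mu>_def)
  moreover have "exp (- \<mu> / 4) = exp (- (real N * q / 16)) ^ card S"
    by (simp add: \<mu>_def flip: exp_of_nat_mult)
  ultimately show ?thesis by (simp only:)
qed

text \<open>The event on which the hitting time is bounded deterministically in terms of the
  degrees. The degrees are bounded only from above: connectivity and the Poincare inequality come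
  from the last clause, the edge expansion of the cross-block graph.\<close>

definition good :: "graph \<Rightarrow> bool" where
  "good \<epsilon> \<longleftrightarrow> (\<forall>v\<in>verts N. real (deg N \<epsilon> v) \<le> 4 * \<gamma> (B v))
     \<and> (\<forall>v\<in>verts N. (\<Sum>w\<in>verts N. cross_adj \<epsilon> v w) \<le> 4 * (real N * q))
     \<and> (\<forall>S\<subseteq>verts N. 2 * card S \<le> N \<longrightarrow>
          real N * q / 16 * real (card S) \<le> (\<Sum>x\<in>S. \<Sum>y\<in>verts N - S. cross_adj \<epsilon> x y))"

lemma prob_not_good:
  assumes Nq: "32 * ln (real N) \<le> real N * q"
  shows "measure_pmf.prob law {\<epsilon>. \<not> good \<epsilon>} \<le> 4 / real N"
proof -
  define A1 where "A1 v = {\<epsilon>. 4 * \<gamma> (B v) \<le> real (deg N \<epsilon> v)}" for v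
  define A2 where "A2 v = {\<epsilon>. 4 * (real N * q) \<le> (\<Sum>w\<in>verts N. cross_adj \<epsilon> v w)}" for v
  define A3 where "A3 S = {\<epsilon>. (\<Sum>x\<in>S. \<Sum>y\<in>verts N - S. cross_adj \<epsilon> x y) \<le> real N * q / 16 * real (card S)}" for S
  \<comment> \<open>The empty set must be left out, since \<open>A3 {}\<close> is the certain
    event.\<close>
  define SS where "SS = {S. S \<subseteq> verts N \<and> S \<noteq> {} \<and> 2 * card S \<le> N}"
  have finSS: "finite SS" by (rule finite_subset[of _ "Pow (verts N)"]) (auto simp: SS_def)
  have N0: "0 < real N" using N by simp
  have expN: "exp (- 2 * ln (real N)) = 1 / (real N)\<^sup>2"
    using N0 by (simp add: exp_minus field_simps exp_double)
  have lnN: "0 \<le> ln (real N)" using N by simp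
  \<comment> \<open>The constant 32 in the hypothesis makes \<open>\<delta>\<close> at most
    \<open>1 / N\<^sup>2\<close>, so that \<open>N * \<delta>\<close> is still small.\<close>
  define \<delta> where "\<delta> = exp (- (real N * q / 16))"
  have "\<delta> \<le> exp (- 2 * ln (real N))" unfolding \<delta>_def using Nq by simp
  then have \<delta>: "0 \<le> \<delta>" "\<delta> \<le> 1 / (real N)\<^sup>2" unfolding expN by (auto simp: \<delta>_def)
  have "{\<epsilon>. \<not> good \<epsilon>} \<subseteq> (\<Union>v\<in>verts N. A1 v) \<union> (\<Union>v\<in>verts N. A2 v) \<union> (\<Union>S\<in>SS. A3 S)"
  proof
    fix \<epsilon> assume bad: "\<epsilon> \<in> {\<epsilon>. \<not> good \<epsilon>}"
    show "\<epsilon> \<in> (\<Union>v\<in>verts N. A1 v) \<union> (\<Union>v\<in>verts N. A2 v) \<union> (\<Union>S\<in>SS. A3 S)"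
    proof (rule ccontr)
      assume not: "\<epsilon> \<notin> (\<Union>v\<in>verts N. A1 v) \<union> (\<Union>v\<in>verts N. A2 v) \<union> (\<Union>S\<in>SS. A3 S)"
      have "real (deg N \<epsilon> v) \<le> 4 * \<gamma> (B v)" if "v \<in> verts N" for v
      proof -
        have "\<epsilon> \<notin> A1 v" using not that by blast
        then show ?thesis by (simp add: A1_def)
      qed
      moreover have "(\<Sum>w\<in>verts N. cross_adj \<epsilon> v w) \<le> 4 * (real N * q)" if "v \<in> verts N" for v
      proof -
        have "\<epsilon> \<notin> A2 v" using not that by blast
        then show ?thesis by (simp add: A2_def)
      qed
      moreover have "real N * q / 16 * real (card S) \<le> (\<Sum>x\<in>S. \<Sum>y\<in>verts N - S. cross_adj \<epsilon> x y)"
        if "S \<subseteq> verts N" "2 * card S \<le> N" for S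
      proof (cases "S = {}")
        case False
        then have "\<epsilon> \<notin> A3 S" using not that by (auto simp: SS_def)
        then show ?thesis by (simp add: A3_def)
      qed simp
      ultimately have "good \<epsilon>" unfolding good_def by blast
      then show False using bad by simp
    qed
  qed
  then have "measure_pmf.prob law {\<epsilon>. \<not> good \<epsilon>}
      \<le> measure_pmf.prob law ((\<Union>v\<in>verts N. A1 v) \<union> (\<Union>v\<in>verts N. A2 v) \<union> (\<Union>S\<in>SS. A3 S))"
    by (intro measure_pmf.finite_measure_mono) auto
  also have "\<dots> \<le> measure_pmf.prob law (\<Union>v\<in>verts N. A1 v) + measure_pmf.prob law (\<Union>v\<in>verts N. A2 v)
      + measure_pmf.prob law (\<Union>S\<in>SS. A3 S)"
    by (intro order.trans[OF measure_Un_le] add_mono measure_Un_le order_refl) auto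
  also have "\<dots> \<le> (\<Sum>v\<in>verts N. measure_pmf.prob law (A1 v)) + (\<Sum>v\<in>verts N. measure_pmf.prob law (A2 v))
      + (\<Sum>S\<in>SS. measure_pmf.prob law (A3 S))"
    by (intro add_mono measure_UNION_le finite_verts finSS) auto
  also have "(\<Sum>v\<in>verts N. measure_pmf.prob law (A1 v)) \<le> (\<Sum>v\<in>verts N. 1 / (real N)\<^sup>2)"
  proof (intro sum_mono)
    fix v assume v: "v \<in> verts N"
    have "measure_pmf.prob law (A1 v) \<le> exp (- 2 * \<gamma> (B v))" unfolding A1_def by (rule prob_deg_ge[OF v])
    also have "\<dots> \<le> exp (- 2 * ln (real N))" using q_le_\<gamma>[OF B_range[OF v]] Nq lnN by simp
    finally show "measure_pmf.prob law (A1 v) \<le> 1 / (real N)\<^sup>2" unfolding expN .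
  qed
  also have "(\<Sum>v\<in>verts N. measure_pmf.prob law (A2 v)) \<le> (\<Sum>v\<in>verts N. 1 / (real N)\<^sup>2)"
  proof (intro sum_mono)
    fix v assume v: "v \<in> verts N"
    have "measure_pmf.prob law (A2 v) \<le> exp (- 2 * (real N * q))" unfolding A2_def by (rule prob_cross_deg_ge[OF v])
    also have "\<dots> \<le> exp (- 2 * ln (real N))" using Nq lnN by simp
    finally show "measure_pmf.prob law (A2 v) \<le> 1 / (real N)\<^sup>2" unfolding expN .
  qed
  also have "(\<Sum>S\<in>SS. measure_pmf.prob law (A3 S)) \<le> 2 / real N"
  proof -
    have "(\<Sum>S\<in>SS. measure_pmf.prob law (A3 S)) \<le> (\<Sum>S\<in>SS. \<delta> ^ card S)"
      unfolding A3_def \<delta>_def by (intro sum_mono prob_cut_le) (auto simp: SS_def)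
    also have "\<dots> \<le> (\<Sum>S\<in>Pow (verts N) - {{}}. \<delta> ^ card S)"
      using \<delta> by (intro sum_mono2) (auto simp: SS_def)
    also have "\<dots> = (\<Sum>S\<in>Pow (verts N). \<delta> ^ card S) - 1"
      by (subst sum_diff1) auto
    \<comment> \<open>By the binomial theorem all subsets together weigh
      \<open>(1 + \<delta>) ^ N\<close>. The summand 1 of the empty set is removed, which leaves a
      quantity of order \<open>N * \<delta>\<close>.\<close>
    also have "(\<Sum>S\<in>Pow (verts N). \<delta> ^ card S) = (1 + \<delta>) ^ N"
      using prod_add[OF finite_verts, of "\<lambda>_. \<delta>" "\<lambda>_. 1" N] by (simp add: add.commute)
    also have "\<dots> \<le> exp (\<delta> * real N)"
    proof -
      have "(1 + \<delta>) ^ N \<le> exp \<delta> ^ N" using \<delta> by (intro power_mono) auto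
      then show ?thesis by (simp add: mult.commute flip: exp_of_nat_mult)
    qed
    also have "\<dots> \<le> exp (1 / real N)"
      using mult_right_mono[OF \<delta>(2), of "real N"] N0 by (simp add: power2_eq_square)
    also have "exp (1 / real N) \<le> 1 + 1 / real N + (1 / real N)\<^sup>2"
      using N by (intro exp_bound) auto
    also have "\<dots> \<le> 1 + 2 / real N" using N by (simp add: power2_eq_square field_simps)
    finally show ?thesis by simp
  qed
  also have "(\<Sum>v\<in>verts N. 1 / (real N)\<^sup>2) = 1 / real N"
    using N0 by (simp add: power2_eq_square)
  finally show ?thesis by (simp add: add_divide_distrib[symmetric])
qed

end

section \<open>Consequences of expansion: connectedness, Poincare inequality, hitting time
  bounds\<close>

context block_model
begin

lemma cross_adj_bounds: "0 \<le> cross_adj \<epsilon> x y \<and> cross_adj \<epsilon> x y \<le> real (adj \<epsilon> x y)"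
  by (simp add: cross_adj_def adj_def)

lemma cross_adj_sym: "cross_adj \<epsilon> x y = cross_adj \<epsilon> y x"
  by (auto simp: cross_adj_def insert_commute)

lemma good_expansion:
  "good \<epsilon> \<Longrightarrow> S \<subseteq> verts N \<Longrightarrow> 2 * card S \<le> N \<Longrightarrow>
    real N * q / 16 * real (card S) \<le> (\<Sum>x\<in>S. \<Sum>y\<in>verts N - S. cross_adj \<epsilon> x y)"
  by (simp add: good_def)

text \<open>No cross-block edge leaves the set of vertices reachable from \<open>v\<close>, and none
  leaves its complement. One of the two has at most half of the vertices, and expansion forces it to
  be empty.\<close>

lemma good_connected:
  assumes good: "good \<epsilon>" and q: "0 < q"
  shows "connected_graph N \<epsilon>"
  unfolding connected_graph_def
proof (intro ballI)
  fix v w assume v: "v \<in> verts N" and w: "w \<in> verts N"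
  define R where "R = {(x, y). x \<in> verts N \<and> y \<in> verts N \<and> \<epsilon> {x, y}}"
  define C where "C = {y \<in> verts N. (v, y) \<in> R\<^sup>*}"
  have v_C: "v \<in> C" using v by (simp add: C_def)
  have C: "C \<subseteq> verts N" "finite C" by (auto simp: C_def)
  have no_edge: "cross_adj \<epsilon> x y = 0" if "x \<in> C" "y \<in> verts N - C" for x y
  proof -
    have "(x, y) \<notin> R" using that rtrancl_into_rtrancl[of v x R y] by (auto simp: C_def)
    then show ?thesis using that by (auto simp: R_def C_def cross_adj_def)
  qed
  have empty: "S = {}" if S: "S \<subseteq> verts N" "2 * card S \<le> N"
    and zero: "\<And>x y. x \<in> S \<Longrightarrow> y \<in> verts N - S \<Longrightarrow> cross_adj \<epsilon> x y = 0" for S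
  proof -
    have "real N * q / 16 * real (card S) \<le> 0"
      using good_expansion[OF good S] zero by simp
    then have "card S = 0" using q N by (simp add: mult_le_0_iff)
    then show ?thesis using finite_subset[OF S(1) finite_verts] by simp
  qed
  have "w \<in> C"
  proof (cases "2 * card C \<le> N")
    case True
    then have "C = {}" using no_edge by (intro empty C) auto
    then show ?thesis using v_C by simp
  next
    case False
    have "card (verts N - C) = N - card C" using C by (simp add: card_Diff_subset)
    moreover have "cross_adj \<epsilon> x y = 0" if "x \<in> verts N - C" "y \<in> verts N - (verts N - C)" for x y
      using no_edge[of y x] that cross_adj_sym[of \<epsilon> x y] by simp
    ultimately have "verts N - C = {}"
      using False by (intro empty) auto
    then show ?thesis using w by blast
  qed
  then show "(v, w) \<in> {(x, y). x \<in> verts N \<and> y \<in> verts N \<and> \<epsilon> {x, y}}\<^sup>*"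
    by (simp add: C_def R_def)
qed

text \<open>The inequality is proved for the cross-block graph, and adding the edges inside the
  blocks only increases the energy. The constant is \<open>D / h\<^sup>2\<close> with
  \<open>D = 4 * (N * q)\<close> and \<open>h = N * q / 16\<close>.\<close>

lemma good_poincare:
  assumes good: "good \<epsilon>" and q: "0 < q"
  shows "\<exists>c. (\<Sum>x\<in>verts N. (g x - c)\<^sup>2)
    \<le> 1024 / (real N * q) * (\<Sum>x\<in>verts N. \<Sum>y\<in>verts N. real (adj \<epsilon> x y) * (g x - g y)\<^sup>2)"
proof -
  define h where "h = real N * q / 16"
  define D where "D = 4 * (real N * q)"
  have Nq: "0 < real N * q" using q N by simp
  obtain c where "(\<Sum>x\<in>verts N. (g x - c)\<^sup>2)
      \<le> D / h\<^sup>2 * (\<Sum>x\<in>verts N. \<Sum>y\<in>verts N. cross_adj \<epsilon> x y * (g x - g y)\<^sup>2)"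
  proof (rule poincare_isoperimetric[of "verts N" "cross_adj \<epsilon>" h D g])
    show "verts N \<noteq> {}" using N by (simp add: verts_def)
    show "0 < h" "0 < D" using Nq by (simp_all add: h_def D_def)
    show "h * real (card S) \<le> (\<Sum>x\<in>S. \<Sum>y\<in>verts N - S. cross_adj \<epsilon> x y)"
      if "S \<subseteq> verts N" "2 * card S \<le> card (verts N)" for S
      unfolding h_def using that by (intro good_expansion good) auto
    show "(\<Sum>y\<in>verts N. cross_adj \<epsilon> x y) \<le> D" if "x \<in> verts N" for x
      using good that unfolding good_def D_def by blast
  qed (use cross_adj_bounds cross_adj_sym in auto)
  also have "D / h\<^sup>2 = 1024 / (real N * q)" using Nq by (simp add: D_def h_def power2_eq_square field_simps)
  also have "1024 / (real N * q) * (\<Sum>x\<in>verts N. \<Sum>y\<in>verts N. cross_adj \<epsilon> x y * (g x - g y)\<^sup>2)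
      \<le> 1024 / (real N * q) * (\<Sum>x\<in>verts N. \<Sum>y\<in>verts N. real (adj \<epsilon> x y) * (g x - g y)\<^sup>2)"
    using Nq cross_adj_bounds by (intro mult_left_mono sum_mono mult_right_mono) auto
  finally show ?thesis by blast
qed

text \<open>Connectedness makes the expected hitting times finite, so \<open>enn2real\<close> does
  not replace an infinite value by 0. The constant 4096 is four times the Poincare constant
  1024.\<close>

lemma good_mean_hitting_time:
  assumes good: "good \<epsilon>" and q: "0 < q" and w: "w \<in> verts N"
  defines "H \<equiv> enn2real (mean_hitting_time N \<epsilon> w)" and "d \<equiv> real (deg N \<epsilon> w)"
  shows "vol \<epsilon> / d - 2 \<le> H"
    and "H \<le> vol \<epsilon> / d + 4096 / (real N * q) * vol \<epsilon>
      * ((\<Sum>x\<in>verts N. (real (deg N \<epsilon> x))\<^sup>2) / (vol \<epsilon>)\<^sup>2 + 1 / d) + 2 * vol \<epsilon> / d\<^sup>2"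
proof -
  have conn: "connected_graph N \<epsilon>" by (rule good_connected[OF good q])
  obtain f :: "nat \<Rightarrow> real" where f: "f w = 0" "\<And>v. 0 \<le> f v"
    "\<And>v. v \<in> verts N \<Longrightarrow> exp_hitting_time N \<epsilon> v w = ennreal (f v)"
    "\<And>v. v \<in> verts N \<Longrightarrow> v \<noteq> w \<Longrightarrow>
      real (deg N \<epsilon> v) * f v = real (deg N \<epsilon> v) + (\<Sum>x\<in>verts N. real (adj \<epsilon> v x) * f x)"
    using hitting_time_equations[OF conn w N] by blast
  have d: "0 < d" unfolding d_def using connected_graph_deg_pos[OF conn w N] by simp
  have deg: "(\<Sum>y\<in>verts N. real (adj \<epsilon> x y)) = real (deg N \<epsilon> x)" for x
    by (simp add: deg_def)
  have vol0: "0 \<le> vol \<epsilon>" by (intro sum_nonneg) auto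
  have H: "H = (\<Sum>x\<in>verts N. real (deg N \<epsilon> x) / vol \<epsilon> * f x)"
  proof -
    have "mean_hitting_time N \<epsilon> w = (\<Sum>x\<in>verts N. ennreal (real (deg N \<epsilon> x) / vol \<epsilon> * f x))"
      unfolding mean_hitting_time_def invariant_dist_def sum_deg_eq[symmetric]
      by (intro sum.cong refl) (simp add: f(2,3) vol0 ennreal_mult[symmetric] del: of_nat_sum)
    also have "\<dots> = ennreal (\<Sum>x\<in>verts N. real (deg N \<epsilon> x) / vol \<epsilon> * f x)"
      using vol0 f(2) by (intro sum_ennreal mult_nonneg_nonneg divide_nonneg_nonneg) auto
    finally show ?thesis
      unfolding H_def using vol0 f(2) by (simp add: sum_nonneg del: of_nat_sum)
  qed
  define a where "a x y = real (adj \<epsilon> x y)" for x y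
  have a: "0 \<le> a x y \<and> a x y \<le> 1" "a x y = a y x" for x y
    by (simp_all add: a_def adj_def insert_commute)
  note bounds = mean_hitting_time_bounds[of "verts N" w a f "1024 / (real N * q)",
      unfolded deg[folded a_def] d_def[symmetric] H[symmetric],
      OF finite_verts w a(2) a(1) d f(1) f(4)[folded a_def] _ good_poincare[OF good q, folded a_def]]
  have "vol \<epsilon> / d - 1 - 1 \<le> H \<and> H \<le> vol \<epsilon> / d - 1 + 1 + 4 * (1024 / (real N * q)) * vol \<epsilon>
      * ((\<Sum>x\<in>verts N. (real (deg N \<epsilon> x))\<^sup>2) / (vol \<epsilon>)\<^sup>2 + 1 / d) + 2 * (vol \<epsilon> / d - 1) / d"
    using bounds q by simp
  moreover have "2 * (vol \<epsilon> / d - 1) / d = 2 * vol \<epsilon> / d\<^sup>2 - 2 / d"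
    using d by (simp add: power2_eq_square field_simps)
  moreover have "0 \<le> 2 / d" using d by simp
  moreover have "4 * (1024 / (real N * q)) = 4096 / (real N * q)" by simp
  moreover have "u - 2 \<le> H \<and> H \<le> u + T + Y"
    if "u - 1 - 1 \<le> H \<and> H \<le> u - 1 + 1 + T + X" "X = Y - Z" "0 \<le> Z" for u T X Y Z :: real
    using that by linarith
  ultimately show "vol \<epsilon> / d - 2 \<le> H"
    and "H \<le> vol \<epsilon> / d + 4096 / (real N * q) * vol \<epsilon>
      * ((\<Sum>x\<in>verts N. (real (deg N \<epsilon> x))\<^sup>2) / (vol \<epsilon>)\<^sup>2 + 1 / d) + 2 * vol \<epsilon> / d\<^sup>2"
    by metis+
qed

section \<open>Concentration of the volume and of the degree of \<open>w\<close>\<close>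

lemma var_bounds:
  assumes "l \<in> {1..M}"
  shows "0 \<le> var l" "var l \<le> \<gamma> l"
proof -
  have p: "0 \<le> p l" "p l \<le> 1" using p01[OF assms] by auto
  show "0 \<le> var l" unfolding var_deg_def using p q01 M by (intro add_nonneg_nonneg mult_nonneg_nonneg) auto
  have "real N / real M * p l * (1 - p l) \<le> real N / real M * p l"
    using p by (intro mult_right_le_one_le mult_nonneg_nonneg) auto
  moreover have "(real M - 1) * (real N / real M) * q * (1 - q) \<le> (real M - 1) * (real N / real M) * q"
    using q01 M by (intro mult_right_le_one_le mult_nonneg_nonneg) auto
  ultimately show "var l \<le> \<gamma> l" unfolding var_deg_def exp_deg_def by linarith
qed

lemma \<gamma>_nonneg: "l \<in> {1..M} \<Longrightarrow> 0 \<le> \<gamma> l"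
  using var_bounds[of l] by linarith

lemma \<gamma>_le_N: "l \<in> {1..M} \<Longrightarrow> \<gamma> l \<le> real N"
proof -
  assume l: "l \<in> {1..M}"
  have "\<gamma> l \<le> real N / real M * 1 + (real M - 1) * (real N / real M) * 1"
    unfolding exp_deg_def using p01[OF l] q01 M by (intro add_mono mult_left_mono) auto
  also have "\<dots> = real N" using M by (simp add: field_simps)
  finally show ?thesis .
qed

lemma \<gamma>_le_avg: "l \<in> {1..M} \<Longrightarrow> \<gamma> l \<le> real M * exp_deg_avg M N p q"
proof -
  assume l: "l \<in> {1..M}"
  have "\<gamma> l \<le> (\<Sum>l=1..M. \<gamma> l)" by (intro member_le_sum l \<gamma>_nonneg) auto
  then show ?thesis using M by (simp add: exp_deg_avg_def block_avg_def)
qed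

lemma sum_block_avg: "(\<Sum>v\<in>verts N. F (B v)) = real N * block_avg M F"
  unfolding sum_blocks using M by (simp add: block_avg_def bs_def)

lemma vol_eq: "vol \<epsilon> = (\<Sum>e\<in>vpairs N. (2 - of_bool (is_singleton e)) * of_bool (\<epsilon> e))"
  unfolding deg_eq_sum by (rule sum_ordered_pairs_eq)

lemma vol_centered:
  "vol \<epsilon> - real N * exp_deg_avg M N p q
    = (\<Sum>e\<in>vpairs N. (2 - of_bool (is_singleton e)) * (of_bool (\<epsilon> e) - edge_prob B p q e))"
proof -
  have "(\<Sum>e\<in>vpairs N. (2 - of_bool (is_singleton e)) * edge_prob B p q e) = (\<Sum>v\<in>verts N. \<gamma> (B v))"
    unfolding sum_ordered_pairs_eq[symmetric] by (intro sum.cong refl sum_star_edge_prob)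
  also have "\<dots> = real N * exp_deg_avg M N p q" unfolding exp_deg_avg_def by (rule sum_block_avg)
  finally show ?thesis unfolding vol_eq right_diff_distrib sum_subtractf by simp
qed

text \<open>In the volume an edge has weight 2 and a loop weight 1, so a squared weight is at most
  twice the weight. Hence the variance of the volume is at most twice the sum of the degree
  variances.\<close>

lemma prob_vol_deviation:
  assumes t: "0 < t"
  shows "measure_pmf.prob law {\<epsilon>. t \<le> \<bar>vol \<epsilon> - real N * exp_deg_avg M N p q\<bar>}
    \<le> 2 * real N * block_avg M var / t\<^sup>2"
proof -
  define r where "r = edge_prob B p q"
  have r: "0 \<le> r e * (1 - r e)" if "e \<in> vpairs N" for e using r01[OF that] by (simp add: r_def)
  have "measure_pmf.prob law {\<epsilon>. t \<le> \<bar>vol \<epsilon> - real N * exp_deg_avg M N p q\<bar>}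
      \<le> (\<Sum>e\<in>vpairs N. (2 - of_bool (is_singleton e))\<^sup>2 * (r e * (1 - r e))) / t\<^sup>2"
    unfolding vol_centered r_def by (rule prob_centered_ge[OF order_refl t])
  also have "\<dots> \<le> (\<Sum>e\<in>vpairs N. 2 * ((2 - of_bool (is_singleton e)) * (r e * (1 - r e)))) / t\<^sup>2"
    using r by (intro divide_right_mono sum_mono) (auto simp: of_bool_def power2_eq_square)
  also have "(\<Sum>e\<in>vpairs N. 2 * ((2 - of_bool (is_singleton e)) * (r e * (1 - r e))))
      = 2 * (\<Sum>v\<in>verts N. var (B v))"
    using sum_ordered_pairs_eq[of "\<lambda>e. r e * (1 - r e)" N]
    by (simp add: r_def sum_star_variance flip: sum_distrib_left)
  finally show ?thesis by (simp add: sum_block_avg)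
qed

lemma deg_centered:
  assumes w: "w \<in> verts N"
  shows "\<gamma> (B w) - real (deg N \<epsilon> w) = (\<Sum>e\<in>star w (verts N). edge_prob B p q e - of_bool (\<epsilon> e))"
  by (simp add: sum_over_star sum_subtractf deg_eq_sum sum_star_edge_prob[OF w] del: sum_of_bool_eq)

lemma star_variance:
  assumes w: "w \<in> verts N"
  shows "(\<Sum>e\<in>star w (verts N). edge_prob B p q e * (1 - edge_prob B p q e)) = var (B w)"
  unfolding sum_over_star by (rule sum_star_variance[OF w])

lemma prob_deg_deviation:
  assumes w: "w \<in> verts N" and t: "0 < t"
  shows "measure_pmf.prob law {\<epsilon>. t \<le> \<bar>\<gamma> (B w) - real (deg N \<epsilon> w)\<bar>} \<le> var (B w) / t\<^sup>2"
  using prob_centered_ge[OF star_subset[OF w order_refl] t, of "\<lambda>_. - 1"]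
  by (simp add: deg_centered[OF w] star_variance[OF w])

end

text \<open>The deterministic linearisation. Here \<open>d\<close> and \<open>v\<close> stand for
  the degree of \<open>w\<close> and the volume, \<open>g\<close> and \<open>V\<close> for their
  means, and \<open>b\<close> for \<open>N q\<close>. \<open>A\<close> measures the deviation of
  \<open>d\<close> in standard deviations, and \<open>\<delta>\<close> that of \<open>v\<close> on
  the scale on which it enters the rescaled hitting time.\<close>

lemma rescaled_error_bound:
  fixes g \<upsilon> V d v H b M N A \<delta> s :: real
  assumes A: "1 \<le> A" "2 * A \<le> \<upsilon>" and g: "\<upsilon>\<^sup>2 \<le> g" "g \<le> N" and V: "0 < V" "N * g \<le> M * V"
    and b: "0 < b" and M: "1 \<le> M" and \<delta>: "0 < \<delta>" "\<delta> \<le> 1"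
    and dev_d: "\<bar>g - d\<bar> \<le> A * \<upsilon>" and dev_v: "\<bar>v - V\<bar> \<le> \<delta> * (V * \<upsilon> / g)"
    and s: "0 \<le> s" "s \<le> 8 * M / N"
    and lower: "v / d - 2 \<le> H"
    and upper: "H \<le> v / d + 4096 / b * v * (s + 1 / d) + 2 * v / d\<^sup>2"
  shows "\<bar>g\<^sup>2 / (\<upsilon> * V) * (H - V / g) - (g - d) / \<upsilon>\<bar>
    \<le> 2 * \<delta> + (2 * A\<^sup>2 + 2 * M + 16) / \<upsilon> + 81920 * M * (g / (b * \<upsilon>))"
proof -
  have \<upsilon>: "2 \<le> \<upsilon>" using A by linarith
  have "\<upsilon> * 2 \<le> \<upsilon>\<^sup>2" using \<upsilon> by (simp add: power2_eq_square)
  then have \<upsilon>g: "2 * \<upsilon> \<le> g" using g by linarith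
  have g0: "0 < g" using \<upsilon>g \<upsilon> by linarith
  have N0: "0 < N" using g g0 by linarith
  have "2 * (A * \<upsilon>) \<le> \<upsilon> * \<upsilon>" using A \<upsilon> by (simp flip: mult.assoc)
  then have A\<upsilon>: "2 * (A * \<upsilon>) \<le> g" using g by (simp add: power2_eq_square)
  have d: "g / 2 \<le> d" using dev_d A\<upsilon> by linarith
  then have d0: "0 < d" using g0 by linarith
  have inv_d: "1 / d \<le> 2 / g" using d g0 d0 by (simp add: field_simps)
  have gd: "g / d \<le> 2" using d d0 by (simp add: field_simps)
  define k where "k = g\<^sup>2 / (\<upsilon> * V)"
  define \<xi> where "\<xi> = g * (v - V) / (V * \<upsilon>)"
  define e where "e = H - v / d"
  have k0: "0 \<le> k" using V \<upsilon> by (simp add: k_def)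
  have kV: "k * V = g\<^sup>2 / \<upsilon>" using V by (simp add: k_def)
  \<comment> \<open>An exact identity: the remainder of expanding \<open>1 / d\<close> around
    \<open>1 / g\<close>, the fluctuation of the volume, and the error \<open>e\<close> of
    \<open>v / d\<close> as an approximation of \<open>H\<close>.\<close>
  have "k * (H - V / g) - (g - d) / \<upsilon> = (g - d)\<^sup>2 / (d * \<upsilon>) + g / d * \<xi> + k * e"
    using d0 g0 V \<upsilon> by (simp add: k_def \<xi>_def e_def power2_eq_square field_simps)
  moreover have "\<bar>x + y + z\<bar> \<le> \<bar>x\<bar> + \<bar>y\<bar> + \<bar>z\<bar>" for x y z :: real by linarith
  ultimately have "\<bar>k * (H - V / g) - (g - d) / \<upsilon>\<bar> \<le> \<bar>(g - d)\<^sup>2 / (d * \<upsilon>)\<bar> + \<bar>g / d * \<xi>\<bar> + \<bar>k * e\<bar>"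
    by (simp only:)
  also have "\<bar>(g - d)\<^sup>2 / (d * \<upsilon>)\<bar> \<le> 2 * A\<^sup>2 / \<upsilon>"
  proof -
    have "(g - d)\<^sup>2 \<le> (A * \<upsilon>)\<^sup>2" using power_mono[OF dev_d, of 2] by simp
    also have "\<dots> \<le> A\<^sup>2 * g" using g by (simp add: power_mult_distrib mult_left_mono)
    also have "\<dots> \<le> A\<^sup>2 * (2 * d)" using d by (intro mult_left_mono) auto
    finally have "(g - d)\<^sup>2 / (d * \<upsilon>) \<le> A\<^sup>2 * (2 * d) / (d * \<upsilon>)"
      using d0 \<upsilon> by (intro divide_right_mono) auto
    also have "\<dots> = 2 * A\<^sup>2 / \<upsilon>" using d0 by simp
    finally show ?thesis using d0 \<upsilon> by simp
  qed
  also have "\<bar>g / d * \<xi>\<bar> \<le> 2 * \<delta>"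
  proof -
    have "\<bar>\<xi>\<bar> = g / (V * \<upsilon>) * \<bar>v - V\<bar>" using g0 V \<upsilon> by (simp add: \<xi>_def abs_mult)
    also have "\<dots> \<le> g / (V * \<upsilon>) * (\<delta> * (V * \<upsilon> / g))"
      using dev_v g0 V \<upsilon> by (intro mult_left_mono) auto
    also have "\<dots> = \<delta>" using g0 V \<upsilon> by simp
    finally have "\<bar>\<xi>\<bar> \<le> \<delta>" .
    then have "g / d * \<bar>\<xi>\<bar> \<le> 2 * \<delta>" using gd \<delta> by (intro mult_mono) auto
    then show ?thesis using g0 d0 by (simp add: abs_mult)
  qed
  also have "\<bar>k * e\<bar> \<le> 2 * M / \<upsilon> + 16 / \<upsilon> + 81920 * M * (g / (b * \<upsilon>))"
  proof (rule abs_leI)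
    \<comment> \<open>The scaling factor \<open>k\<close> is itself at most
      \<open>M / \<upsilon>\<close>, so the additive constant 2 in the lower bound is
      harmless.\<close>
    have "k * N * g \<le> k * (M * V)" using V(2) k0 by (simp add: mult.assoc mult_left_mono)
    also have "\<dots> = M * g\<^sup>2 / \<upsilon>" using kV by (simp add: mult_ac)
    finally have "k * N \<le> M * g / \<upsilon>" using g0 \<upsilon> by (simp add: power2_eq_square field_simps)
    also have "\<dots> \<le> M * N / \<upsilon>" using g M \<upsilon> by (intro divide_right_mono mult_left_mono) auto
    finally have "k * N \<le> M / \<upsilon> * N" by simp
    then have k: "k \<le> M / \<upsilon>" using N0 by (rule mult_right_le_imp_le)
    have "- e \<le> 2" using lower by (simp add: e_def)
    then have "k * (- e) \<le> k * 2" using k0 by (rule mult_left_mono)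
    then have "- (k * e) \<le> k * 2" by simp
    also have "\<dots> \<le> 2 * M / \<upsilon>" using k by simp
    also have "\<dots> \<le> 2 * M / \<upsilon> + 16 / \<upsilon> + 81920 * M * (g / (b * \<upsilon>))"
      using M g0 b \<upsilon> by simp
    finally show "- (k * e) \<le> 2 * M / \<upsilon> + 16 / \<upsilon> + 81920 * M * (g / (b * \<upsilon>))" .
    have "\<delta> * (V * \<upsilon> / g) \<le> 1 * (V * \<upsilon> / g)" using \<delta> V \<upsilon> g0 by (intro mult_right_mono) auto
    also have "\<dots> \<le> V" using \<upsilon>g \<upsilon> V g0 by (simp add: field_simps)
    finally have v: "v \<le> 2 * V" "0 \<le> v" using dev_v by auto
    have "8 * M / N \<le> 8 * M / g" using g g0 M by (intro divide_left_mono) auto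
    then have "s + 1 / d \<le> 8 * M / g + 2 / g" using s inv_d by linarith
    also have "\<dots> \<le> 10 * M / g" using M g0 by (simp add: field_simps)
    finally have s1: "s + 1 / d \<le> 10 * M / g" .
    have "e \<le> 4096 / b * v * (s + 1 / d) + 2 * v * (1 / d)\<^sup>2"
      using upper by (simp add: e_def power_divide)
    \<comment> \<open>The origin of the constants: 81920 is 4096 times 2 times 10, and 16 is 2 times
      2 times the square of 2.\<close>
    also have "\<dots> \<le> 4096 / b * (2 * V) * (10 * M / g) + 2 * (2 * V) * (2 / g)\<^sup>2"
      using v s s1 b d0 inv_d V by (intro add_mono mult_mono power_mono) auto
    finally have "k * e \<le> k * (4096 / b * (2 * V) * (10 * M / g) + 2 * (2 * V) * (2 / g)\<^sup>2)"
      using k0 by (rule mult_left_mono)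
    also have "\<dots> = (k * V) * (81920 * M / (b * g) + 16 / g\<^sup>2)"
      by (simp add: power_divide algebra_simps)
    also have "\<dots> = 16 / \<upsilon> + 81920 * M * (g / (b * \<upsilon>))"
      unfolding kV using g0 \<upsilon> b by (simp add: power2_eq_square field_simps)
    also have "\<dots> \<le> 2 * M / \<upsilon> + 16 / \<upsilon> + 81920 * M * (g / (b * \<upsilon>))"
      using M \<upsilon> by simp
    finally show "k * e \<le> 2 * M / \<upsilon> + 16 / \<upsilon> + 81920 * M * (g / (b * \<upsilon>))" .
  qed
  finally show ?thesis by (simp add: k_def add_divide_distrib)
qed

context block_model
begin

text \<open>Three events are discarded: the graph is not good, the degree of \<open>w\<close> is off
  by \<open>A\<close> standard deviations, or the volume is off. The last term is Chebyshev's bound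
  for the volume, in the form that the third growth condition makes small. \<open>A\<close> and
  \<open>\<delta>\<close> stay free, to be fixed before \<open>N\<close> grows.\<close>

lemma prob_error_le:
  assumes w: "w \<in> verts N" and q: "0 < q" and Nq: "32 * ln (real N) \<le> real N * q"
    and A: "1 \<le> A" "2 * A \<le> sd_deg M N p q (B w)" and \<delta>: "0 < \<delta>" "\<delta> \<le> 1"
    and H: "\<And>\<epsilon>. connected_graph N \<epsilon> \<Longrightarrow> H \<epsilon> = enn2real (mean_hitting_time N \<epsilon> w)"
  defines "g \<equiv> \<gamma> (B w)" and "\<upsilon> \<equiv> sd_deg M N p q (B w)" and "G \<equiv> exp_deg_avg M N p q"
  shows "measure_pmf.prob law {\<epsilon>. 2 * \<delta> + (2 * A\<^sup>2 + 2 * real M + 16) / \<upsilon> + 81920 * real M * (g / (real N * q * \<upsilon>))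
      < \<bar>g\<^sup>2 / (real N * \<upsilon> * G) * (H \<epsilon> - real N * G / g) - (g - real (deg N \<epsilon> w)) / \<upsilon>\<bar>}
    \<le> 4 / real N + 1 / A\<^sup>2 + 2 / \<delta>\<^sup>2 * (sd_deg_avg M N p q / \<upsilon> * (g / G) / sqrt (real N))\<^sup>2"
proof -
  define V where "V = real N * G"
  have Bw: "B w \<in> {1..M}" by (rule B_range[OF w])
  have N0: "0 < real N" using N by simp
  have \<upsilon>: "2 \<le> \<upsilon>" using A by (simp add: \<upsilon>_def)
  have \<upsilon>2: "\<upsilon>\<^sup>2 = var (B w)" using var_bounds[OF Bw] by (simp add: \<upsilon>_def sd_deg_def)
  have g: "\<upsilon>\<^sup>2 \<le> g" "g \<le> real N" unfolding \<upsilon>2 g_def using var_bounds[OF Bw] \<gamma>_le_N[OF Bw] by auto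
  have "4 \<le> \<upsilon>\<^sup>2" using power_mono[OF \<upsilon>, of 2] by simp
  then have g0: "0 < g" using g by linarith
  have gG: "g \<le> real M * G" unfolding g_def G_def by (rule \<gamma>_le_avg[OF Bw])
  then have "0 < real M * G" using g0 by linarith
  then have G0: "0 < G" using M by (simp add: zero_less_mult_iff)
  have V0: "0 < V" using G0 N0 by (simp add: V_def)
  define t where "t = \<delta> * (V * \<upsilon> / g)"
  have t0: "0 < t" using \<delta> V0 \<upsilon> g0 by (simp add: t_def)
  define Bad1 where "Bad1 = {\<epsilon>. \<not> good \<epsilon>}"
  define Bad2 where "Bad2 = {\<epsilon>. A * \<upsilon> \<le> \<bar>g - real (deg N \<epsilon> w)\<bar>}"
  define Bad3 where "Bad3 = {\<epsilon>. t \<le> \<bar>vol \<epsilon> - V\<bar>}"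
  have bound: "\<bar>g\<^sup>2 / (\<upsilon> * V) * (H \<epsilon> - V / g) - (g - real (deg N \<epsilon> w)) / \<upsilon>\<bar>
      \<le> 2 * \<delta> + (2 * A\<^sup>2 + 2 * real M + 16) / \<upsilon> + 81920 * real M * (g / (real N * q * \<upsilon>))"
    if \<epsilon>: "\<epsilon> \<notin> Bad1" "\<epsilon> \<notin> Bad2" "\<epsilon> \<notin> Bad3" for \<epsilon>
  proof -
    have good: "good \<epsilon>" using \<epsilon> by (simp add: Bad1_def)
    have dev_v: "\<bar>vol \<epsilon> - V\<bar> \<le> t" using \<epsilon> unfolding Bad3_def by (simp del: of_nat_sum)
    have "V * \<upsilon> / g \<le> V / 2"
    proof -
      have "2 * \<upsilon> \<le> \<upsilon>\<^sup>2" using \<upsilon> by (simp add: power2_eq_square)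
      then have "2 * \<upsilon> \<le> g" using g(1) by linarith
      then show ?thesis using V0 g0 by (simp add: field_simps)
    qed
    moreover have "t \<le> 1 * (V * \<upsilon> / g)"
      unfolding t_def using \<delta> V0 \<upsilon> g0 by (intro mult_right_mono) auto
    ultimately have "t \<le> V / 2" by linarith
    then have vol_ge: "V / 2 \<le> vol \<epsilon>" using dev_v by (simp del: of_nat_sum)
    \<comment> \<open>The sum of squares is at most the maximal degree times the volume, and on a
      good graph every degree is at most \<open>4 * M * G\<close>.\<close>
    have "(\<Sum>x\<in>verts N. (real (deg N \<epsilon> x))\<^sup>2) \<le> (\<Sum>x\<in>verts N. (4 * real M * G) * real (deg N \<epsilon> x))"
    proof (intro sum_mono)
      fix x assume x: "x \<in> verts N"
      have "real (deg N \<epsilon> x) \<le> 4 * \<gamma> (B x)" using good x by (simp add: good_def)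
      also have "\<dots> \<le> 4 * real M * G" using \<gamma>_le_avg[OF B_range[OF x]] by (simp add: G_def)
      finally show "(real (deg N \<epsilon> x))\<^sup>2 \<le> (4 * real M * G) * real (deg N \<epsilon> x)"
        unfolding power2_eq_square by (rule mult_right_mono) simp
    qed
    also have "\<dots> = 4 * real M * G * vol \<epsilon>" by (simp add: sum_distrib_left)
    finally have "(\<Sum>x\<in>verts N. (real (deg N \<epsilon> x))\<^sup>2) / (vol \<epsilon>)\<^sup>2 \<le> 4 * real M * G * vol \<epsilon> / (vol \<epsilon>)\<^sup>2"
      by (intro divide_right_mono) auto
    also have "\<dots> = 4 * real M * G / vol \<epsilon>"
      using vol_ge V0 by (simp add: power2_eq_square del: of_nat_sum)
    also have "\<dots> \<le> 4 * real M * G / (V / 2)"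
      using vol_ge V0 G0 by (intro divide_left_mono) (auto simp del: of_nat_sum)
    also have "\<dots> = 8 * real M / real N" using G0 by (simp add: V_def)
    finally have s: "(\<Sum>x\<in>verts N. (real (deg N \<epsilon> x))\<^sup>2) / (vol \<epsilon>)\<^sup>2 \<le> 8 * real M / real N" .
    note hit = good_mean_hitting_time[OF good q w, folded H[OF good_connected[OF good q]]]
    show ?thesis
    proof (rule rescaled_error_bound[OF A(1) _ g V0 _ _ _ \<delta> _ _ _ s hit])
      show "2 * A \<le> \<upsilon>" using A by (simp add: \<upsilon>_def)
      show "real N * g \<le> real M * V" using gG N0 by (simp add: V_def mult.left_commute)
      show "0 < real N * q" using N0 q by simp
      show "1 \<le> real M" using M by simp
      show "\<bar>g - real (deg N \<epsilon> w)\<bar> \<le> A * \<upsilon>" using \<epsilon> by (simp add: Bad2_def)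
      show "\<bar>vol \<epsilon> - V\<bar> \<le> \<delta> * (V * \<upsilon> / g)" using dev_v unfolding t_def .
      show "0 \<le> (\<Sum>x\<in>verts N. (real (deg N \<epsilon> x))\<^sup>2) / (vol \<epsilon>)\<^sup>2" by (simp add: sum_nonneg)
    qed
  qed
  have "measure_pmf.prob law {\<epsilon>. 2 * \<delta> + (2 * A\<^sup>2 + 2 * real M + 16) / \<upsilon> + 81920 * real M * (g / (real N * q * \<upsilon>))
      < \<bar>g\<^sup>2 / (real N * \<upsilon> * G) * (H \<epsilon> - real N * G / g) - (g - real (deg N \<epsilon> w)) / \<upsilon>\<bar>}
      \<le> measure_pmf.prob law (Bad1 \<union> Bad2 \<union> Bad3)"
  proof (rule measure_pmf.finite_measure_mono)
    have eq: "real N * \<upsilon> * G = \<upsilon> * V" "real N * G = V" by (simp_all add: V_def)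
    show "{\<epsilon>. 2 * \<delta> + (2 * A\<^sup>2 + 2 * real M + 16) / \<upsilon> + 81920 * real M * (g / (real N * q * \<upsilon>))
      < \<bar>g\<^sup>2 / (real N * \<upsilon> * G) * (H \<epsilon> - real N * G / g) - (g - real (deg N \<epsilon> w)) / \<upsilon>\<bar>} \<subseteq> Bad1 \<union> Bad2 \<union> Bad3"
      unfolding eq
    proof (rule subsetI, rule ccontr)
      fix \<epsilon>
      assume err: "\<epsilon> \<in> {\<epsilon>. 2 * \<delta> + (2 * A\<^sup>2 + 2 * real M + 16) / \<upsilon> + 81920 * real M * (g / (real N * q * \<upsilon>))
          < \<bar>g\<^sup>2 / (\<upsilon> * V) * (H \<epsilon> - V / g) - (g - real (deg N \<epsilon> w)) / \<upsilon>\<bar>}"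
        and "\<epsilon> \<notin> Bad1 \<union> Bad2 \<union> Bad3"
      then have "\<epsilon> \<notin> Bad1" "\<epsilon> \<notin> Bad2" "\<epsilon> \<notin> Bad3" by blast+
      from leD[OF bound[OF this]] show False using err unfolding mem_Collect_eq by (rule notE)
    qed
  qed simp
  also have "\<dots> \<le> measure_pmf.prob law Bad1 + measure_pmf.prob law Bad2 + measure_pmf.prob law Bad3"
    by (intro order.trans[OF measure_Un_le] add_mono measure_Un_le order_refl) auto
  also have "measure_pmf.prob law Bad1 \<le> 4 / real N"
    unfolding Bad1_def by (rule prob_not_good[OF Nq])
  also have "measure_pmf.prob law Bad2 \<le> 1 / A\<^sup>2"
  proof -
    have "measure_pmf.prob law Bad2 \<le> var (B w) / (A * \<upsilon>)\<^sup>2"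
      unfolding Bad2_def g_def by (rule prob_deg_deviation[OF w]) (use A \<upsilon> in simp)
    also have "\<dots> = 1 / A\<^sup>2" unfolding \<upsilon>2[symmetric] using \<upsilon> by (simp add: power_mult_distrib)
    finally show ?thesis .
  qed
  also have "measure_pmf.prob law Bad3 \<le> 2 / \<delta>\<^sup>2 * (sd_deg_avg M N p q / \<upsilon> * (g / G) / sqrt (real N))\<^sup>2"
  proof -
    have "0 \<le> block_avg M var"
      unfolding block_avg_def using var_bounds(1) by (intro mult_nonneg_nonneg sum_nonneg) auto
    then have sd: "(sd_deg_avg M N p q)\<^sup>2 = block_avg M var" by (simp add: sd_deg_avg_def)
    have "measure_pmf.prob law Bad3 \<le> 2 * real N * block_avg M var / t\<^sup>2"
      unfolding Bad3_def V_def G_def by (rule prob_vol_deviation[OF t0])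
    also have "\<dots> = 2 / \<delta>\<^sup>2 * (sd_deg_avg M N p q / \<upsilon> * (g / G) / sqrt (real N))\<^sup>2"
      using N0 \<delta> g0 G0 \<upsilon>
      by (simp add: t_def V_def sd power_mult_distrib power_divide) (simp add: power2_eq_square)
    finally show ?thesis .
  qed
  finally show ?thesis by simp
qed

end

section \<open>Convergence in distribution\<close>

text \<open>Slutsky's argument for characteristic functions: \<open>iexp\<close> is 1-Lipschitz,
  which serves where \<open>X\<close> and \<open>Y\<close> are close, and elsewhere two of its
  values differ by at most 2. So closeness in probability is enough to exchange \<open>X\<close> for
  \<open>Y\<close>.\<close>

lemma (in bernoulli_family) norm_char_diff_le:
  fixes X Y :: "('e \<Rightarrow> bool) \<Rightarrow> real"
  assumes \<tau>: "0 \<le> \<tau>"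
  shows "cmod (measure_pmf.expectation law (\<lambda>\<epsilon>. iexp (t * X \<epsilon>)) - measure_pmf.expectation law (\<lambda>\<epsilon>. iexp (t * Y \<epsilon>)))
    \<le> \<bar>t\<bar> * \<tau> + 2 * measure_pmf.prob law {\<epsilon>. \<tau> < \<bar>X \<epsilon> - Y \<epsilon>\<bar>}"
proof -
  define Z where "Z = {\<epsilon>. \<tau> < \<bar>X \<epsilon> - Y \<epsilon>\<bar>}"
  have pointwise: "cmod (iexp (t * X \<epsilon>) - iexp (t * Y \<epsilon>)) \<le> \<bar>t\<bar> * \<tau> + 2 * indicator Z \<epsilon>" for \<epsilon>
  proof (cases "\<epsilon> \<in> Z")
    case True
    have "cmod (iexp (t * X \<epsilon>) - iexp (t * Y \<epsilon>)) \<le> cmod (iexp (t * X \<epsilon>)) + cmod (iexp (t * Y \<epsilon>))"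
      by (rule norm_triangle_ineq4)
    also have "\<dots> = 2" unfolding norm_exp_i_times by simp
    moreover have "0 \<le> \<bar>t\<bar> * \<tau>" using \<tau> by simp
    ultimately show ?thesis using True by simp
  next
    case False
    have "iexp (t * X \<epsilon>) - iexp (t * Y \<epsilon>) = iexp (t * Y \<epsilon>) * (iexp (t * (X \<epsilon> - Y \<epsilon>)) - 1)"
      by (simp add: algebra_simps flip: exp_add)
    then have "cmod (iexp (t * X \<epsilon>) - iexp (t * Y \<epsilon>)) = cmod (iexp (t * (X \<epsilon> - Y \<epsilon>)) - 1)"
      by (simp only: norm_mult norm_exp_i_times)
    also have "\<dots> \<le> \<bar>t * (X \<epsilon> - Y \<epsilon>)\<bar>" using iexp_approx1[of "t * (X \<epsilon> - Y \<epsilon>)" 0] by simp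
    also have "\<dots> \<le> \<bar>t\<bar> * \<tau>" using False by (simp add: abs_mult Z_def mult_left_mono)
    finally show ?thesis using False by simp
  qed
  have "cmod (measure_pmf.expectation law (\<lambda>\<epsilon>. iexp (t * X \<epsilon>)) - measure_pmf.expectation law (\<lambda>\<epsilon>. iexp (t * Y \<epsilon>)))
      = cmod (measure_pmf.expectation law (\<lambda>\<epsilon>. iexp (t * X \<epsilon>) - iexp (t * Y \<epsilon>)))"
    by (subst Bochner_Integration.integral_diff) simp_all
  also have "\<dots> \<le> measure_pmf.expectation law (\<lambda>\<epsilon>. cmod (iexp (t * X \<epsilon>) - iexp (t * Y \<epsilon>)))"
    by (rule integral_norm_bound)
  also have "\<dots> \<le> measure_pmf.expectation law (\<lambda>\<epsilon>. \<bar>t\<bar> * \<tau> + 2 * indicator Z \<epsilon>)"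
    by (intro integral_mono integrable_law pointwise)
  also have "\<dots> = \<bar>t\<bar> * \<tau> + 2 * measure_pmf.prob law Z"
    by (subst Bochner_Integration.integral_add) simp_all
  finally show ?thesis unfolding Z_def .
qed

section \<open>The growth conditions turned into inequalities for fixed \<open>N\<close>\<close>

context block_model
begin

text \<open>With \<open>Q = (M - 1) q\<close>, the last quantity is at most \<open>p\<^sub>m / (Q \<upsilon>\<^sub>m) + 1 / \<upsilon>\<^sub>m\<close>. If \<open>p\<^sub>m\<^sub>i\<^sub>n \<le> Q\<close>, then
  \<open>p\<^sub>m / Q \<le> p\<^sub>m\<^sub>a\<^sub>x / p\<^sub>m\<^sub>i\<^sub>n\<close>, which the first condition controls; otherwise \<open>\<gamma>\<^sub>m\<^sub>i\<^sub>n \<le> 2 (N / M) p\<^sub>m\<^sub>i\<^sub>n\<close>, and the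
  fourth condition gives the bound.\<close>

lemma asymptotic_bounds:
  assumes pmin: "0 < p_min M p" and q: "0 < q" and L: "1 \<le> L" and m: "m \<in> {1..M}"
    and a: "a \<le> 1" and c: "c \<le> 1"
    and cond1: "\<And>l. l \<in> {1..M} \<Longrightarrow> 0 < var l \<and> L ^ 4 / var l * ((p_max M p)\<^sup>2 / (p_min M p)\<^sup>2) \<le> a"
    and cond4: "\<gamma> m / sd_deg M N p q m * ((p_min M p)\<^sup>2 / (exp_deg_min M N p q * (real M - 1)\<^sup>2 * q\<^sup>2)) \<le> c"
  shows "L\<^sup>2 \<le> sd_deg M N p q m" "L\<^sup>2 / 2 \<le> real N * q"
    "\<gamma> m / (real N * q * sd_deg M N p q m) \<le> sqrt a + 2 * c + 1 / sd_deg M N p q m"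
proof -
  define \<upsilon> where "\<upsilon> = sd_deg M N p q m"
  define Q where "Q = (real M - 1) * q"
  define pm where "pm = p_min M p"
  define pM where "pM = p_max M p"
  define gm where "gm = exp_deg_min M N p q"
  have ne: "{1..M} \<noteq> {}" using M by auto
  have bs0: "0 < bs" using N M by (simp add: bs_def)
  have Q0: "0 < Q" using q M by (simp add: Q_def)
  have pm0: "0 < pm" using pmin by (simp add: pm_def)
  have \<gamma>: "\<gamma> l = bs * (p l + Q)" for l unfolding exp_deg_def bs_def[symmetric] Q_def by (simp add: distrib_left)
  have p_bounds: "pm \<le> p l" "p l \<le> pM" if "l \<in> {1..M}" for l
    using that by (auto simp: pm_def p_min_def pM_def p_max_def)
  have \<upsilon>2: "\<upsilon>\<^sup>2 = var m" using var_bounds[OF m] by (simp add: \<upsilon>_def sd_deg_def)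
  have \<upsilon>0: "0 < \<upsilon>" using cond1[OF m] by (simp add: \<upsilon>_def sd_deg_def)
  have r1: "1 \<le> pM / pm" using p_bounds[OF m] pm0 by simp
  have L4: "1 \<le> L ^ 4" using L by (simp add: one_le_power)
  have var_ge: "L ^ 4 * (pM / pm)\<^sup>2 \<le> a * var l" if "l \<in> {1..M}" for l
  proof -
    have "L ^ 4 / var l * (pM / pm)\<^sup>2 * var l \<le> a * var l"
      using cond1[OF that] by (intro mult_right_mono) (auto simp: pM_def pm_def power_divide)
    then show ?thesis using cond1[OF that] by simp
  qed
  have var_ge': "L ^ 4 \<le> var l" if l: "l \<in> {1..M}" for l
  proof -
    have "L ^ 4 * 1 \<le> L ^ 4 * (pM / pm)\<^sup>2" using L4 r1 by (intro mult_left_mono one_le_power) auto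
    also have "\<dots> \<le> a * var l" by (rule var_ge[OF l])
    also have "\<dots> \<le> 1 * var l" using a var_bounds(1)[OF l] by (rule mult_right_mono)
    finally show ?thesis by simp
  qed
  have "(L\<^sup>2)\<^sup>2 \<le> \<upsilon>\<^sup>2" using var_ge'[OF m] by (simp add: \<upsilon>2 flip: power_mult)
  then have \<upsilon>L: "L\<^sup>2 \<le> \<upsilon>" by (rule power2_le_imp_le) (use \<upsilon>0 in simp)
  then show "L\<^sup>2 \<le> sd_deg M N p q m" by (simp add: \<upsilon>_def)
  have "gm \<in> \<gamma> ` {1..M}" unfolding gm_def exp_deg_min_def using ne by (intro Min_in) auto
  then obtain l1 where l1: "l1 \<in> {1..M}" "gm = \<gamma> l1" by auto
  have gm_L: "L ^ 4 \<le> gm" using var_ge'[OF l1(1)] var_bounds(2)[OF l1(1)] l1(2) by linarith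
  then have gm0: "0 < gm" using L4 by linarith
  have "pm \<in> p ` {1..M}" unfolding pm_def p_min_def using ne by (intro Min_in) auto
  then obtain l0 where l0: "l0 \<in> {1..M}" "pm = p l0" by auto
  have "gm \<le> \<gamma> l0" unfolding gm_def exp_deg_min_def using l0 by simp
  then have gm_le: "gm \<le> bs * (pm + Q)" by (simp add: \<gamma> l0)
  have g\<upsilon>: "\<upsilon>\<^sup>2 \<le> \<gamma> m" unfolding \<upsilon>2 by (rule var_bounds[OF m])
  have gp: "bs * p m \<le> \<gamma> m" using bs0 Q0 by (simp add: \<gamma> mult_left_mono)
  have "\<gamma> m / \<upsilon> * (pm\<^sup>2 / (gm * Q\<^sup>2)) \<le> c"
    using cond4 by (simp add: \<upsilon>_def pm_def gm_def Q_def power_mult_distrib mult.assoc)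
  then have c4: "\<gamma> m * pm\<^sup>2 \<le> c * (\<upsilon> * gm * Q\<^sup>2)"
    using \<upsilon>0 gm0 Q0 by (simp add: field_simps)
  have "bs * Q \<le> real N * q" using M q N by (simp add: bs_def Q_def field_simps)
  \<comment> \<open>If \<open>pm \<le> Q\<close>, already the minimal expected degree, which is at
    least \<open>L ^ 4\<close>, is at most \<open>2 * bs * Q\<close>. Otherwise \<open>c4\<close>
    bounds \<open>Q\<close> from below: together with \<open>gm / 2 \<le> bs * pm\<close> it gives
    \<open>\<upsilon> * gm / 4 \<le> (bs * Q)\<^sup>2\<close>, and \<open>\<upsilon> * gm\<close> is
    at least \<open>L ^ 4\<close>.\<close>
  moreover have "L\<^sup>2 / 2 \<le> bs * Q"
  proof (cases "pm \<le> Q")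
    case True
    have "L\<^sup>2 * 1 \<le> L\<^sup>2 * L\<^sup>2" using L by (intro mult_left_mono) auto
    then have "L\<^sup>2 \<le> L ^ 4" by (simp add: power2_eq_square power4_eq_xxxx mult.assoc)
    also have "\<dots> \<le> bs * (pm + Q)" using gm_L gm_le by linarith
    also have "\<dots> \<le> bs * (2 * Q)" using True bs0 by (intro mult_left_mono) auto
    finally show ?thesis by simp
  next
    case False
    define x where "x = bs * Q"
    have x0: "0 \<le> x" using bs0 Q0 by (simp add: x_def)
    have "bs * (pm + Q) \<le> bs * (2 * pm)" using False bs0 by (intro mult_left_mono) auto
    then have y: "gm / 2 \<le> bs * pm" using gm_le by simp
    have "\<upsilon>\<^sup>2 * pm\<^sup>2 \<le> \<gamma> m * pm\<^sup>2" using g\<upsilon> by (intro mult_right_mono) auto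
    also have "\<dots> \<le> c * (\<upsilon> * gm * Q\<^sup>2)" by (rule c4)
    also have "\<dots> \<le> 1 * (\<upsilon> * gm * Q\<^sup>2)"
      using \<upsilon>0 gm0 by (intro mult_right_mono c) auto
    finally have "\<upsilon> * (\<upsilon> * pm\<^sup>2) \<le> \<upsilon> * (gm * Q\<^sup>2)" by (simp add: power2_eq_square mult_ac)
    then have "\<upsilon> * pm\<^sup>2 \<le> gm * Q\<^sup>2" using \<upsilon>0 by simp
    then have "bs\<^sup>2 * (\<upsilon> * pm\<^sup>2) \<le> bs\<^sup>2 * (gm * Q\<^sup>2)" by (intro mult_left_mono) auto
    then have "\<upsilon> * (bs * pm)\<^sup>2 \<le> gm * x\<^sup>2" by (simp add: x_def power_mult_distrib mult_ac)
    moreover have "\<upsilon> * (gm / 2)\<^sup>2 \<le> \<upsilon> * (bs * pm)\<^sup>2"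
      using y gm0 \<upsilon>0 by (intro mult_left_mono power_mono) auto
    ultimately have "gm * (\<upsilon> * gm / 4) \<le> gm * x\<^sup>2" by (simp add: power2_eq_square mult_ac)
    then have "\<upsilon> * gm / 4 \<le> x\<^sup>2" using gm0 by (simp only: mult_le_cancel_left_pos)
    moreover have "1 * L ^ 4 \<le> \<upsilon> * gm"
      using order.trans[OF one_le_power[OF L] \<upsilon>L] gm_L \<upsilon>0 L by (intro mult_mono) auto
    ultimately have "(L\<^sup>2 / 2)\<^sup>2 \<le> x\<^sup>2" by (simp add: power2_eq_square power4_eq_xxxx)
    then show ?thesis unfolding x_def[symmetric] using x0 by (rule power2_le_imp_le)
  qed
  ultimately show "L\<^sup>2 / 2 \<le> real N * q" by linarith
  have "0 \<le> L ^ 4 * (pM / pm)\<^sup>2" using L by simp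
  then have a0: "0 \<le> a * var m" using var_ge[OF m] by linarith
  have a_nonneg: "0 \<le> a" using a0 cond1[OF m] by (simp add: zero_le_mult_iff)
  have c_nonneg: "0 \<le> c"
  proof -
    have "0 \<le> \<gamma> m * pm\<^sup>2" using \<gamma>_nonneg[OF m] by simp
    then have "0 \<le> c * (\<upsilon> * gm * Q\<^sup>2)" using c4 by linarith
    moreover have "0 < \<upsilon> * gm * Q\<^sup>2" using \<upsilon>0 gm0 Q0 by simp
    ultimately show ?thesis by (metis mult_neg_pos not_le)
  qed
  have main: "p m / (Q * \<upsilon>) \<le> sqrt a + 2 * c"
  proof (cases "pm \<le> Q")
    case True
    have "(pM / pm)\<^sup>2 * 1 \<le> (pM / pm)\<^sup>2 * L ^ 4" using L4 by (intro mult_left_mono) auto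
    also have "\<dots> \<le> a * \<upsilon>\<^sup>2" unfolding \<upsilon>2 using var_ge[OF m] by (simp add: mult.commute)
    finally have "(pM / pm)\<^sup>2 \<le> a * \<upsilon>\<^sup>2" by simp
    moreover have "0 < \<upsilon>\<^sup>2" using \<upsilon>0 by simp
    ultimately have "(pM / pm / \<upsilon>)\<^sup>2 \<le> a"
      unfolding power_divide[of "pM / pm" \<upsilon>] by (simp only: pos_divide_le_eq)
    then have "pM / pm / \<upsilon> \<le> sqrt a" by (rule real_le_rsqrt)
    moreover have "p m / (Q * \<upsilon>) \<le> pM / pm / \<upsilon>"
      using True pm0 Q0 \<upsilon>0 p_bounds[OF m] by (simp add: frac_le mult_mono)
    ultimately show ?thesis using c_nonneg by linarith
  next
    case False
    have "bs * p m * pm\<^sup>2 \<le> \<gamma> m * pm\<^sup>2" using gp by (intro mult_right_mono) auto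
    also have "\<dots> \<le> c * (\<upsilon> * gm * Q\<^sup>2)" by (rule c4)
    also have "\<dots> \<le> c * (\<upsilon> * (bs * (2 * pm)) * (Q * pm))"
    proof -
      have "bs * (pm + Q) \<le> bs * (2 * pm)" using False bs0 by (intro mult_left_mono) auto
      then have "gm \<le> bs * (2 * pm)" using gm_le by linarith
      then show ?thesis
        using c_nonneg \<upsilon>0 gm0 Q0 False bs0 pm0 unfolding power2_eq_square by (intro mult_left_mono mult_mono) auto
    qed
    finally have "(bs * pm\<^sup>2) * p m \<le> (bs * pm\<^sup>2) * (2 * c * (Q * \<upsilon>))"
      by (simp add: power2_eq_square mult_ac)
    then have "p m \<le> 2 * c * (Q * \<upsilon>)" using bs0 pm0 by simp
    then have "p m / (Q * \<upsilon>) \<le> 2 * c" using Q0 \<upsilon>0 by (simp add: divide_le_eq)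
    then show ?thesis using real_sqrt_ge_zero[OF a_nonneg] by linarith
  qed
  have "\<gamma> m / (real N * q * \<upsilon>) \<le> \<gamma> m / (bs * Q * \<upsilon>)"
    using \<open>bs * Q \<le> real N * q\<close> \<gamma>_nonneg[OF m] bs0 Q0 \<upsilon>0 q N
    by (intro divide_left_mono mult_right_mono mult_pos_pos) auto
  also have "\<dots> = p m / (Q * \<upsilon>) + 1 / \<upsilon>"
    unfolding \<gamma> using bs0 Q0 \<upsilon>0 by (simp add: field_simps)
  also have "\<dots> \<le> sqrt a + 2 * c + 1 / \<upsilon>" using main by simp
  finally show "\<gamma> m / (real N * q * sd_deg M N p q m) \<le> sqrt a + 2 * c + 1 / sd_deg M N p q m"
    unfolding \<upsilon>_def .
qed

lemma norm_char_deg_diff_le: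
  assumes w: "w \<in> verts N" and var: "0 < var (B w)"
  shows "cmod (measure_pmf.expectation law (\<lambda>\<epsilon>. iexp (t * ((\<gamma> (B w) - real (deg N \<epsilon> w)) / sd_deg M N p q (B w))))
      - exp (- (t\<^sup>2) / 2)) \<le> \<bar>t\<bar> ^ 3 / (6 * sd_deg M N p q (B w)) + t ^ 4 / (16 * (sd_deg M N p q (B w))\<^sup>2)"
  unfolding deg_centered[OF w]
  by (rule norm_char_count_diff_le[OF star_subset[OF w order_refl]])
    (use var in \<open>simp_all add: sd_deg_def star_variance[OF w]\<close>)

end

theorem theorem1p3:
  fixes M :: nat and B :: "nat \<Rightarrow> nat \<Rightarrow> nat"
    and p :: "nat \<Rightarrow> nat \<Rightarrow> real" and q :: "nat \<Rightarrow> real"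
    and w :: "nat \<Rightarrow> nat" and m :: "nat \<Rightarrow> nat" and \<kappa> :: ennreal
    and H :: "nat \<Rightarrow> graph \<Rightarrow> real"
  assumes M: "1 \<le> M"
    and blocks: "\<And>N. M dvd N \<Longrightarrow> M < N \<Longrightarrow> equal_blocks M N (B N)"
    and p_range: "\<And>N l. M dvd N \<Longrightarrow> M < N \<Longrightarrow> l \<in> {1..M} \<Longrightarrow> 0 \<le> p N l \<and> p N l \<le> 1"
    and q_range: "\<And>N. M dvd N \<Longrightarrow> M < N \<Longrightarrow> 0 \<le> q N \<and> q N \<le> 1"
    and p_decreasing: "\<And>N k l. M dvd N \<Longrightarrow> M < N \<Longrightarrow> 1 \<le> k \<Longrightarrow> k \<le> l \<Longrightarrow> l \<le> M \<Longrightarrow> p N l \<le> p N k"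
    and w: "\<And>N. M dvd N \<Longrightarrow> M < N \<Longrightarrow> w N \<in> verts N"
    and m: "\<And>N. M dvd N \<Longrightarrow> M < N \<Longrightarrow> m N = B N (w N)"
    and H: "\<And>N \<epsilon>. M dvd N \<Longrightarrow> M < N \<Longrightarrow> connected_graph N \<epsilon> \<Longrightarrow>
              H N \<epsilon> = enn2real (mean_hitting_time N \<epsilon> (w N))"
    \<comment> \<open>the denominators in the following conditions do not vanish\<close>
    and p_min_pos: "\<forall>\<^sub>F N in multiples M. p_min M (p N) > 0"
    and q_pos: "\<forall>\<^sub>F N in multiples M. (real M - 1) * q N > 0"
    and var_pos: "\<And>l. l \<in> {1..M} \<Longrightarrow> \<forall>\<^sub>F N in multiples M. var_deg M N (p N) (q N) l > 0"
    and kappa: "((\<lambda>N. ennreal ((real M - 1) * q N / p_min M (p N))) \<longlongrightarrow> \<kappa>) (multiples M)"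
    and cond1: "\<And>l. l \<in> {1..M} \<Longrightarrow>
      ((\<lambda>N. real M * ln (real N) ^ 4 /
              (real N * p N l * (1 - p N l) + real N * (real M - 1) * q N * (1 - q N))
            * ((p_max M (p N))\<^sup>2 / (p_min M (p N))\<^sup>2)) \<longlongrightarrow> 0) (multiples M)"
    and cond2: "much_less (multiples M)
      (\<lambda>N. exp_deg M N (p N) (q N) (m N) / exp_deg_avg M N (p N) (q N))
      (\<lambda>N. sd_deg M N (p N) (q N) (m N) / block_avg M (p N))"
    and cond3: "much_less (multiples M)
      (\<lambda>N. sd_deg_avg M N (p N) (q N) / sd_deg M N (p N) (q N) (m N)
           * (exp_deg M N (p N) (q N) (m N) / exp_deg_avg M N (p N) (q N)))
      (\<lambda>N. sqrt (real N))"
    and cond4: "((\<lambda>N. exp_deg M N (p N) (q N) (m N) / sd_deg M N (p N) (q N) (m N)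
           * ((p_min M (p N))\<^sup>2
              / (exp_deg_min M N (p N) (q N) * (real M - 1)\<^sup>2 * (q N)\<^sup>2))) \<longlongrightarrow> 0) (multiples M)"
  defines "X \<equiv> \<lambda>N \<epsilon>. (exp_deg M N (p N) (q N) (m N))\<^sup>2
             / (real N * sd_deg M N (p N) (q N) (m N) * exp_deg_avg M N (p N) (q N))
             * (H N \<epsilon> - real N * exp_deg_avg M N (p N) (q N) / exp_deg M N (p N) (q N) (m N))"
  shows "weak_conv_m (\<lambda>k. let N = M * k in distr (measure_pmf (sbm N (B N) (p N) (q N))) borel (X N))
           std_normal_distribution"
proof -
  define F where "F = multiples M"
  define \<upsilon> where "\<upsilon> N = sd_deg M N (p N) (q N) (m N)" for N
  define g where "g N = exp_deg M N (p N) (q N) (m N)" for N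
  define G where "G N = exp_deg_avg M N (p N) (q N)" for N
  \<comment> \<open>Summing over the blocks merges the \<open>M\<close> conditions into a single
    null sequence that dominates each of them.\<close>
  define a where "a N = (\<Sum>l=1..M. real M * ln (real N) ^ 4 /
      (real N * p N l * (1 - p N l) + real N * (real M - 1) * q N * (1 - q N))
      * ((p_max M (p N))\<^sup>2 / (p_min M (p N))\<^sup>2))" for N
  define c where "c N = g N / \<upsilon> N * ((p_min M (p N))\<^sup>2
      / (exp_deg_min M N (p N) (q N) * (real M - 1)\<^sup>2 * (q N)\<^sup>2))" for N
  define \<rho> where "\<rho> N = g N / (real N * q N * \<upsilon> N)" for N
  define s where "s N = sd_deg_avg M N (p N) (q N) / \<upsilon> N * (g N / G N) / sqrt (real N)" for N
  define Y where "Y N \<epsilon> = (g N - real (deg N \<epsilon> (w N))) / \<upsilon> N" for N \<epsilon>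
  define P where "P N = measure_pmf (sbm N (B N) (p N) (q N))" for N
  have X: "X N \<epsilon> = (g N)\<^sup>2 / (real N * \<upsilon> N * G N) * (H N \<epsilon> - real N * G N / g N)" for N \<epsilon>
    by (simp add: X_def g_def \<upsilon>_def G_def)
  have F_eq: "F = filtermap (\<lambda>k. M * k) sequentially"
    unfolding F_def by (rule multiples_eq[OF M])
  have F_bot: "F \<noteq> bot" by (simp add: F_eq filtermap_bot_iff)
  have evF: "\<forall>\<^sub>F N in F. M dvd N \<and> M < N"
    by (simp add: F_def multiples_def eventually_inf_principal)
  \<comment> \<open>For \<open>M = 1\<close> the factor \<open>M - 1\<close> vanishes, which
    contradicts the positivity of \<open>(M - 1) * q N\<close> along a nontrivial filter.\<close>
  have M2: "2 \<le> M"
  proof (rule ccontr)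
    assume "\<not> 2 \<le> M"
    then have "M = 1" using M by simp
    then have "\<forall>\<^sub>F N in F. False" using q_pos by (simp add: F_def)
    then show False using F_bot by (simp add: eventually_False)
  qed
  have model: "block_model M N (B N) (p N) (q N)" if "M dvd N" "M < N" for N
    using that M2 blocks p_range q_range by unfold_locales auto
  have mN: "m N \<in> {1..M}" if NM: "M dvd N" "M < N" for N
    unfolding m[OF NM] by (rule block_model.B_range[OF model[OF NM] w[OF NM]])
  have ln_top: "filterlim (\<lambda>N. ln (real N)) at_top F"
  proof (rule filterlim_mono[OF _ order_refl])
    show "filterlim (\<lambda>N. ln (real N)) at_top sequentially"
      by (rule filterlim_compose[OF ln_at_top filterlim_real_sequentially])
    show "F \<le> sequentially" by (simp add: F_def multiples_def)
  qed
  have N_top: "filterlim (\<lambda>N. real N) at_top F"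
    by (rule filterlim_mono[OF filterlim_real_sequentially order_refl]) (simp add: F_def multiples_def)
  have a_lim: "(a \<longlongrightarrow> 0) F"
    unfolding a_def F_def by (rule tendsto_null_sum) (use cond1 in auto)
  have c_lim: "(c \<longlongrightarrow> 0) F" using cond4 unfolding c_def g_def \<upsilon>_def F_def .
  have s_lim: "(s \<longlongrightarrow> 0) F" using cond3 unfolding much_less_def s_def g_def \<upsilon>_def G_def F_def .
  have "\<forall>\<^sub>F N in F. \<forall>l\<in>{1..M}. var_deg M N (p N) (q N) l > 0"
    unfolding F_def by (intro eventually_ball_finite ballI var_pos) auto
  moreover have "\<forall>\<^sub>F N in F. a N < 1" "\<forall>\<^sub>F N in F. c N < 1"
    by (intro order_tendstoD(2)[OF a_lim] order_tendstoD(2)[OF c_lim]; simp)+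
  \<comment> \<open>For \<open>L = ln N \<ge> 64\<close> the bound
    \<open>L\<^sup>2 / 2 \<le> N q\<close> implies \<open>32 * L \<le> N q\<close>, the threshold of
    the union bound over cuts.\<close>
  moreover have "\<forall>\<^sub>F N in F. 64 \<le> ln (real N)"
    using ln_top by (simp add: filterlim_at_top)
  ultimately have asymp: "\<forall>\<^sub>F N in F. M dvd N \<and> M < N \<and> 64 \<le> ln (real N) \<and> 0 < q N \<and> 0 < var_deg M N (p N) (q N) (m N)
      \<and> ln (real N) \<le> \<upsilon> N \<and> 32 * ln (real N) \<le> real N * q N
      \<and> 0 \<le> \<rho> N \<and> \<rho> N \<le> sqrt (a N) + 2 * c N + 1 / \<upsilon> N"
    using evF p_min_pos[folded F_def] q_pos[folded F_def]
  proof eventually_elim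
    case (elim N)
    then have NM: "M dvd N" "M < N" by auto
    interpret block_model M N "B N" "p N" "q N" by (rule model[OF NM])
    have q0: "0 < q N" using elim M2 by (simp add: zero_less_mult_iff)
    have L: "1 \<le> ln (real N)" using elim by linarith
    \<comment> \<open>The denominator in the first growth condition is \<open>M\<close> times the
      degree variance, and this \<open>M\<close> cancels the one in the numerator.\<close>
    have denom: "real N * p N l * (1 - p N l) + real N * (real M - 1) * q N * (1 - q N)
        = real M * var_deg M N (p N) (q N) l" for l
      using M2 by (simp add: var_deg_def field_simps)
    have a_eq: "a N = (\<Sum>l=1..M. ln (real N) ^ 4 / var_deg M N (p N) (q N) l * ((p_max M (p N))\<^sup>2 / (p_min M (p N))\<^sup>2))"
      unfolding a_def denom using M2 by simp
    have cond1': "0 < var_deg M N (p N) (q N) l \<and>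
        ln (real N) ^ 4 / var_deg M N (p N) (q N) l * ((p_max M (p N))\<^sup>2 / (p_min M (p N))\<^sup>2) \<le> a N"
      if l: "l \<in> {1..M}" for l
    proof
      show "0 < var_deg M N (p N) (q N) l" using elim l by blast
      show "ln (real N) ^ 4 / var_deg M N (p N) (q N) l * ((p_max M (p N))\<^sup>2 / (p_min M (p N))\<^sup>2) \<le> a N"
        unfolding a_eq
        by (rule member_le_sum[OF l]) (auto intro!: divide_nonneg_nonneg mult_nonneg_nonneg var_bounds(1))
    qed
    note bounds = asymptotic_bounds[OF _ q0 L mN[OF NM] _ _ cond1', of "c N"]
    have c_le: "exp_deg M N (p N) (q N) (m N) / sd_deg M N (p N) (q N) (m N) * ((p_min M (p N))\<^sup>2
      / (exp_deg_min M N (p N) (q N) * (real M - 1)\<^sup>2 * (q N)\<^sup>2)) \<le> c N"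
      by (simp add: c_def g_def \<upsilon>_def)
    have L2: "64 * ln (real N) \<le> (ln (real N))\<^sup>2"
      unfolding power2_eq_square using elim by (intro mult_right_mono) auto
    have "(ln (real N))\<^sup>2 \<le> \<upsilon> N" unfolding \<upsilon>_def by (rule bounds(1)) (use elim c_le in auto)
    moreover have "(ln (real N))\<^sup>2 / 2 \<le> real N * q N" by (rule bounds(2)) (use elim c_le in auto)
    moreover have "\<rho> N \<le> sqrt (a N) + 2 * c N + 1 / \<upsilon> N"
      unfolding \<rho>_def g_def \<upsilon>_def by (rule bounds(3)) (use elim c_le in auto)
    moreover have "0 \<le> \<rho> N"
      unfolding \<rho>_def g_def using \<gamma>_nonneg[OF mN[OF NM]] q0 L L2 \<open>(ln (real N))\<^sup>2 \<le> \<upsilon> N\<close>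
      by (intro divide_nonneg_nonneg mult_nonneg_nonneg) auto
    ultimately show ?case using NM q0 L2 L elim mN[OF NM] by auto
  qed
  have ln_inv: "((\<lambda>N. 1 / ln (real N)) \<longlongrightarrow> 0) F"
    by (rule tendsto_divide_0[OF tendsto_const filterlim_at_top_imp_at_infinity[OF ln_top]])
  have \<upsilon>_inv: "((\<lambda>N. 1 / \<upsilon> N) \<longlongrightarrow> 0) F"
  proof (rule tendsto_sandwich[OF _ _ tendsto_const ln_inv])
    show "\<forall>\<^sub>F N in F. 0 \<le> 1 / \<upsilon> N" using asymp by eventually_elim auto
    show "\<forall>\<^sub>F N in F. 1 / \<upsilon> N \<le> 1 / ln (real N)"
      using asymp by eventually_elim (use M2 in \<open>auto intro!: frac_le\<close>)
  qed
  have \<rho>_lim: "(\<rho> \<longlongrightarrow> 0) F"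
  proof (rule tendsto_sandwich[OF _ _ tendsto_const])
    show "\<forall>\<^sub>F N in F. 0 \<le> \<rho> N" using asymp by eventually_elim auto
    show "\<forall>\<^sub>F N in F. \<rho> N \<le> sqrt (a N) + 2 * c N + 1 / \<upsilon> N" using asymp by eventually_elim auto
    have "((\<lambda>N. sqrt (a N) + 2 * c N + 1 / \<upsilon> N) \<longlongrightarrow> sqrt 0 + 2 * 0 + 0) F"
      by (intro tendsto_intros a_lim c_lim \<upsilon>_inv)
    then show "((\<lambda>N. sqrt (a N) + 2 * c N + 1 / \<upsilon> N) \<longlongrightarrow> 0) F" by simp
  qed
  have prob_lim: "((\<lambda>N. measure (P N) {\<epsilon>. \<tau> < \<bar>X N \<epsilon> - Y N \<epsilon>\<bar>}) \<longlongrightarrow> 0) F" if \<tau>: "0 < \<tau>" for \<tau>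
  proof (rule tendstoI)
    fix \<eta> :: real assume \<eta>: "0 < \<eta>"
    \<comment> \<open>Both thresholds are fixed before \<open>N\<close> grows: \<open>A\<close>
      makes the degree term \<open>1 / A\<^sup>2\<close> at most \<open>\<eta> / 4\<close>, and
      \<open>\<delta>\<close> makes the volume term at most \<open>\<tau> / 2\<close>. All other
      terms then vanish in the limit.\<close>
    define A where "A = max 1 (sqrt (4 / \<eta>))"
    define \<delta> where "\<delta> = min 1 (\<tau> / 4)"
    define K where "K = 2 * A\<^sup>2 + 2 * real M + 16"
    have A: "1 \<le> A" and \<delta>: "0 < \<delta>" "\<delta> \<le> 1" "2 * \<delta> \<le> \<tau> / 2" using \<tau> by (auto simp: A_def \<delta>_def)
    have "4 / \<eta> = (sqrt (4 / \<eta>))\<^sup>2" using \<eta> by simp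
    also have "\<dots> \<le> A\<^sup>2" using \<eta> by (intro power_mono) (auto simp: A_def)
    finally have A2: "1 / A\<^sup>2 \<le> \<eta> / 4" using A \<eta> by (simp add: field_simps)
    have "((\<lambda>N. K * (1 / \<upsilon> N) + 81920 * real M * \<rho> N)
        \<longlongrightarrow> K * 0 + 81920 * real M * 0) F"
      by (intro tendsto_intros \<upsilon>_inv \<rho>_lim)
    then have "\<forall>\<^sub>F N in F. K * (1 / \<upsilon> N) + 81920 * real M * \<rho> N < \<tau> / 2"
      by (rule order_tendstoD(2)) (use \<tau> in simp)
    moreover have "((\<lambda>N. 4 / real N + 2 / \<delta>\<^sup>2 * (s N)\<^sup>2) \<longlongrightarrow> 0 + 2 / \<delta>\<^sup>2 * 0\<^sup>2) F"
      by (intro tendsto_add tendsto_mult tendsto_power tendsto_const s_lim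
          tendsto_divide_0[OF tendsto_const filterlim_at_top_imp_at_infinity[OF N_top]])
    then have "\<forall>\<^sub>F N in F. 4 / real N + 2 / \<delta>\<^sup>2 * (s N)\<^sup>2 < \<eta> / 4"
      by (rule order_tendstoD(2)) (use \<eta> in simp)
    moreover have "\<forall>\<^sub>F N in F. 2 * A \<le> ln (real N)"
      using ln_top by (simp add: filterlim_at_top)
    ultimately show "\<forall>\<^sub>F N in F. dist (measure (P N) {\<epsilon>. \<tau> < \<bar>X N \<epsilon> - Y N \<epsilon>\<bar>}) 0 < \<eta>"
      using asymp
    proof eventually_elim
      case (elim N)
      then have NM: "M dvd N" "M < N" by auto
      interpret block_model M N "B N" "p N" "q N" by (rule model[OF NM])
      have "measure (P N) {\<epsilon>. \<tau> < \<bar>X N \<epsilon> - Y N \<epsilon>\<bar>}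
          \<le> measure (P N) {\<epsilon>. 2 * \<delta> + K / \<upsilon> N + 81920 * real M * \<rho> N < \<bar>X N \<epsilon> - Y N \<epsilon>\<bar>}"
        unfolding P_def
      proof (rule measure_pmf.finite_measure_mono)
        have "K * (1 / \<upsilon> N) + 81920 * real M * \<rho> N < \<tau> / 2" using elim by blast
        moreover have "K * (1 / \<upsilon> N) = K / \<upsilon> N" by simp
        ultimately have "2 * \<delta> + K / \<upsilon> N + 81920 * real M * \<rho> N \<le> \<tau>"
          using \<delta>(3) by linarith
        then show "{\<epsilon>. \<tau> < \<bar>X N \<epsilon> - Y N \<epsilon>\<bar>} \<subseteq> {\<epsilon>. 2 * \<delta> + K / \<upsilon> N
            + 81920 * real M * \<rho> N < \<bar>X N \<epsilon> - Y N \<epsilon>\<bar>}"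
          using order.strict_trans1 by blast
      qed simp
      also have "\<dots> \<le> 4 / real N + 1 / A\<^sup>2 + 2 / \<delta>\<^sup>2 * (s N)\<^sup>2"
        unfolding K_def P_def sbm_eq X Y_def \<rho>_def s_def g_def \<upsilon>_def G_def m[OF NM]
        by (rule prob_error_le[OF w[OF NM] _ _ A _ \<delta>(1,2)])
          (use elim H[OF NM] in \<open>auto simp: \<upsilon>_def m[OF NM]\<close>)
      also have "\<dots> < \<eta>" using elim A2 \<eta> by linarith
      finally show ?case by simp
    qed
  qed
  have char_lim: "((\<lambda>N. char (distr (P N) borel (X N)) t) \<longlongrightarrow> char std_normal_distribution t) F" for t
  proof (rule tendstoI)
    fix \<eta> :: real assume \<eta>: "0 < \<eta>"
    \<comment> \<open>Lipschitz part, exceptional event and normal approximation get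
      \<open>\<eta> / 3\<close> each; the \<open>+ 1\<close> covers \<open>t = 0\<close>.\<close>
    define \<tau> where "\<tau> = \<eta> / (3 * (\<bar>t\<bar> + 1))"
    have \<tau>: "0 < \<tau>" using \<eta> by (simp add: \<tau>_def)
    have "\<bar>t\<bar> * \<tau> \<le> (\<bar>t\<bar> + 1) * \<tau>" using \<tau> by (intro mult_right_mono) auto
    moreover have "u * (\<eta> / (3 * u)) = \<eta> / 3" if "0 < u" for u :: real using that by simp
    then have "(\<bar>t\<bar> + 1) * \<tau> = \<eta> / 3" unfolding \<tau>_def by (meson abs_ge_zero add_nonneg_pos zero_less_one)
    ultimately have t\<tau>: "\<bar>t\<bar> * \<tau> \<le> \<eta> / 3" by simp
    have "\<forall>\<^sub>F N in F. measure (P N) {\<epsilon>. \<tau> < \<bar>X N \<epsilon> - Y N \<epsilon>\<bar>} < \<eta> / 6"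
      by (rule order_tendstoD(2)[OF prob_lim[OF \<tau>]]) (use \<eta> in simp)
    moreover have "((\<lambda>N. \<bar>t\<bar> ^ 3 / 6 * (1 / \<upsilon> N) + t ^ 4 / 16 * (1 / \<upsilon> N)\<^sup>2) \<longlongrightarrow> \<bar>t\<bar> ^ 3 / 6 * 0 + t ^ 4 / 16 * 0\<^sup>2) F"
      by (intro tendsto_intros \<upsilon>_inv)
    then have "\<forall>\<^sub>F N in F. \<bar>t\<bar> ^ 3 / 6 * (1 / \<upsilon> N) + t ^ 4 / 16 * (1 / \<upsilon> N)\<^sup>2 < \<eta> / 3"
      by (rule order_tendstoD(2)) (use \<eta> in simp)
    ultimately show "\<forall>\<^sub>F N in F. dist (char (distr (P N) borel (X N)) t) (char std_normal_distribution t) < \<eta>"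
      using asymp
    proof eventually_elim
      case (elim N)
      then have NM: "M dvd N" "M < N" by auto
      interpret block_model M N "B N" "p N" "q N" by (rule model[OF NM])
      define cX where "cX = measure_pmf.expectation law (\<lambda>\<epsilon>. iexp (t * X N \<epsilon>))"
      define cY where "cY = measure_pmf.expectation law (\<lambda>\<epsilon>. iexp (t * Y N \<epsilon>))"
      have charX: "char (distr (P N) borel (X N)) t = cX"
        unfolding char_def P_def sbm_eq cX_def by (subst integral_distr) auto
      have "cmod (cX - cY) \<le> \<bar>t\<bar> * \<tau> + 2 * measure (P N) {\<epsilon>. \<tau> < \<bar>X N \<epsilon> - Y N \<epsilon>\<bar>}"
        unfolding cX_def cY_def P_def sbm_eq by (rule norm_char_diff_le) (use \<tau> in simp)
      moreover have "cmod (cY - exp (- (t\<^sup>2) / 2)) \<le> \<bar>t\<bar> ^ 3 / 6 * (1 / \<upsilon> N) + t ^ 4 / 16 * (1 / \<upsilon> N)\<^sup>2"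
        using norm_char_deg_diff_le[OF w[OF NM], of t] elim
        unfolding cY_def Y_def g_def \<upsilon>_def m[OF NM] by (simp add: power_divide)
      moreover have "dist cX (complex_of_real (exp (- (t\<^sup>2) / 2))) \<le> cmod (cX - cY) + cmod (cY - complex_of_real (exp (- (t\<^sup>2) / 2)))"
        unfolding dist_norm by (rule norm_diff_triangle_le[OF order_refl order_refl])
      ultimately show ?case
        unfolding charX char_std_normal_distribution using t\<tau> elim by simp
    qed
  qed
  show ?thesis
    unfolding Let_def
  \<comment> \<open>Levy's theorem is applied along \<open>k \<mapsto> M * k\<close>, whose image
    filter is \<open>multiples M\<close>. The first indices, where \<open>M < N\<close> fails, are
    harmless: \<open>sbm\<close> is a probability distribution for all parameters.\<close>
  proof (rule levy_continuity)
    show "real_distribution (distr (measure_pmf (sbm (M * k) (B (M * k)) (p (M * k)) (q (M * k)))) borel (X (M * k)))" for k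
      by (rule prob_space.real_distribution_distr[OF prob_space_measure_pmf]) simp
    show "real_distribution std_normal_distribution" by (rule real_dist_normal_dist)
    show "(\<lambda>k. char (distr (measure_pmf (sbm (M * k) (B (M * k)) (p (M * k)) (q (M * k)))) borel (X (M * k))) t)
        \<longlonglongrightarrow> char std_normal_distribution t" for t
      using char_lim[of t] unfolding F_eq filterlim_filtermap P_def .
  qed
qed

end
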